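(* Let $f$ be a complete end of a CMC-1 face in de Sitter 3-space $S^3_1$. Then the end is not hyperbolic; hence it is either elliptic or parabolic. Moreover, the total curvature of the induced metric $ds^2$ over a (sufficiently small) punctured neighborhood of the end is finite.
   Context: $\mathbb R^4_1$ is Lorentz–Minkowski 4-space with signature $(-,+,+,+)$, identified with the $2\times2$ Hermitian matrices by $(x_0,x_1,x_2,x_3)\leftrightarrow\begin{pmatrix} x_0+x_3 & x_1+ix_2 \\ x_1-ix_2 & x_0-x_3 \end{pmatrix}$, so $\langle X,X\rangle=-\det X$. De Sitter 3-space is $S^3_1=\{X=X^*:\det X=-1\}=\{Fe_3F^*:F\in SL_2\mathbb C\}$, with $e_3=\mathrm{diag}(1,-1)$, $X^*={}^t\overline X$. $SU_{1,1}=\{S\in SL_2\mathbb C: Se_3S^*=e_3\}$. CMC-1 face: a $C^\infty$ map $f:M^2\to S^3_1$ from a 2-manifold such that (1) on an open dense set $W$, $f$ is a spacelike immersion of constant mean curvature one; (2) near any singular point $p$ (a point where the induced metric $ds^2=f^*\langle\,,\rangle$ degenerates) there are a neighborhood $U$ and a $C^1$ function $\lambda:U\cap W\to(0,\infty)$ such that $\lambda\,ds^2$ extends to a $C^1$ Riemannian metric on $U$; (3) $df(p)\neq0$ for all $p$. $M^2$ is regarded as a Riemann surface, with $f$ conformal away from its singular points. Known representation: on the universal cover $\widetilde M^2$ there are a meromorphic function $g$ (secondary Gauss map, $|g|\not\equiv1$), a holomorphic 1-form $\omega$ with $(1+|g|^2)^2|\omega|^2$ positive definite, and a holomorphic immersion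 (holomorphic null lift) $F:\widetilde M^2\to SL_2\mathbb C$ with $F^{-1}dF=\begin{pmatrix} g & -g^2 \\ 1 & -g \end{pmatrix}\omega$ and $f=Fe_3F^*$; then $ds^2=(1-|g|^2)^2|\omega|^2$ and the singular set is $\{|g|=1\}$. $F$ is unique up to $F\mapsto FA^{-1}$, $A\in SU_{1,1}$. Complete end: a CMC-1 face $f:\Delta^*=\{0<|z|<1\}\to S^3_1$ such that the singular set does not accumulate at $0$ and every path in $\Delta^*$ tending to $0$ has infinite $ds^2$-length. (A CMC-1 face on $M^2$ is called complete if there is a symmetric 2-tensor $T$ vanishing outside a compact subset of $M^2$ such that $T+ds^2$ is a complete Riemannian metric; every end of a complete CMC-1 face is conformally a punctured disk and is a complete end in this sense.) Type of an end: let $\tau$ be the deck transformation corresponding to the counterclockwise loop about $0$; then $F\circ\tau=F\tilde\rho(\tau)$ with $\tilde\rho(\tau)\in SU_{1,1}$. The end is elliptic, parabolic or hyperbolic if $\tilde\rho(\tau)$ is conjugate in $SU_{1,1}$, respectively, to $\Lambda_e(t)=\mathrm{diag}(e^{it},e^{-it})$ for some $t\in(-\pi,\pi]$; to $\pm\Lambda_p(t)$, $\Lambda_p(t)=\begin{pmatrix} 1+it & -it \\ it & 1-it \end{pmatrix}$, for some $t\in\mathbb R\setminus\{0\}$; to $\pm\Lambda_h(t)$, $\Lambda_h(t)=\begin{pmatrix} \cosh t & \sinh t \\ \sinh t & \cosh t \end{pmatrix}$, for some $t>0$. Every element of $SU_{1,1}$ is of exactly one of these types. Total curvature: the integral of the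 Gaussian curvature $K_{ds^2}$ ($\ge0$) against the area element of $ds^2$. *)

theory Defs
  imports "HOL-Complex_Analysis.Complex_Analysis"
begin

section \<open>Lorentz--Minkowski space and Hermitian matrices\<close>

text \<open>The coordinates \<open>(x\<^sub>0, x\<^sub>1, x\<^sub>2, x\<^sub>3)\<close> are the components \<open>x $ 1, x $ 2, x $ 3, x $ 4\<close>.\<close>

definition lorentz :: "real^4 \<Rightarrow> real^4 \<Rightarrow> real" where
  "lorentz x y = - (x $ 1 * y $ 1) + x $ 2 * y $ 2 + x $ 3 * y $ 3 + x $ 4 * y $ 4"

definition herm :: "real^4 \<Rightarrow> complex^2^2" where
  "herm x = vector
     [vector [of_real (x $ 1 + x $ 4), of_real (x $ 2) + \<i> * of_real (x $ 3)],
      vector [of_real (x $ 2) - \<i> * of_real (x $ 3), of_real (x $ 1 - x $ 4)]]"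

definition hconj :: "complex^2^2 \<Rightarrow> complex^2^2" where
  "hconj A = (\<chi> i j. cnj (A $ j $ i))"

definition e3 :: "complex^2^2" where
  "e3 = vector [vector [1, 0], vector [0, -1]]"

definition de_sitter :: "(real^4) set" where
  "de_sitter = {x. det (herm x) = -1}"

definition SL2C :: "(complex^2^2) set" where
  "SL2C = {A. det A = 1}"

definition SU11 :: "(complex^2^2) set" where
  "SU11 = {S \<in> SL2C. S ** e3 ** hconj S = e3}"


section \<open>Calculus in the coordinate \<open>z = x + \<i> y\<close>\<close>

definition coord_vec :: "2 \<Rightarrow> complex" where
  "coord_vec i = (if i = 1 then 1 else \<i>)"

definition pd :: "2 \<Rightarrow> (complex \<Rightarrow> 'a::real_normed_vector) \<Rightarrow> complex \<Rightarrow> 'a" where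
  "pd i f z = frechet_derivative f (at z) (coord_vec i)"

text \<open>Only meaningful for open sets, since derivatives are taken in the whole plane.\<close>

primrec Ck_on :: "nat \<Rightarrow> complex set \<Rightarrow> (complex \<Rightarrow> 'a::real_normed_vector) \<Rightarrow> bool" where
  "Ck_on 0 S f \<longleftrightarrow> continuous_on S f"
| "Ck_on (Suc k) S f \<longleftrightarrow> (\<forall>z\<in>S. f differentiable (at z)) \<and> (\<forall>i. Ck_on k S (pd i f))"

definition smooth_map_on :: "complex set \<Rightarrow> (complex \<Rightarrow> 'a::real_normed_vector) \<Rightarrow> bool" where
  "smooth_map_on S f \<longleftrightarrow> (\<forall>k. Ck_on k S f)"

definition pos_def :: "real^2^2 \<Rightarrow> bool" where
  "pos_def A \<longleftrightarrow> transpose A = A \<and> (\<forall>v. v \<noteq> 0 \<longrightarrow> v \<bullet> (A *v v) > 0)"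

definition riemannian_C1_on :: "complex set \<Rightarrow> (complex \<Rightarrow> real^2^2) \<Rightarrow> bool" where
  "riemannian_C1_on U h \<longleftrightarrow> Ck_on 1 U h \<and> (\<forall>z\<in>U. pos_def (h z))"


section \<open>Gaussian curvature of a metric on a plane domain\<close>

text \<open>\<open>christoffel h k i j\<close> is \<open>\<Gamma>\<^sup>k\<^sub>i\<^sub>j\<close>, and \<open>riemann h l k i j\<close> is the \<open>\<partial>\<^sub>l\<close>-component of
  \<open>R(\<partial>\<^sub>i, \<partial>\<^sub>j) \<partial>\<^sub>k\<close>.\<close>

definition christoffel :: "(complex \<Rightarrow> real^2^2) \<Rightarrow> 2 \<Rightarrow> 2 \<Rightarrow> 2 \<Rightarrow> complex \<Rightarrow> real" where
  "christoffel h k i j z = (\<Sum>l\<in>UNIV. matrix_inv (h z) $ k $ l *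
     (pd i (\<lambda>w. h w $ j $ l) z + pd j (\<lambda>w. h w $ i $ l) z - pd l (\<lambda>w. h w $ i $ j) z)) / 2"

definition riemann :: "(complex \<Rightarrow> real^2^2) \<Rightarrow> 2 \<Rightarrow> 2 \<Rightarrow> 2 \<Rightarrow> 2 \<Rightarrow> complex \<Rightarrow> real" where
  "riemann h l k i j z =
     pd i (christoffel h l j k) z - pd j (christoffel h l i k) z
     + (\<Sum>m\<in>UNIV. christoffel h l i m z * christoffel h m j k z
                 - christoffel h l j m z * christoffel h m i k z)"

definition gauss_curvature :: "(complex \<Rightarrow> real^2^2) \<Rightarrow> complex \<Rightarrow> real" where
  "gauss_curvature h z = (\<Sum>l\<in>UNIV. h z $ 1 $ l * riemann h l 2 1 2 z) / det (h z)"


section \<open>CMC-1 faces\<close>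

definition induced :: "(complex \<Rightarrow> real^4) \<Rightarrow> complex \<Rightarrow> complex \<Rightarrow> complex \<Rightarrow> real" where
  "induced f z u v = lorentz (frechet_derivative f (at z) u) (frechet_derivative f (at z) v)"

definition ds2 :: "(complex \<Rightarrow> real^4) \<Rightarrow> complex \<Rightarrow> real^2^2" where
  "ds2 f z = (\<chi> i j. induced f z (coord_vec i) (coord_vec j))"

definition singular_set :: "complex set \<Rightarrow> (complex \<Rightarrow> real^4) \<Rightarrow> complex set" where
  "singular_set M f = {z \<in> M. det (ds2 f z) = 0}"

text \<open>
  The unit normal is the one compatible with the orientation of the Riemann surface.  The
  orientation of de Sitter space is the one for which the surfaces \<open>F e\<^sub>3 F\<^sup>*\<close> with \<open>F\<close> holomorphic
  and null have mean curvature \<open>1\<close> rather than \<open>-1\<close>: for \<open>F(z) = (1, 0; z, 1)\<close> at \<open>z = 0\<close> one has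
  \<open>f\<^sub>x = (0,1,0,0)\<close>, \<open>f\<^sub>y = (0,0,-1,0)\<close>, \<open>f = (0,0,0,1)\<close> and \<open>\<nu> = (-1,0,0,0)\<close>.
\<close>

definition unit_normal :: "(complex \<Rightarrow> real^4) \<Rightarrow> complex \<Rightarrow> real^4 \<Rightarrow> bool" where
  "unit_normal f z \<nu> \<longleftrightarrow>
     lorentz \<nu> \<nu> = -1 \<and> lorentz \<nu> (f z) = 0 \<and> (\<forall>i. lorentz \<nu> (pd i f z) = 0) \<and>
     det (vector [pd 1 f z, pd 2 f z, \<nu>, f z] :: real^4^4) > 0"

definition second_form :: "(complex \<Rightarrow> real^4) \<Rightarrow> complex \<Rightarrow> real^4 \<Rightarrow> real^2^2" where
  "second_form f z \<nu> = (\<chi> i j. lorentz (pd i (pd j f) z) \<nu>)"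

definition mean_curvature :: "(complex \<Rightarrow> real^4) \<Rightarrow> complex \<Rightarrow> real^4 \<Rightarrow> real" where
  "mean_curvature f z \<nu> = trace (matrix_inv (ds2 f z) ** second_form f z \<nu>) / 2"

definition spacelike_cmc1_on :: "complex set \<Rightarrow> (complex \<Rightarrow> real^4) \<Rightarrow> bool" where
  "spacelike_cmc1_on W f \<longleftrightarrow>
     (\<forall>z\<in>W. pos_def (ds2 f z) \<and> (\<exists>\<nu>. unit_normal f z \<nu> \<and> mean_curvature f z \<nu> = 1))"

text \<open>Here the Riemann surface \<open>M\<close> is an open subset of the complex plane.\<close>

definition cmc1_face :: "complex set \<Rightarrow> (complex \<Rightarrow> real^4) \<Rightarrow> bool" where
  "cmc1_face M f \<longleftrightarrow>
     open M \<and> smooth_map_on M f \<and> f ` M \<subseteq> de_sitter \<and>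
     (\<exists>W. open W \<and> W \<subseteq> M \<and> M \<subseteq> closure W \<and> spacelike_cmc1_on W f \<and>
        (\<forall>p \<in> singular_set M f. \<exists>U \<mu> h.
            open U \<and> p \<in> U \<and> U \<subseteq> M \<and>
            Ck_on 1 (U \<inter> W) \<mu> \<and> (\<forall>z \<in> U \<inter> W. \<mu> z > (0::real)) \<and>
            riemannian_C1_on U h \<and> (\<forall>z \<in> U \<inter> W. h z = \<mu> z *\<^sub>R ds2 f z))) \<and>
     (\<forall>p\<in>M. frechet_derivative f (at p) \<noteq> (\<lambda>_. 0)) \<and>
     (\<forall>z \<in> M - singular_set M f. \<exists>c>0. ds2 f z = mat c)"


section \<open>Complete ends\<close>

definition punctured_disk :: "real \<Rightarrow> complex set" where
  "punctured_disk r = {z. 0 < cmod z \<and> cmod z < r}"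

definition path_to_puncture :: "(real \<Rightarrow> complex) \<Rightarrow> bool" where
  "path_to_puncture \<gamma> \<longleftrightarrow>
     (\<forall>b. 0 < b \<and> b < 1 \<longrightarrow> \<gamma> piecewise_C1_differentiable_on {0..b}) \<and>
     \<gamma> ` {0..<1} \<subseteq> punctured_disk 1 \<and> (\<gamma> \<longlongrightarrow> 0) (at_left 1)"

definition ds_length :: "(complex \<Rightarrow> real^4) \<Rightarrow> (real \<Rightarrow> complex) \<Rightarrow> ennreal" where
  "ds_length f \<gamma> = (\<integral>\<^sup>+ t \<in> {0..<1}.
     ennreal (sqrt (induced f (\<gamma> t) (vector_derivative \<gamma> (at t)) (vector_derivative \<gamma> (at t))))
     \<partial>lborel)"

definition complete_end :: "(complex \<Rightarrow> real^4) \<Rightarrow> bool" where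
  "complete_end f \<longleftrightarrow>
     cmc1_face (punctured_disk 1) f \<and>
     \<not> 0 islimpt singular_set (punctured_disk 1) f \<and>
     (\<forall>\<gamma>. path_to_puncture \<gamma> \<longrightarrow> ds_length f \<gamma> = \<infinity>)"


section \<open>Holomorphic null lifts and the type of an end\<close>

text \<open>
  The universal cover of the punctured unit disk is \<open>exp\<close> on the left half-plane, and the deck
  transformation of the counterclockwise loop about \<open>0\<close> is translation by \<open>2 \<pi> \<i>\<close>.
\<close>

definition left_half_plane :: "complex set" where
  "left_half_plane = {w. Re w < 0}"

definition matrix_deriv :: "(complex \<Rightarrow> complex^2^2) \<Rightarrow> complex \<Rightarrow> complex^2^2" where
  "matrix_deriv F w = (\<chi> i j. deriv (\<lambda>u. F u $ i $ j) w)"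

text \<open>
  The one-form is \<open>\<omega> dw\<close>.  At a pole of \<open>g\<close> the metric \<open>(1 + |g|\<^sup>2)\<^sup>2 |\<omega>|\<^sup>2\<close> and the
  right-hand side of the equation for \<open>F\<close> are meant as limits; the equation at the poles then
  follows by continuity.
\<close>

definition null_lift_data ::
  "(complex \<Rightarrow> complex^2^2) \<Rightarrow> (complex \<Rightarrow> complex) \<Rightarrow> (complex \<Rightarrow> complex) \<Rightarrow> bool" where
  "null_lift_data F g \<omega> \<longleftrightarrow>
     g nicely_meromorphic_on left_half_plane \<and>
     (\<exists>w\<in>left_half_plane. \<not> is_pole g w \<and> cmod (g w) \<noteq> 1) \<and>
     \<omega> holomorphic_on left_half_plane \<and>
     (\<forall>p\<in>left_half_plane. \<exists>l>0.
        ((\<lambda>w. (1 + (cmod (g w))\<^sup>2)\<^sup>2 * (cmod (\<omega> w))\<^sup>2) \<longlongrightarrow> l) (at p)) \<and>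
     (\<forall>i j. (\<lambda>w. F w $ i $ j) holomorphic_on left_half_plane) \<and>
     F ` left_half_plane \<subseteq> SL2C \<and>
     (\<forall>w\<in>left_half_plane. matrix_deriv F w \<noteq> 0) \<and>
     (\<forall>w\<in>left_half_plane. \<not> is_pole g w \<longrightarrow>
        matrix_inv (F w) ** matrix_deriv F w =
        vector [vector [g w * \<omega> w, - (g w)\<^sup>2 * \<omega> w], vector [\<omega> w, - g w * \<omega> w]])"

definition null_lift :: "(complex \<Rightarrow> real^4) \<Rightarrow> (complex \<Rightarrow> complex^2^2) \<Rightarrow> bool" where
  "null_lift f F \<longleftrightarrow>
     (\<exists>g \<omega>. null_lift_data F g \<omega>) \<and>
     (\<forall>w\<in>left_half_plane. herm (f (exp w)) = F w ** e3 ** hconj (F w))"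

definition end_monodromy :: "(complex \<Rightarrow> real^4) \<Rightarrow> complex^2^2 \<Rightarrow> bool" where
  "end_monodromy f \<rho> \<longleftrightarrow> \<rho> \<in> SU11 \<and>
     (\<exists>F. null_lift f F \<and>
        (\<forall>w\<in>left_half_plane. F (w + 2 * of_real pi * \<i>) = F w ** \<rho>))"

definition conj_SU11 :: "complex^2^2 \<Rightarrow> complex^2^2 \<Rightarrow> bool" where
  "conj_SU11 A B \<longleftrightarrow> (\<exists>P\<in>SU11. A = P ** B ** matrix_inv P)"

definition Lambda_e :: "real \<Rightarrow> complex^2^2" where
  "Lambda_e t = vector [vector [cis t, 0], vector [0, cis (- t)]]"

definition Lambda_p :: "real \<Rightarrow> complex^2^2" where
  "Lambda_p t = vector [vector [1 + \<i> * of_real t, - \<i> * of_real t],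
                        vector [\<i> * of_real t, 1 - \<i> * of_real t]]"

definition Lambda_h :: "real \<Rightarrow> complex^2^2" where
  "Lambda_h t = vector [vector [of_real (cosh t), of_real (sinh t)],
                        vector [of_real (sinh t), of_real (cosh t)]]"

definition elliptic :: "complex^2^2 \<Rightarrow> bool" where
  "elliptic \<rho> \<longleftrightarrow> (\<exists>t. - pi < t \<and> t \<le> pi \<and> conj_SU11 \<rho> (Lambda_e t))"

definition parabolic :: "complex^2^2 \<Rightarrow> bool" where
  "parabolic \<rho> \<longleftrightarrow>
     (\<exists>t. t \<noteq> 0 \<and> (conj_SU11 \<rho> (Lambda_p t) \<or> conj_SU11 \<rho> (- Lambda_p t)))"

definition hyperbolic :: "complex^2^2 \<Rightarrow> bool" where
  "hyperbolic \<rho> \<longleftrightarrow>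
     (\<exists>t>0. conj_SU11 \<rho> (Lambda_h t) \<or> conj_SU11 \<rho> (- Lambda_h t))"

text \<open>
  A null lift is unique up to \<open>F \<mapsto> F A\<^sup>-\<^sup>1\<close> with \<open>A \<in> SU\<^sub>1\<^sub>,\<^sub>1\<close>, which conjugates the monodromy, so
  the choice of the lift does not affect the type.
\<close>

definition elliptic_end :: "(complex \<Rightarrow> real^4) \<Rightarrow> bool" where
  "elliptic_end f \<longleftrightarrow> (\<exists>\<rho>. end_monodromy f \<rho> \<and> elliptic \<rho>)"

definition parabolic_end :: "(complex \<Rightarrow> real^4) \<Rightarrow> bool" where
  "parabolic_end f \<longleftrightarrow> (\<exists>\<rho>. end_monodromy f \<rho> \<and> parabolic \<rho>)"

definition hyperbolic_end :: "(complex \<Rightarrow> real^4) \<Rightarrow> bool" where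
  "hyperbolic_end f \<longleftrightarrow> (\<exists>\<rho>. end_monodromy f \<rho> \<and> hyperbolic \<rho>)"


section \<open>Total curvature\<close>

definition finite_total_curvature :: "(complex \<Rightarrow> real^4) \<Rightarrow> complex set \<Rightarrow> bool" where
  "finite_total_curvature f S \<longleftrightarrow>
     set_integrable lborel S (\<lambda>z. gauss_curvature (ds2 f) z * sqrt (det (ds2 f z)))"

end

theory Submission
  imports Defs
begin

text \<open>
  Write \<open>X = herm \<circ> f\<close>.  In the conformal coordinate \<open>z\<close> the equation \<open>H = 1\<close> says that
  \<open>X\<^sub>z X\<^sup>-\<^sup>1\<close> is holomorphic; written without dividing by the metric it extends from the
  dense regular set across the singularities by continuity.  Solving the linear equation
  \<open>F' = X\<^sub>w X\<^sup>-\<^sup>1 F\<close> on the universal cover \<open>w = log z\<close> gives the null lift and its monodromy.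

  With \<open>N = F\<^sup>-\<^sup>1 F' = (a, b; c, -a)\<close>, \<open>a\<^sup>2 + b c = 0\<close>, the induced metric in the coordinate \<open>w\<close> is
  \<open>(|c| - |b|)\<^sup>2 |dw|\<^sup>2\<close>.  Near the end there are no singular points, so \<open>|c| - |b|\<close> has
  constant sign there and one of \<open>a / c\<close>, \<open>a / b\<close> is a holomorphic map \<open>G\<close> from a half plane
  into the unit disk on which the monodromy acts by Moebius transformations of the disk.  As
  \<open>Re w\<close> tends to minus infinity the hyperbolic distance of \<open>w\<close> and \<open>w + 2 \<pi> \<i>\<close> tends to \<open>0\<close>,
  hence by Schwarz--Pick the monodromy has no positive translation length, that is, it is not
  hyperbolic.  The curvature form is the pullback under \<open>G\<close> of the area form of the disk, and
  Schwarz--Pick bounds it by the area form of the punctured disk, which is finite at the cusp.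
\<close>

no_notation fps_nth (infixl \<open>$\<close> 75)

section \<open>The Schwarz--Pick lemma\<close>

lemma one_minus_cnj_mult_neq_zero:
  assumes "cmod u < 1" "cmod v < 1"
  shows "1 - cnj u * v \<noteq> 0"
proof
  assume "1 - cnj u * v = 0"
  then have "cmod u * cmod v = 1"
    by (metis complex_mod_cnj eq_iff_diff_eq_0 norm_mult norm_one)
  moreover have "cmod u * cmod v < 1 * 1"
    using assms by (intro mult_strict_mono) auto
  ultimately show False by simp
qed

lemma Schwarz_Pick_ball:
  assumes hol: "f holomorphic_on ball 0 1" and maps: "f ` ball 0 1 \<subseteq> ball 0 1"
    and u: "cmod u < 1" and v: "cmod v < 1"
  shows "cmod (Moebius_function 0 (f u) (f v)) \<le> cmod (Moebius_function 0 u v)"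
proof -
  define h where "h = Moebius_function 0 (f u) \<circ> (f \<circ> Moebius_function 0 (- u))"
  have disk: "cmod (f z) < 1" if "cmod z < 1" for z
    using maps that by (auto simp: image_subset_iff)
  have Moebius_u: "cmod (Moebius_function 0 (- u) z) < 1" if "cmod z < 1" for z
    using Moebius_function_norm_lt_1[of "- u" z 0] u that by simp
  have "f \<circ> Moebius_function 0 (- u) holomorphic_on ball 0 1"
    by (rule holomorphic_on_compose_gen[OF Moebius_function_holomorphic hol])
       (use u Moebius_u in auto)
  then have "h holomorphic_on ball 0 1"
    unfolding h_def
    by (rule holomorphic_on_compose_gen[OF _ Moebius_function_holomorphic])
       (use u disk Moebius_u in auto)
  moreover have "h 0 = 0"
    by (simp add: h_def Moebius_function_of_zero Moebius_function_eq_zero)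
  moreover have "cmod (h z) < 1" if "cmod z < 1" for z
    using Moebius_function_norm_lt_1 disk u Moebius_u[OF that] by (simp add: h_def)
  moreover have "cmod (Moebius_function 0 u v) < 1"
    by (rule Moebius_function_norm_lt_1[OF u v])
  ultimately have "cmod (h (Moebius_function 0 u v)) \<le> cmod (Moebius_function 0 u v)"
    by (rule Schwarz_Lemma(1))
  then show ?thesis
    using Moebius_function_compose[of "- u" u v] u v by (simp add: h_def)
qed

definition cayley :: "complex \<Rightarrow> complex" where
  "cayley z = (z + 1) / (z - 1)"

lemma cayley_cayley: "z \<noteq> 1 \<Longrightarrow> cayley (cayley z) = z"
  by (simp add: cayley_def field_simps)

lemma Re_cayley: "Re (cayley z) = ((cmod z)\<^sup>2 - 1) / (cmod (z - 1))\<^sup>2"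
  unfolding cayley_def Re_divide cmod_power2
  by (simp add: power2_eq_square algebra_simps flip: add_divide_distrib)

lemma Re_cayley_neg: "cmod z < 1 \<Longrightarrow> Re (cayley z) < 0"
  by (auto simp: Re_cayley divide_less_0_iff abs_square_less_1)

lemma norm_cayley_less_one:
  assumes "Re w < 0"
  shows "cmod (cayley w) < 1"
proof -
  have "(cmod (w + 1))\<^sup>2 < (cmod (w - 1))\<^sup>2"
    using assms unfolding cmod_power2 by (simp add: power2_eq_square algebra_simps)
  then have "cmod (w + 1) < cmod (w - 1)"
    by (rule power2_less_imp_less) simp
  then show ?thesis
    unfolding cayley_def norm_divide
    by (metis divide_less_eq_1_pos norm_ge_zero order_le_less_trans)
qed

lemma norm_Moebius_function_cayley:
  assumes "Re u < 0" "Re v < 0"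
  shows "cmod (Moebius_function 0 (cayley u) (cayley v)) = cmod (v - u) / cmod (v + cnj u)"
proof -
  have nonzero: "u - 1 \<noteq> 0" "v - 1 \<noteq> 0" "cnj u - 1 \<noteq> 0" "v + cnj u \<noteq> 0"
    using assms by (auto simp: complex_eq_iff)
  have "cayley v - cayley u = 2 * (u - v) / ((u - 1) * (v - 1))"
    using nonzero by (simp add: cayley_def field_simps)
  moreover have "1 - cnj (cayley u) * cayley v = - (2 * (v + cnj u)) / ((cnj u - 1) * (v - 1))"
    using nonzero by (simp add: cayley_def divide_simps) (simp add: algebra_simps)
  moreover have "cmod (cnj u - 1) = cmod (u - 1)"
    by (metis complex_cnj_diff complex_cnj_one complex_mod_cnj)
  ultimately show ?thesis
    using nonzero
    by (simp only: Moebius_function_simple norm_divide norm_mult norm_minus_cancel)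
       (simp add: norm_minus_commute)
qed

lemma Schwarz_Pick_half_plane:
  assumes hol: "G holomorphic_on {w. Re w < c}"
    and disk: "\<And>w. Re w < c \<Longrightarrow> cmod (G w) < 1"
    and u: "Re u < c" and v: "Re v < c"
  shows "cmod (Moebius_function 0 (G u) (G v)) \<le> cmod (v - u) / cmod (v + cnj u - 2 * of_real c)"
proof -
  define f where "f = (\<lambda>z. G (cayley z + of_real c))"
  have "(\<lambda>z. cayley z + of_real c) holomorphic_on ball 0 1"
    unfolding cayley_def by (intro holomorphic_intros) auto
  then have "G \<circ> (\<lambda>z. cayley z + of_real c) holomorphic_on ball 0 1"
    by (rule holomorphic_on_compose_gen[OF _ hol]) (auto simp: Re_cayley_neg)
  then have "f holomorphic_on ball 0 1"
    by (simp add: f_def o_def)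
  moreover have "f ` ball 0 1 \<subseteq> ball 0 1"
    using disk Re_cayley_neg by (auto simp: f_def)
  moreover have "Re (u - of_real c) < 0" "Re (v - of_real c) < 0"
    using u v by auto
  ultimately have "cmod (Moebius_function 0 (f (cayley (u - of_real c)))
        (f (cayley (v - of_real c))))
      \<le> cmod (v - of_real c - (u - of_real c)) / cmod (v - of_real c + cnj (u - of_real c))"
    using Schwarz_Pick_ball norm_cayley_less_one norm_Moebius_function_cayley by metis
  moreover have "f (cayley (w - of_real c)) = G w" if "Re w < c" for w
    using that by (subst f_def, subst cayley_cayley) (auto simp: complex_eq_iff)
  ultimately show ?thesis
    using u v by (simp add: algebra_simps)
qed

lemma Schwarz_Pick_half_plane_deriv:
  assumes hol: "G holomorphic_on {w. Re w < c}"
    and disk: "\<And>w. Re w < c \<Longrightarrow> cmod (G w) < 1"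
    and u: "Re u < c"
  shows "cmod (deriv G u) / (1 - (cmod (G u))\<^sup>2) \<le> 1 / (2 * (c - Re u))"
proof -
  have "(G has_field_derivative deriv G u) (at u)"
    using holomorphic_derivI[OF hol open_halfspace_Re_lt] u by auto
  then have quotient: "((\<lambda>v. (G v - G u) / (v - u)) \<longlongrightarrow> deriv G u) (at u)"
    and cont: "(G \<longlongrightarrow> G u) (at u)"
    using DERIV_isCont by (auto simp: has_field_derivative_iff isCont_def)
  have nonzero: "1 - cnj (G u) * G u \<noteq> 0" "u + cnj u - 2 * of_real c \<noteq> 0"
    using one_minus_cnj_mult_neq_zero[OF disk[OF u] disk[OF u]] u
    by (simp_all add: complex_eq_iff)
  have left: "((\<lambda>v. cmod ((G v - G u) / (v - u) / (1 - cnj (G u) * G v)))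
      \<longlongrightarrow> cmod (deriv G u / (1 - cnj (G u) * G u))) (at u)"
    by (intro tendsto_intros quotient cont nonzero)
  have right: "((\<lambda>v. 1 / cmod (v + cnj u - 2 * of_real c))
      \<longlongrightarrow> 1 / cmod (u + cnj u - 2 * of_real c)) (at u)"
    by (intro tendsto_intros) (use nonzero in auto)
  have "\<forall>\<^sub>F v in at u. v \<in> {w. Re w < c} \<and> v \<noteq> u"
    using eventually_at_in_open[OF open_halfspace_Re_lt, of u c] u by simp
  then have "\<forall>\<^sub>F v in at u. cmod ((G v - G u) / (v - u) / (1 - cnj (G u) * G v))
      \<le> 1 / cmod (v + cnj u - 2 * of_real c)"
  proof eventually_elim
    case (elim v)
    then have "cmod (Moebius_function 0 (G u) (G v)) / cmod (v - u)
        \<le> cmod (v - u) / cmod (v + cnj u - 2 * of_real c) / cmod (v - u)"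
      using Schwarz_Pick_half_plane[OF hol disk u] by (intro divide_right_mono) auto
    then show ?case
      using elim by (simp add: Moebius_function_simple norm_divide norm_mult mult.commute)
  qed
  from tendsto_le[OF _ right left this]
  have "cmod (deriv G u / (1 - cnj (G u) * G u)) \<le> 1 / cmod (u + cnj u - 2 * of_real c)"
    by simp
  moreover have "u + cnj u - 2 * of_real c = of_real (- (2 * (c - Re u)))"
    and "1 - cnj (G u) * G u = of_real (1 - (cmod (G u))\<^sup>2)"
    by (simp_all add: complex_eq_iff complex_norm_square mult.commute flip: complex_norm_square)
  moreover have "(cmod (G u))\<^sup>2 < 1"
    using disk[OF u] by (simp add: abs_square_less_1)
  ultimately show ?thesis
    using u by (simp only: norm_divide norm_of_real) simp
qed

definition disk_automorphism :: "complex \<Rightarrow> complex \<Rightarrow> complex \<Rightarrow> complex" where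
  "disk_automorphism p q z = (p * z + q) / (cnj q * z + cnj p)"

lemma disk_automorphism_denominator_neq_zero:
  assumes det: "(cmod p)\<^sup>2 - (cmod q)\<^sup>2 = 1" and z: "cmod z < 1"
  shows "cnj q * z + cnj p \<noteq> 0"
proof
  assume "cnj q * z + cnj p = 0"
  then have "cmod p = cmod q * cmod z"
    by (metis add.commute add_eq_0_iff complex_mod_cnj norm_minus_cancel norm_mult)
  also have "\<dots> \<le> cmod q"
    using z by (simp add: mult_left_le)
  finally have "(cmod p)\<^sup>2 \<le> (cmod q)\<^sup>2"
    by (simp only: power_mono norm_ge_zero)
  then show False using det by linarith
qed

lemma disk_automorphism_displacement:
  assumes det: "(cmod p)\<^sup>2 - (cmod q)\<^sup>2 = 1" and z: "cmod z < 1"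
  shows "(Re p)\<^sup>2 * (1 - (cmod (Moebius_function 0 z (disk_automorphism p q z)))\<^sup>2) \<le> 1"
proof -
  define d where "d = cnj q * z + cnj p"
  define D where "D = d - cnj z * (p * z + q)"
  define E where "E = p * z + q - z * d"
  have "d \<noteq> 0"
    unfolding d_def by (rule disk_automorphism_denominator_neq_zero[OF det z])
  then have "disk_automorphism p q z - z = E / d" "1 - cnj z * disk_automorphism p q z = D / d"
    by (simp_all add: disk_automorphism_def D_def E_def diff_divide_distrib flip: d_def)
  then have Moebius: "Moebius_function 0 z (disk_automorphism p q z) = E / D"
    using \<open>d \<noteq> 0\<close> by (simp add: Moebius_function_simple)
  have det_Re_Im: "Re p * Re p + Im p * Im p - (Re q * Re q + Im q * Im q) = 1"
    using det unfolding cmod_power2 by (simp add: power2_eq_square)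
  have "(cmod D)\<^sup>2 - (cmod E)\<^sup>2
      = (1 - (cmod z)\<^sup>2)\<^sup>2 * (Re p * Re p + Im p * Im p - (Re q * Re q + Im q * Im q))"
    unfolding D_def E_def d_def cmod_power2 by (simp add: power2_eq_square) algebra
  then have norm_diff: "(cmod D)\<^sup>2 - (cmod E)\<^sup>2 = (1 - (cmod z)\<^sup>2)\<^sup>2"
    unfolding det_Re_Im by simp
  have "Re D = Re p * (1 - (cmod z)\<^sup>2)"
    unfolding D_def d_def cmod_power2 by (simp add: algebra_simps power2_eq_square)
  then have Re_bound: "(Re p)\<^sup>2 * (1 - (cmod z)\<^sup>2)\<^sup>2 \<le> (cmod D)\<^sup>2"
    by (simp add: cmod_power2 flip: power_mult_distrib)
  have "(1 - (cmod z)\<^sup>2)\<^sup>2 > 0"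
    using z abs_square_less_1[of "cmod z"] by simp
  then have "(cmod D)\<^sup>2 > 0"
    using norm_diff zero_le_power2[of "cmod E"] by linarith
  then have "(Re p)\<^sup>2 * (1 - (cmod (E / D))\<^sup>2) = (Re p)\<^sup>2 * (1 - (cmod z)\<^sup>2)\<^sup>2 / (cmod D)\<^sup>2"
    unfolding norm_diff[symmetric] by (simp add: norm_divide power_divide field_simps)
  also have "\<dots> \<le> 1"
    using Re_bound \<open>(cmod D)\<^sup>2 > 0\<close> by simp
  finally show ?thesis
    unfolding Moebius .
qed

text \<open>
  A translation that does not increase the real part moves \<open>c - s\<close> by a pseudohyperbolic distance
  that tends to \<open>0\<close> as \<open>s\<close> tends to infinity.
\<close>

lemma disk_automorphism_semiconjugate_translation:
  assumes hol: "G holomorphic_on {w. Re w < c}"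
    and disk: "\<And>w. Re w < c \<Longrightarrow> cmod (G w) < 1"
    and det: "(cmod p)\<^sup>2 - (cmod q)\<^sup>2 = 1" and \<tau>: "Re \<tau> \<le> 0"
    and equivariant: "\<And>w. Re w < c \<Longrightarrow> G (w + \<tau>) = disk_automorphism p q (G w)"
  shows "\<bar>Re p\<bar> \<le> 1"
proof -
  have "\<forall>\<^sub>F s in at_top. (Re p)\<^sup>2 * (1 - (cmod \<tau> / (2 * s))\<^sup>2) \<le> 1"
    using eventually_gt_at_top[of 0]
  proof eventually_elim
    case (elim s)
    define u where "u = complex_of_real (c - s)"
    have u: "Re u < c" and u\<tau>: "Re (u + \<tau>) < c"
      using elim \<tau> by (simp_all add: u_def)
    have "2 * s \<le> cmod (u + \<tau> + cnj u - 2 * of_real c)"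
      using abs_Re_le_cmod[of "u + \<tau> + cnj u - 2 * of_real c"] elim \<tau> by (simp add: u_def)
    then have "cmod (u + \<tau> - u) / cmod (u + \<tau> + cnj u - 2 * of_real c) \<le> cmod \<tau> / (2 * s)"
      using elim by (simp add: frac_le)
    then have "cmod (Moebius_function 0 (G u) (G (u + \<tau>))) \<le> cmod \<tau> / (2 * s)"
      using Schwarz_Pick_half_plane[OF hol disk u u\<tau>] by linarith
    then have "1 - (cmod \<tau> / (2 * s))\<^sup>2 \<le> 1 - (cmod (Moebius_function 0 (G u) (G (u + \<tau>))))\<^sup>2"
      by (intro diff_left_mono power_mono) auto
    then have "(Re p)\<^sup>2 * (1 - (cmod \<tau> / (2 * s))\<^sup>2)
        \<le> (Re p)\<^sup>2 * (1 - (cmod (Moebius_function 0 (G u) (G (u + \<tau>))))\<^sup>2)"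
      by (intro mult_left_mono) auto
    also have "\<dots> \<le> 1"
      using disk_automorphism_displacement[OF det disk[OF u]] equivariant[OF u] by simp
    finally show ?case .
  qed
  moreover have "((\<lambda>s. (Re p)\<^sup>2 * (1 - (cmod \<tau> / (2 * s))\<^sup>2)) \<longlongrightarrow> (Re p)\<^sup>2 * (1 - 0\<^sup>2)) at_top"
    by (intro tendsto_intros tendsto_divide_0[OF tendsto_const] filterlim_at_top_imp_at_infinity
        filterlim_tendsto_pos_mult_at_top[OF tendsto_const _ filterlim_ident]) simp
  ultimately have "(Re p)\<^sup>2 * (1 - 0\<^sup>2) \<le> 1"
    by (intro tendsto_upperbound) auto
  then show ?thesis
    by (simp add: abs_square_le_1)
qed

section \<open>Complex matrices and their holomorphic derivatives\<close>

definition mscale :: "complex \<Rightarrow> complex^'m^'n \<Rightarrow> complex^'m^'n" (infixr \<open>*\<^sub>m\<close> 75) where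
  "k *\<^sub>m A = (\<chi> i j. k * A $ i $ j)"

lemma mscale_nth [simp]: "(k *\<^sub>m A) $ i $ j = k * A $ i $ j"
  by (simp add: mscale_def)

lemma mscale_simps:
  "(k + l) *\<^sub>m A = k *\<^sub>m A + l *\<^sub>m A"
  "k *\<^sub>m (A + B) = k *\<^sub>m A + k *\<^sub>m B" "k *\<^sub>m (A - B) = k *\<^sub>m A - k *\<^sub>m B"
  "(- k) *\<^sub>m A = - (k *\<^sub>m A)" "k *\<^sub>m (- A) = - (k *\<^sub>m A)"
  "k *\<^sub>m (l *\<^sub>m A) = (k * l) *\<^sub>m A" "1 *\<^sub>m A = A" "0 *\<^sub>m A = 0" "k *\<^sub>m 0 = 0"
  by (simp_all add: vec_eq_iff algebra_simps)

lemma matrix_mult_simps: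
  fixes A B :: "complex^'m^'n" and C D :: "complex^'k^'m"
  shows "A ** (C ** E) = A ** C ** E"
    "(A + B) ** C = A ** C + B ** C" "(A - B) ** C = A ** C - B ** C" "(- A) ** C = - (A ** C)"
    "A ** (C + D) = A ** C + A ** D" "A ** (C - D) = A ** C - A ** D" "A ** (- C) = - (A ** C)"
    "A ** 0 = 0" "0 ** C = 0" "(k *\<^sub>m A) ** C = k *\<^sub>m (A ** C)" "A ** (k *\<^sub>m C) = k *\<^sub>m (A ** C)"
  by (simp_all add: matrix_mul_assoc)
     (simp_all add: vec_eq_iff matrix_matrix_mult_def algebra_simps sum.distrib sum_subtractf
       sum_negf sum_distrib_left)

lemma norm_mscale: "norm (k *\<^sub>m A) = cmod k * norm A"
  by (simp add: norm_vec_def norm_mult L2_set_right_distrib)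

lemma bounded_bilinear_matrix_matrix_mult:
  "bounded_bilinear ((**) :: complex^'m^'n \<Rightarrow> complex^'k^'m \<Rightarrow> complex^'k^'n)"
  unfolding bilinear_conv_bounded_bilinear[symmetric] bilinear_def
  by (auto intro!: linearI simp: vec_eq_iff matrix_matrix_mult_def algebra_simps sum.distrib
      scaleR_sum_right)

lemma has_derivative_vecI:
  fixes F :: "'a::real_normed_vector \<Rightarrow> 'b::euclidean_space^'n"
  assumes "\<And>i. ((\<lambda>w. F w $ i) has_derivative (\<lambda>h. D h $ i)) (at x within S)"
  shows "(F has_derivative D) (at x within S)"
  unfolding has_derivative_componentwise_within[of F]
proof
  fix b :: "'b^'n" assume "b \<in> Basis"
  then obtain i u where "b = axis i u" by (auto simp: Basis_vec_def)
  show "((\<lambda>x. F x \<bullet> b) has_derivative (\<lambda>x. D x \<bullet> b)) (at x within S)"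
    unfolding \<open>b = axis i u\<close> inner_axis by (intro has_derivative_inner_left assms)
qed

definition has_matrix_derivative ::
    "(complex \<Rightarrow> complex^'m^'n) \<Rightarrow> complex^'m^'n \<Rightarrow> complex filter \<Rightarrow> bool"
    (infix \<open>(has'_matrix'_derivative)\<close> 50) where
  "(F has_matrix_derivative D) net \<longleftrightarrow> (F has_derivative (\<lambda>h. h *\<^sub>m D)) net"

lemma has_matrix_derivative_iff:
  "(F has_matrix_derivative D) (at w) \<longleftrightarrow>
     (\<forall>i j. ((\<lambda>u. F u $ i $ j) has_field_derivative D $ i $ j) (at w))"
proof -
  have mult: "(\<lambda>h. (h *\<^sub>m D) $ i $ j) = (*) (D $ i $ j)" for i j
    by (simp add: fun_eq_iff)
  have "((\<lambda>u. F u $ i $ j) has_field_derivative D $ i $ j) (at w)"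
    if "(F has_matrix_derivative D) (at w)" for i j
    using that unfolding has_matrix_derivative_def has_field_derivative_def mult[symmetric]
    by (intro bounded_linear.has_derivative[OF bounded_linear_vec_nth])
  moreover have "(F has_matrix_derivative D) (at w)"
    if "\<And>i j. ((\<lambda>u. F u $ i $ j) has_field_derivative D $ i $ j) (at w)"
    unfolding has_matrix_derivative_def
    using that
    by (intro has_derivative_vecI) (simp add: mult has_field_derivative_def del: mscale_nth)
  ultimately show ?thesis by blast
qed

lemma has_matrix_derivative_const: "((\<lambda>w. A) has_matrix_derivative 0) (at w)"
  by (simp add: has_matrix_derivative_iff)

lemma has_matrix_derivative_add:
  assumes "(F has_matrix_derivative F') (at w)" "(G has_matrix_derivative G') (at w)"
  shows "((\<lambda>w. F w + G w) has_matrix_derivative (F' + G')) (at w)"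
  using assms by (simp add: has_matrix_derivative_iff DERIV_add)

lemma has_matrix_derivative_mult:
  assumes "(F has_matrix_derivative F') (at w)" "(G has_matrix_derivative G') (at w)"
  shows "((\<lambda>w. F w ** G w) has_matrix_derivative (F w ** G' + F' ** G w)) (at w)"
  using bounded_bilinear.FDERIV[OF bounded_bilinear_matrix_matrix_mult
      assms[unfolded has_matrix_derivative_def]]
  by (simp add: has_matrix_derivative_def matrix_mult_simps mscale_simps)

lemma has_matrix_derivative_unique:
  assumes "(F has_matrix_derivative D) (at w)" "(F has_matrix_derivative E) (at w)"
  shows "D = E"
  using assms DERIV_unique by (simp add: has_matrix_derivative_iff vec_eq_iff) blast

lemma has_matrix_derivative_shift:
  "(F has_matrix_derivative D) (at (w + a)) \<Longrightarrow> ((\<lambda>w. F (w + a)) has_matrix_derivative D) (at w)"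
  by (simp add: has_matrix_derivative_iff DERIV_shift)

lemma has_matrix_derivative_zero_unique:
  assumes "open S" "connected S" "\<And>w. w \<in> S \<Longrightarrow> (F has_matrix_derivative 0) (at w)"
    and "v \<in> S" "w \<in> S"
  shows "F v = F w"
  using assms(3)
  by (intro has_derivative_zero_unique_connected[OF assms(1,2) _ assms(4,5)])
     (simp add: has_matrix_derivative_def mscale_simps)

definition matrix_holomorphic_on ::
    "(complex \<Rightarrow> complex^'m^'n) \<Rightarrow> complex set \<Rightarrow> bool"
    (infixl \<open>(matrix'_holomorphic'_on)\<close> 50) where
  "F matrix_holomorphic_on S \<longleftrightarrow> (\<forall>i j. (\<lambda>w. F w $ i $ j) holomorphic_on S)"

lemma matrix_holomorphic_onD:
  "F matrix_holomorphic_on S \<Longrightarrow> (\<lambda>w. F w $ i $ j) holomorphic_on S"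
  by (simp add: matrix_holomorphic_on_def)

lemma matrix_holomorphic_on_mult:
  assumes "F matrix_holomorphic_on S" "G matrix_holomorphic_on S"
  shows "(\<lambda>w. F w ** G w) matrix_holomorphic_on S"
  using assms unfolding matrix_holomorphic_on_def matrix_matrix_mult_def
  by (simp add: holomorphic_on_sum holomorphic_on_mult)

lemma matrix_holomorphic_on_const: "(\<lambda>w. A) matrix_holomorphic_on S"
  by (simp add: matrix_holomorphic_on_def)

lemma matrix_holomorphic_on_open:
  assumes "open S" "\<And>w. w \<in> S \<Longrightarrow> (F has_matrix_derivative F' w) (at w)"
  shows "F matrix_holomorphic_on S"
  using assms
  by (auto simp: matrix_holomorphic_on_def has_matrix_derivative_iff holomorphic_on_open)

lemma matrix_holomorphic_on_imp_continuous_on: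
  "F matrix_holomorphic_on S \<Longrightarrow> continuous_on S F"
  unfolding matrix_holomorphic_on_def continuous_on_componentwise[of S F]
  by (auto simp: Basis_vec_def inner_axis
      intro!: continuous_intros holomorphic_on_imp_continuous_on)

section \<open>Linear holomorphic differential equations\<close>

lemma matrix_primitive_convex:
  assumes "open S" "convex S" "w0 \<in> S" "H matrix_holomorphic_on S"
  obtains P where "P w0 = 0" "\<And>w. w \<in> S \<Longrightarrow> (P has_matrix_derivative H w) (at w)"
proof -
  have "\<exists>q. \<forall>w\<in>S. (q has_field_derivative H w $ i $ j) (at w)" for i j
    using holomorphic_convex_primitive'[OF assms(2,1) matrix_holomorphic_onD[OF assms(4)]] assms(1)
    by (metis at_within_open)
  then obtain q where "\<And>i j w. w \<in> S \<Longrightarrow> (q i j has_field_derivative H w $ i $ j) (at w)"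
    by metis
  then have "((\<lambda>w. q i j w - q i j w0) has_field_derivative H w $ i $ j) (at w)"
    if "w \<in> S" for i j w
    using that by (auto intro!: derivative_eq_intros)
  then show thesis
    by (intro that[of "\<lambda>w. \<chi> i j. q i j w - q i j w0"])
       (auto simp: has_matrix_derivative_iff vec_eq_iff)
qed

lemma has_derivative_along_line:
  assumes "(F has_derivative D) (at (a + t *\<^sub>R v))"
  shows "((\<lambda>t. F (a + t *\<^sub>R v)) has_derivative (\<lambda>s. s *\<^sub>R D v)) (at t)"
proof -
  have "((\<lambda>t. a + t *\<^sub>R v) has_derivative (\<lambda>s. s *\<^sub>R v)) (at t)"
    by (auto intro!: derivative_eq_intros)
  from diff_chain_at[OF this assms] show ?thesis
    by (simp add: o_def linear_scale[OF has_derivative_linear[OF assms]])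
qed

lemma norm_diff_le_power_Suc:
  fixes F :: "'a::real_normed_vector \<Rightarrow> 'b::real_normed_vector"
  assumes der: "\<And>x. x \<in> closed_segment a b \<Longrightarrow> (F has_derivative F' x) (at x)"
    and bound: "\<And>x. x \<in> closed_segment a b \<Longrightarrow> norm (F' x (b - a)) \<le> B * norm (x - a) ^ n"
  shows "norm (F b - F a) \<le> B * norm (b - a) ^ n / Suc n"
proof -
  define \<gamma> where "\<gamma> = (\<lambda>t::real. a + t *\<^sub>R (b - a))"
  have \<gamma>: "\<gamma> t \<in> closed_segment a b" if "0 \<le> t" "t \<le> 1" for t
    using that by (auto simp: \<gamma>_def in_segment algebra_simps intro!: exI[of _ t])
  have F\<gamma>: "((\<lambda>t. F (\<gamma> t)) has_vector_derivative F' (\<gamma> t) (b - a)) (at t)"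
    if "0 \<le> t" "t \<le> 1" for t
    using has_derivative_along_line der[OF \<gamma>[OF that]]
    unfolding has_vector_derivative_def \<gamma>_def by blast
  define \<psi> where "\<psi> = (\<lambda>t. B * norm (b - a) ^ n * t ^ Suc n / Suc n)"
  have "norm (F (\<gamma> 1) - F (\<gamma> 0)) \<le> \<psi> 1 - \<psi> 0"
  proof (rule differentiable_bound_general)
    show "continuous_on {0..1} (\<lambda>t. F (\<gamma> t))"
      by (intro continuous_at_imp_continuous_on ballI has_vector_derivative_continuous[OF F\<gamma>]) auto
    show "continuous_on {0..1} \<psi>"
      unfolding \<psi>_def by (intro continuous_intros) auto
    show "(\<psi> has_vector_derivative B * norm (b - a) ^ n * t ^ n) (at t)" for t
      unfolding has_real_derivative_iff_has_vector_derivative[symmetric] \<psi>_def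
      by (auto intro!: derivative_eq_intros simp del: power_Suc of_nat_Suc)
    fix t :: real assume t: "0 < t" "t < 1"
    show "((\<lambda>t. F (\<gamma> t)) has_vector_derivative F' (\<gamma> t) (b - a)) (at t)"
      using F\<gamma> t by simp
    show "norm (F' (\<gamma> t) (b - a)) \<le> B * norm (b - a) ^ n * t ^ n"
      using bound[OF \<gamma>, of t] t by (simp add: \<gamma>_def power_mult_distrib mult_ac)
  qed simp
  then show ?thesis
    by (simp add: \<gamma>_def \<psi>_def)
qed

lemma Picard_terms_exist:
  assumes S: "open S" "convex S" "w0 \<in> S" and A: "A matrix_holomorphic_on S"
  obtains Y where "\<And>w. Y 0 w = F0" "\<And>n. Y (Suc n) w0 = 0"
    "\<And>n w. w \<in> S \<Longrightarrow> (Y (Suc n) has_matrix_derivative A w ** Y n w) (at w)"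
proof -
  have "\<exists>Y. \<forall>n. (Y n matrix_holomorphic_on S \<and> (n = 0 \<longrightarrow> Y n = (\<lambda>w. F0))) \<and>
      (Y (Suc n) w0 = 0 \<and> (\<forall>w\<in>S. (Y (Suc n) has_matrix_derivative A w ** Y n w) (at w)))"
  proof (rule dependent_nat_choice)
    show "\<exists>Y. Y matrix_holomorphic_on S \<and> (0 = 0 \<longrightarrow> Y = (\<lambda>w. F0))"
      using matrix_holomorphic_on_const by blast
    fix Y and n :: nat assume "Y matrix_holomorphic_on S \<and> (n = 0 \<longrightarrow> Y = (\<lambda>w. F0))"
    then have "(\<lambda>w. A w ** Y w) matrix_holomorphic_on S"
      using A matrix_holomorphic_on_mult by blast
    then obtain P where "P w0 = 0" "\<And>w. w \<in> S \<Longrightarrow> (P has_matrix_derivative A w ** Y w) (at w)"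
      using matrix_primitive_convex[OF S] by blast
    moreover from this(2) have "P matrix_holomorphic_on S"
      by (rule matrix_holomorphic_on_open[OF S(1)])
    ultimately show "\<exists>P. (P matrix_holomorphic_on S \<and> (Suc n = 0 \<longrightarrow> P = (\<lambda>w. F0))) \<and>
        P w0 = 0 \<and> (\<forall>w\<in>S. (P has_matrix_derivative A w ** Y w) (at w))"
      by blast
  qed
  then show thesis using that by (metis (no_types, lifting))
qed

lemma Picard_terms_bound:
  assumes Y: "\<And>w. Y 0 w = F0" "\<And>n. Y (Suc n) w0 = 0"
      "\<And>n w. w \<in> K \<Longrightarrow> (Y (Suc n) has_matrix_derivative A w ** Y n w) (at w)"
    and star: "\<And>w. w \<in> K \<Longrightarrow> closed_segment w0 w \<subseteq> K"
    and "L \<ge> 0" and norm_A: "\<And>w n. w \<in> K \<Longrightarrow> norm (A w ** Y n w) \<le> L * norm (Y n w)"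
    and "w \<in> K"
  shows "norm (Y n w) \<le> norm F0 * (L * cmod (w - w0)) ^ n / fact n"
  using \<open>w \<in> K\<close>
proof (induction n arbitrary: w)
  case 0
  then show ?case by (simp add: Y)
next
  case (Suc n)
  define B where "B = cmod (w - w0) * L * norm F0 * L ^ n / fact n"
  have "norm (Y (Suc n) w - Y (Suc n) w0) \<le> B * cmod (w - w0) ^ n / Suc n"
  proof (rule norm_diff_le_power_Suc)
    fix v assume "v \<in> closed_segment w0 w"
    then have v: "v \<in> K" using star Suc.prems by blast
    show "(Y (Suc n) has_derivative (\<lambda>h. h *\<^sub>m (A v ** Y n v))) (at v)"
      using Y(3)[OF v] by (simp add: has_matrix_derivative_def)
    have "norm (A v ** Y n v) \<le> L * norm (Y n v)"
      by (rule norm_A[OF v])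
    also have "\<dots> \<le> L * (norm F0 * (L * cmod (v - w0)) ^ n / fact n)"
      by (intro mult_left_mono Suc.IH v \<open>L \<ge> 0\<close>)
    finally have "cmod (w - w0) * norm (A v ** Y n v)
        \<le> cmod (w - w0) * (L * (norm F0 * (L * cmod (v - w0)) ^ n / fact n))"
      by (intro mult_left_mono) auto
    then show "norm ((w - w0) *\<^sub>m (A v ** Y n v)) \<le> B * cmod (v - w0) ^ n"
      by (simp add: B_def norm_mscale power_mult_distrib mult_ac)
  qed
  also have "\<dots> = norm F0 * (L * cmod (w - w0)) ^ Suc n / fact (Suc n)"
    by (simp add: B_def power_mult_distrib mult_ac del: of_nat_Suc)
  finally show ?case by (simp add: Y)
qed

lemma matrix_mult_bound_on_compact:
  fixes A :: "complex \<Rightarrow> complex^'m^'n"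
  assumes "compact K" "continuous_on K A"
  obtains L where "L \<ge> 0"
    "\<And>w (Z :: complex^'k^'m). w \<in> K \<Longrightarrow> norm (A w ** Z) \<le> L * norm Z"
proof -
  have "bounded (A ` K)"
    using assms by (intro compact_imp_bounded compact_continuous_image)
  then obtain M where "M > 0" and norm_A: "\<And>w. w \<in> K \<Longrightarrow> norm (A w) \<le> M"
    unfolding bounded_pos by blast
  obtain C where "C \<ge> 0" and norm_mult:
    "\<And>B (Z :: complex^'k^'m). norm ((B :: complex^'m^'n) ** Z) \<le> norm B * norm Z * C"
    using bounded_bilinear.nonneg_bounded[OF bounded_bilinear_matrix_matrix_mult] by blast
  have "norm (A w ** Z) \<le> M * C * norm Z" if "w \<in> K" for w and Z :: "complex^'k^'m"
  proof -
    have "norm (A w) * norm Z * C \<le> M * norm Z * C"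
      using norm_A[OF that] \<open>C \<ge> 0\<close> by (intro mult_right_mono) auto
    then show ?thesis
      using norm_mult[of "A w" Z] by (simp add: mult_ac)
  qed
  then show thesis
    using that[of "M * C"] \<open>M > 0\<close> \<open>C \<ge> 0\<close> by simp
qed

lemma Picard_series_locally_uniform:
  assumes S: "open S" "convex S" "w0 \<in> S" and A: "A matrix_holomorphic_on S"
    and Y: "\<And>w. Y 0 w = F0" "\<And>n. Y (Suc n) w0 = 0"
      "\<And>n w. w \<in> S \<Longrightarrow> (Y (Suc n) has_matrix_derivative A w ** Y n w) (at w)"
    and "v \<in> S"
  shows "\<exists>r>0. cball v r \<subseteq> S \<and>
    uniform_limit (cball v r) (\<lambda>n w. \<Sum>k<n. Y k w) (\<lambda>w. \<Sum>k. Y k w) sequentially"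
proof -
  obtain r where r: "r > 0" "cball v r \<subseteq> S"
    using S(1) \<open>v \<in> S\<close> open_contains_cball by blast
  define K where "K = convex hull (insert w0 (cball v r))"
  have "K \<subseteq> S"
    unfolding K_def using r S by (intro hull_minimal) auto
  then have K: "compact K" "convex K" "w0 \<in> K" "cball v r \<subseteq> K" "K \<subseteq> S"
    by (auto simp: K_def hull_inc intro!: compact_convex_hull)
  have "continuous_on K A"
    using K(5) matrix_holomorphic_on_imp_continuous_on[OF A] continuous_on_subset by blast
  then obtain L where "L \<ge> 0" and norm_A: "\<And>w n. w \<in> K \<Longrightarrow> norm (A w ** Y n w) \<le> L * norm (Y n w)"
    using matrix_mult_bound_on_compact[OF K(1)] by metis
  have "bounded ((\<lambda>w. w - w0) ` K)"
    by (intro compact_imp_bounded compact_continuous_image continuous_intros K(1))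
  then obtain R where radius: "\<And>w. w \<in> K \<Longrightarrow> cmod (w - w0) \<le> R"
    unfolding bounded_iff by blast
  have "uniform_limit (cball v r) (\<lambda>n w. \<Sum>k<n. Y k w) (\<lambda>w. \<Sum>k. Y k w) sequentially"
  proof (rule Weierstrass_m_test)
    show "summable (\<lambda>n. norm F0 * (L * R) ^ n / fact n)"
      using summable_mult[OF summable_exp[of "L * R"], of "norm F0"] by (simp add: field_simps)
    fix n w assume "w \<in> cball v r"
    then have w: "w \<in> K" using K by blast
    have "norm (Y n w) \<le> norm F0 * (L * cmod (w - w0)) ^ n / fact n"
      using K Y \<open>L \<ge> 0\<close> norm_A w
      by (intro Picard_terms_bound[where A = A and K = K]) (auto simp: closed_segment_subset)
    also have "\<dots> \<le> norm F0 * (L * R) ^ n / fact n"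
      using radius[OF w] \<open>L \<ge> 0\<close> by (intro divide_right_mono mult_left_mono power_mono) auto
    finally show "norm (Y n w) \<le> norm F0 * (L * R) ^ n / fact n" .
  qed
  with r show ?thesis by blast
qed

lemma has_matrix_derivative_uniform_limit:
  assumes S: "open S" "w \<in> S"
    and deriv: "\<And>n w. w \<in> S \<Longrightarrow> (P n has_matrix_derivative P' n w) (at w)"
    and uniform: "\<And>v. v \<in> S \<Longrightarrow> \<exists>r>0. cball v r \<subseteq> S \<and> uniform_limit (cball v r) P F sequentially"
    and limit: "(\<lambda>n. P' n w) \<longlonglongrightarrow> F'"
  shows "(F has_matrix_derivative F') (at w)"
proof -
  have "((\<lambda>u. F u $ i $ j) has_field_derivative F' $ i $ j) (at w)" for i j
  proof -
    have deriv_entry: "((\<lambda>u. P n u $ i $ j) has_field_derivative P' n w $ i $ j) (at w)"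
      if "w \<in> S" for n w
      using deriv[OF that] by (simp add: has_matrix_derivative_iff)
    have uniform_entry: "\<exists>r>0. cball v r \<subseteq> S \<and>
        uniform_limit (cball v r) (\<lambda>n u. P n u $ i $ j) (\<lambda>u. F u $ i $ j) sequentially"
      if v: "v \<in> S" for v
    proof -
      obtain r where r: "r > 0" "cball v r \<subseteq> S" "uniform_limit (cball v r) P F sequentially"
        using uniform[OF v] by blast
      have "uniform_limit (cball v r) (\<lambda>n u. P n u $ i $ j) (\<lambda>u. F u $ i $ j) sequentially"
        by (intro bounded_linear.uniform_limit[OF bounded_linear_vec_nth] r(3))
      with r(1,2) show ?thesis by blast
    qed
    obtain D where "\<forall>w\<in>S. ((\<lambda>u. F u $ i $ j) has_field_derivative D w) (at w) \<and>
        (\<lambda>n. P' n w $ i $ j) \<longlonglongrightarrow> D w"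
      using has_complex_derivative_uniform_sequence[OF S(1) deriv_entry uniform_entry] by blast
    moreover have "(\<lambda>n. P' n w $ i $ j) \<longlonglongrightarrow> F' $ i $ j"
      by (intro tendsto_intros limit)
    ultimately show ?thesis
      using LIMSEQ_unique S(2) by metis
  qed
  then show ?thesis
    by (simp add: has_matrix_derivative_iff)
qed

lemma Picard_partial_sums_derivative:
  assumes "\<And>w. Y 0 w = F0" "\<And>n. (Y (Suc n) has_matrix_derivative A ** Y n w) (at w)"
  shows "((\<lambda>w. \<Sum>k<Suc n. Y k w) has_matrix_derivative A ** (\<Sum>k<n. Y k w)) (at w)"
proof (induction n)
  case 0
  have "Y 0 = (\<lambda>w. F0)"
    using assms(1) by blast
  then show ?case
    by (simp add: has_matrix_derivative_const matrix_mult_simps)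
next
  case (Suc n)
  then show ?case
    using has_matrix_derivative_add[OF _ assms(2)] by (simp add: matrix_mult_simps)
qed

lemma holomorphic_linear_ode:
  assumes S: "open S" "convex S" "w0 \<in> S" and A: "A matrix_holomorphic_on S"
  obtains F where "F w0 = F0" "\<And>w. w \<in> S \<Longrightarrow> (F has_matrix_derivative A w ** F w) (at w)"
proof -
  obtain Y where Y: "\<And>w. Y 0 w = F0" "\<And>n. Y (Suc n) w0 = 0"
    "\<And>n w. w \<in> S \<Longrightarrow> (Y (Suc n) has_matrix_derivative A w ** Y n w) (at w)"
    using Picard_terms_exist[OF S A] by blast
  define P where "P = (\<lambda>n w. \<Sum>k<n. Y k w)"
  define F where "F = (\<lambda>w. \<Sum>n. Y n w)"
  have uniform: "\<exists>r>0. cball v r \<subseteq> S \<and> uniform_limit (cball v r) P F sequentially"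
    if "v \<in> S" for v
    unfolding P_def F_def by (rule Picard_series_locally_uniform[OF S A Y that])
  have "(F has_matrix_derivative A w ** F w) (at w)" if w: "w \<in> S" for w
  proof (rule has_matrix_derivative_uniform_limit[OF S(1) w])
    show "(P (Suc n) has_matrix_derivative A v ** P n v) (at v)" if "v \<in> S" for n v
      unfolding P_def by (rule Picard_partial_sums_derivative[OF Y(1) Y(3)[OF that]])
    show "\<exists>r>0. cball v r \<subseteq> S \<and> uniform_limit (cball v r) (\<lambda>n. P (Suc n)) F sequentially"
      if "v \<in> S" for v
      using uniform[OF that] filterlim_compose[OF _ filterlim_Suc] by blast
    have "(\<lambda>n. P n w) \<longlonglongrightarrow> F w"
      using uniform[OF w] tendsto_uniform_limitI by force
    then show "(\<lambda>n. A w ** P n w) \<longlonglongrightarrow> A w ** F w"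
      by (intro bounded_bilinear.tendsto[OF bounded_bilinear_matrix_matrix_mult] tendsto_const)
  qed
  moreover have "F w0 = F0"
    using suminf_finite[of "{0}" "\<lambda>n. Y n w0"] Y(1,2) by (auto simp: F_def gr0_conv_Suc)
  ultimately show thesis
    using that by blast
qed

section \<open>Symmetry of second derivatives\<close>

lemma norm_scaleR_add_scaleR_le:
  fixes a b :: "'a::real_normed_vector"
  assumes "0 \<le> s" "s \<le> h" "0 \<le> t" "t \<le> h"
  shows "norm (s *\<^sub>R a + t *\<^sub>R b) \<le> h * (norm a + norm b)"
proof -
  have "norm (s *\<^sub>R a + t *\<^sub>R b) \<le> s * norm a + t * norm b"
    using norm_triangle_ineq[of "s *\<^sub>R a" "t *\<^sub>R b"] assms by simp
  also have "\<dots> \<le> h * norm a + h * norm b"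
    using assms by (intro add_mono mult_right_mono) auto
  finally show ?thesis
    by (simp add: algebra_simps)
qed

definition second_difference ::
    "('a::real_vector \<Rightarrow> 'b::real_vector) \<Rightarrow> 'a \<Rightarrow> 'a \<Rightarrow> 'a \<Rightarrow> real \<Rightarrow> 'b" where
  "second_difference f z a b h =
    f (z + h *\<^sub>R a + h *\<^sub>R b) - f (z + h *\<^sub>R a) - f (z + h *\<^sub>R b) + f z"

lemma second_difference_commute: "second_difference f z a b = second_difference f z b a"
  by (simp add: fun_eq_iff second_difference_def algebra_simps)

lemma second_difference_bound:
  fixes f :: "'a::real_normed_vector \<Rightarrow> 'b::real_normed_vector"
  assumes f: "\<And>y. norm (y - z) \<le> h * (norm a + norm b) \<Longrightarrow> (f has_derivative f' y) (at y)"
    and approx: "\<And>y. norm (y - z) \<le> h * (norm a + norm b) \<Longrightarrow>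
      norm (f' y a - f' z a - G (y - z)) \<le> e * norm (y - z)"
    and "linear G" "h > 0" "e \<ge> 0"
  shows "norm (second_difference f z a b h - h\<^sup>2 *\<^sub>R G b) \<le> 2 * e * (norm a + norm b) * h\<^sup>2"
proof -
  define \<phi> where "\<phi> = (\<lambda>s. f (z + s *\<^sub>R a + h *\<^sub>R b) - f (z + s *\<^sub>R a) - s *\<^sub>R (h *\<^sub>R G b))"
  define \<phi>' where "\<phi>' = (\<lambda>s. f' (z + s *\<^sub>R a + h *\<^sub>R b) a - f' (z + s *\<^sub>R a) a - h *\<^sub>R G b)"
  have near: "norm (z + s *\<^sub>R a + t *\<^sub>R b - z) \<le> h * (norm a + norm b)"
    if "0 \<le> s" "s \<le> h" "0 \<le> t" "t \<le> h" for s t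
    using norm_scaleR_add_scaleR_le[OF that] by simp
  have f_line: "((\<lambda>s. f (z + s *\<^sub>R a + t *\<^sub>R b)) has_derivative
      (\<lambda>r. r *\<^sub>R f' (z + s *\<^sub>R a + t *\<^sub>R b) a)) (at s)"
    if "0 \<le> s" "s \<le> h" "0 \<le> t" "t \<le> h" for s t
    using has_derivative_along_line[of f _ "z + t *\<^sub>R b" s a] f[OF near[OF that]]
    by (simp add: add_ac)
  have "norm (\<phi> h - \<phi> 0) \<le> (h * (2 * e * (h * (norm a + norm b)))) * norm (h - 0) ^ 0 / Suc 0"
  proof (rule norm_diff_le_power_Suc)
    fix s assume "s \<in> closed_segment 0 h"
    then have s: "0 \<le> s" "s \<le> h"
      using \<open>h > 0\<close> by (auto simp: closed_segment_eq_real_ivl)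
    show "(\<phi> has_derivative (\<lambda>r. r *\<^sub>R \<phi>' s)) (at s)"
      unfolding \<phi>_def \<phi>'_def using f_line[OF s, of h] f_line[OF s, of 0] \<open>h > 0\<close>
      by (auto intro!: derivative_eq_intros simp: algebra_simps)
    let ?x = "z + s *\<^sub>R a + h *\<^sub>R b" and ?y = "z + s *\<^sub>R a + 0 *\<^sub>R b"
    have "G (?x - z) - G (?y - z) = h *\<^sub>R G b"
      using \<open>linear G\<close> by (simp add: linear_add linear_scale linear_diff)
    then have "\<phi>' s = (f' ?x a - f' z a - G (?x - z)) - (f' ?y a - f' z a - G (?y - z))"
      by (simp add: \<phi>'_def algebra_simps)
    then have "norm (\<phi>' s)
        \<le> norm (f' ?x a - f' z a - G (?x - z)) + norm (f' ?y a - f' z a - G (?y - z))"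
      using norm_triangle_ineq4 by metis
    also have "\<dots> \<le> e * norm (?x - z) + e * norm (?y - z)"
      using s \<open>h > 0\<close> by (intro add_mono approx near) auto
    also have "\<dots> \<le> e * (h * (norm a + norm b)) + e * (h * (norm a + norm b))"
      using s \<open>h > 0\<close> \<open>e \<ge> 0\<close> by (intro add_mono mult_left_mono near) auto
    finally have "norm (\<phi>' s) \<le> 2 * e * (h * (norm a + norm b))"
      by simp
    then show "norm ((h - 0) *\<^sub>R \<phi>' s) \<le> h * (2 * e * (h * (norm a + norm b))) * norm (s - 0) ^ 0"
      using \<open>h > 0\<close> by simp
  qed
  then show ?thesis
    by (simp add: \<phi>_def second_difference_def power2_eq_square algebra_simps)
qed

lemma second_difference_tendsto:
  fixes f :: "'a::real_normed_vector \<Rightarrow> 'b::real_normed_vector"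
  assumes M: "open M" "z \<in> M" and f: "\<And>w. w \<in> M \<Longrightarrow> (f has_derivative f' w) (at w)"
    and G: "((\<lambda>w. f' w a) has_derivative G) (at z)"
  shows "((\<lambda>h. second_difference f z a b h /\<^sub>R h\<^sup>2) \<longlongrightarrow> G b) (at_right 0)"
proof (rule tendstoI)
  fix e :: real assume "e > 0"
  define N where "N = norm a + norm b + 1"
  have N: "N > 0" "norm a + norm b < N"
    by (simp_all add: N_def add_nonneg_pos)
  define \<epsilon> where "\<epsilon> = e / (2 * N)"
  have "\<epsilon> > 0"
    using \<open>e > 0\<close> N by (simp add: \<epsilon>_def)
  obtain d where "d > 0" and approx:
    "\<And>y. norm (y - z) < d \<Longrightarrow> norm (f' y a - f' z a - G (y - z)) \<le> \<epsilon> * norm (y - z)"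
    using G \<open>\<epsilon> > 0\<close> unfolding has_derivative_at_alt by blast
  obtain r where "r > 0" "ball z r \<subseteq> M"
    using M open_contains_ball by blast
  have "\<forall>\<^sub>F h in at_right 0. h \<in> {0<..<min d r / N}"
    using \<open>d > 0\<close> \<open>r > 0\<close> N by (intro eventually_at_right_real) simp
  then show "\<forall>\<^sub>F h in at_right 0. dist (second_difference f z a b h /\<^sub>R h\<^sup>2) (G b) < e"
  proof eventually_elim
    case (elim h)
    then have "h > 0" "h * (norm a + norm b) < min d r"
      using N mult_left_mono[of "norm a + norm b" N h] by (simp_all add: field_simps)
    then have small: "norm (y - z) < d" "y \<in> M" if "norm (y - z) \<le> h * (norm a + norm b)" for y
      using that \<open>ball z r \<subseteq> M\<close> by (auto simp: dist_norm norm_minus_commute)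
    have "norm (second_difference f z a b h - h\<^sup>2 *\<^sub>R G b) \<le> 2 * \<epsilon> * (norm a + norm b) * h\<^sup>2"
      using \<open>h > 0\<close> \<open>\<epsilon> > 0\<close> G by (intro second_difference_bound[where f' = f'])
        (auto simp: f approx small has_derivative_linear)
    also have "\<dots> < 2 * \<epsilon> * N * h\<^sup>2"
      using \<open>h > 0\<close> \<open>\<epsilon> > 0\<close> N by simp
    also have "\<dots> = e * h\<^sup>2"
      using N by (simp add: \<epsilon>_def)
    finally have "norm (second_difference f z a b h - h\<^sup>2 *\<^sub>R G b) / h\<^sup>2 < e"
      using \<open>h > 0\<close> by (simp add: divide_less_eq)
    moreover have "second_difference f z a b h /\<^sub>R h\<^sup>2 - G b
        = (second_difference f z a b h - h\<^sup>2 *\<^sub>R G b) /\<^sub>R h\<^sup>2"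
      using \<open>h > 0\<close> by (simp add: algebra_simps)
    ultimately show ?case
      by (simp add: dist_norm divide_inverse mult.commute)
  qed
qed

lemma second_derivative_symmetric:
  fixes f :: "'a::real_normed_vector \<Rightarrow> 'b::real_normed_vector"
  assumes M: "open M" "z \<in> M" and f: "\<And>w. w \<in> M \<Longrightarrow> (f has_derivative f' w) (at w)"
    and G: "((\<lambda>w. f' w a) has_derivative G) (at z)"
    and H: "((\<lambda>w. f' w b) has_derivative H) (at z)"
  shows "G b = H a"
proof (rule tendsto_unique)
  show "((\<lambda>h. second_difference f z a b h /\<^sub>R h\<^sup>2) \<longlongrightarrow> G b) (at_right 0)"
    by (rule second_difference_tendsto[OF M f G])
  show "((\<lambda>h. second_difference f z a b h /\<^sub>R h\<^sup>2) \<longlongrightarrow> H a) (at_right 0)"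
    using second_difference_tendsto[OF M f H, of a]
    by (simp only: second_difference_commute[of f z a b])
qed simp

section \<open>Partial derivatives of smooth maps on plane domains\<close>

lemma pd_eqI: "(f has_derivative D) (at z) \<Longrightarrow> pd i f z = D (coord_vec i)"
  unfolding pd_def using frechet_derivative_at by metis

lemma linear_complex_eq:
  fixes D :: "complex \<Rightarrow> 'a::real_vector"
  assumes "linear D"
  shows "D h = Re h *\<^sub>R D 1 + Im h *\<^sub>R D \<i>"
proof -
  have "D h = D (Re h *\<^sub>R 1 + Im h *\<^sub>R \<i>)"
    by (rule arg_cong[of _ _ D]) (simp add: complex_eq_iff)
  then show ?thesis
    using assms by (simp add: linear_add linear_scale)
qed

lemma has_derivative_pd:
  assumes "f differentiable (at z)"
  shows "(f has_derivative (\<lambda>h. Re h *\<^sub>R pd 1 f z + Im h *\<^sub>R pd 2 f z)) (at z)"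
proof -
  have "pd 1 f z = frechet_derivative f (at z) 1" "pd 2 f z = frechet_derivative f (at z) \<i>"
    by (simp_all add: pd_def coord_vec_def)
  then show ?thesis
    using assms linear_complex_eq[OF linear_frechet_derivative[OF assms], symmetric]
    by (simp add: frechet_derivative_works)
qed

lemma has_matrix_derivative_of_has_derivative:
  assumes "(F has_derivative D) (at z)" "D \<i> = \<i> *\<^sub>m D 1"
  shows "(F has_matrix_derivative D 1) (at z)"
proof -
  have "D = (\<lambda>h. h *\<^sub>m D 1)"
  proof
    fix h
    have "D h = Re h *\<^sub>R D 1 + Im h *\<^sub>R (\<i> *\<^sub>m D 1)"
      unfolding assms(2)[symmetric]
      by (rule linear_complex_eq[OF has_derivative_linear[OF assms(1)]])
    also have "\<dots> = h *\<^sub>m D 1"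
      by (simp add: vec_eq_iff complex_eq_iff)
    finally show "D h = h *\<^sub>m D 1" .
  qed
  with assms(1) show ?thesis
    unfolding has_matrix_derivative_def by metis
qed

lemma smooth_map_on_imp_continuous_on: "smooth_map_on S f \<Longrightarrow> continuous_on S f"
  unfolding smooth_map_on_def using Ck_on.simps(1) by blast

lemma smooth_map_on_imp_differentiable: "smooth_map_on S f \<Longrightarrow> z \<in> S \<Longrightarrow> f differentiable (at z)"
  unfolding smooth_map_on_def using Ck_on.simps(2) by blast

lemma smooth_map_on_pd: "smooth_map_on S f \<Longrightarrow> smooth_map_on S (pd i f)"
  unfolding smooth_map_on_def using Ck_on.simps(2) by blast

lemma pd_commute:
  assumes S: "open S" "z \<in> S" and f: "smooth_map_on S f"
  shows "pd i (pd j f) z = pd j (pd i f) z"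
proof -
  have f': "(f has_derivative frechet_derivative f (at w)) (at w)" if "w \<in> S" for w
    using smooth_map_on_imp_differentiable[OF f that] by (simp add: frechet_derivative_works)
  have f'': "((\<lambda>w. frechet_derivative f (at w) (coord_vec k)) has_derivative
      frechet_derivative (pd k f) (at z)) (at z)" for k
    using smooth_map_on_imp_differentiable[OF smooth_map_on_pd[OF f] S(2)]
    unfolding frechet_derivative_works by (simp add: pd_def[abs_def])
  have "frechet_derivative (pd j f) (at z) (coord_vec i)
      = frechet_derivative (pd i f) (at z) (coord_vec j)"
    by (rule second_derivative_symmetric[OF S f' f'' f''])
  then show ?thesis by (simp only: pd_def[of _ "pd _ f"])
qed

lemma continuous_on_eq_dense:
  fixes f g :: "'a::topological_space \<Rightarrow> 'b::real_normed_vector"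
  assumes "continuous_on M f" "continuous_on M g" "W \<subseteq> M" "M \<subseteq> closure W"
    and "\<And>w. w \<in> W \<Longrightarrow> f w = g w" "z \<in> M"
  shows "f z = g z"
proof -
  have "closedin (top_of_set M) {w \<in> M. f w - g w = 0}"
    using assms(1,2) by (intro continuous_closedin_preimage_constant continuous_intros)
  then obtain T where T: "closed T" "{w \<in> M. f w - g w = 0} = M \<inter> T"
    by (auto simp: closedin_closed)
  moreover have "W \<subseteq> {w \<in> M. f w - g w = 0}"
    using assms(3,5) by auto
  ultimately have "closure W \<subseteq> T"
    by (metis closure_minimal le_inf_iff)
  then have "z \<in> {w \<in> M. f w - g w = 0}"
    using T(2) assms(4,6) by blast
  then show ?thesis by simp
qed

section \<open>Lorentzian and Hermitian algebra\<close>

lemma vector_4: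
  "(vector [a, b, c, d] :: ('a::zero)^4) $ 1 = a"
  "(vector [a, b, c, d] :: ('a::zero)^4) $ 2 = b"
  "(vector [a, b, c, d] :: ('a::zero)^4) $ 3 = c"
  "(vector [a, b, c, d] :: ('a::zero)^4) $ 4 = d"
  unfolding vector_def by simp_all

lemma det_4:
  fixes A :: "'a::comm_ring_1^4^4"
  shows "det A =
    A$1$1 * (A$2$2 * (A$3$3 * A$4$4 - A$3$4 * A$4$3) - A$2$3 * (A$3$2 * A$4$4 - A$3$4 * A$4$2)
           + A$2$4 * (A$3$2 * A$4$3 - A$3$3 * A$4$2)) -
    A$1$2 * (A$2$1 * (A$3$3 * A$4$4 - A$3$4 * A$4$3) - A$2$3 * (A$3$1 * A$4$4 - A$3$4 * A$4$1)
           + A$2$4 * (A$3$1 * A$4$3 - A$3$3 * A$4$1)) +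
    A$1$3 * (A$2$1 * (A$3$2 * A$4$4 - A$3$4 * A$4$2) - A$2$2 * (A$3$1 * A$4$4 - A$3$4 * A$4$1)
           + A$2$4 * (A$3$1 * A$4$2 - A$3$2 * A$4$1)) -
    A$1$4 * (A$2$1 * (A$3$2 * A$4$3 - A$3$3 * A$4$2) - A$2$2 * (A$3$1 * A$4$3 - A$3$3 * A$4$1)
           + A$2$3 * (A$3$1 * A$4$2 - A$3$2 * A$4$1))"
proof -
  have insert_1: "finite {2::4, 3, 4}" "1 \<notin> {2::4, 3, 4}" by auto
  have insert_2: "finite {3::4, 4}" "2 \<notin> {3::4, 4}" by auto
  have insert_3: "finite {4::4}" "3 \<notin> {4::4}" by auto
  show ?thesis
    unfolding det_def UNIV_4 sum_over_permutations_insert[OF insert_1]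
      sum_over_permutations_insert[OF insert_2] sum_over_permutations_insert[OF insert_3]
      permutes_sing
    by (simp add: sign_swap_id permutation_swap_id permutation_compose sign_compose sign_id
        swap_id_eq algebra_simps)
qed

lemma lorentz_commute: "lorentz x y = lorentz y x"
  by (simp add: lorentz_def mult.commute)

lemma lorentz_simps:
  "lorentz (x + y) z = lorentz x z + lorentz y z" "lorentz z (x + y) = lorentz z x + lorentz z y"
  "lorentz (x - y) z = lorentz x z - lorentz y z" "lorentz z (x - y) = lorentz z x - lorentz z y"
  "lorentz (k *\<^sub>R x) z = k * lorentz x z" "lorentz z (k *\<^sub>R x) = k * lorentz z x"
  by (simp_all add: lorentz_def algebra_simps)

lemma bounded_bilinear_lorentz: "bounded_bilinear lorentz"
  unfolding bilinear_conv_bounded_bilinear[symmetric] bilinear_def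
  by (auto intro!: linearI simp: lorentz_simps)

definition lorentz_cross :: "real^4 \<Rightarrow> real^4 \<Rightarrow> real^4 \<Rightarrow> real^4" where
  "lorentz_cross u v x =
    (let minor = (\<lambda>i j k. u$i * (v$j * x$k - v$k * x$j) - u$j * (v$i * x$k - v$k * x$i)
                        + u$k * (v$i * x$j - v$j * x$i))
     in vector [- minor 2 3 4, - minor 1 3 4, minor 1 2 4, - minor 1 2 3])"

lemma lorentz_lorentz_cross:
  "lorentz (lorentz_cross u v x) y = det (vector [u, v, y, x] :: real^4^4)"
  unfolding lorentz_def lorentz_cross_def Let_def det_4 vector_4 by (simp add: algebra_simps)

lemma lorentz_frame_nondegenerate:
  assumes det: "det (vector [u, v, n, x] :: real^4^4) \<noteq> 0"
    and orthogonal: "lorentz y u = 0" "lorentz y v = 0" "lorentz y n = 0" "lorentz y x = 0"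
  shows "y = 0"
proof -
  define A where "A = (vector [u, v, n, x] :: real^4^4)"
  define y' where "y' = (vector [- y$1, y$2, y$3, y$4] :: real^4)"
  have "A *v y' = 0"
    using orthogonal unfolding A_def y'_def lorentz_def
    by (simp add: vec_eq_iff forall_4 matrix_vector_mult_def sum_4 vector_4 algebra_simps)
  moreover obtain B where "B ** A = mat 1"
    using det invertible_det_nz[of A] unfolding A_def invertible_def by blast
  ultimately have "y' = 0"
    by (metis matrix_vector_mul_assoc matrix_vector_mul_lid matrix_vector_mult_0_right)
  then show ?thesis
    by (simp add: y'_def vec_eq_iff forall_4 vector_4)
qed

lemma det_lorentz_orthogonal_frame_power2:
  assumes "lorentz u v = 0" "lorentz u n = 0" "lorentz u x = 0"
    "lorentz v n = 0" "lorentz v x = 0" "lorentz n x = 0"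
  shows "(det (vector [u, v, n, x] :: real^4^4))\<^sup>2
     = - (lorentz u u * lorentz v v * lorentz n n * lorentz x x)"
proof -
  define A where "A = (vector [u, v, n, x] :: real^4^4)"
  define J where "J = (vector [vector [-1, 0, 0, 0], vector [0, 1, 0, 0], vector [0, 0, 1, 0],
    vector [0, 0, 0, 1]] :: real^4^4)"
  define G where "G = (vector [vector [lorentz u u, 0, 0, 0], vector [0, lorentz v v, 0, 0],
    vector [0, 0, lorentz n n, 0], vector [0, 0, 0, lorentz x x]] :: real^4^4)"
  have "A ** J ** transpose A = G"
    using assms unfolding A_def J_def G_def lorentz_def
    by (simp add: vec_eq_iff forall_4 matrix_matrix_mult_def sum_4 vector_4 transpose_def
        algebra_simps)
  then have "det A * det J * det A = det G"
    by (metis det_mul det_transpose)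
  moreover have "det J = -1"
    unfolding J_def det_4 vector_4 by simp
  moreover have "det G = lorentz u u * lorentz v v * lorentz n n * lorentz x x"
    unfolding G_def det_4 vector_4 by simp
  ultimately show ?thesis
    by (simp add: A_def power2_eq_square)
qed

text \<open>
  The unit normal \<open>n\<close> is eliminated in favour of the cross product, so that the resulting equation
  makes sense, and holds by continuity, also where the metric degenerates.
\<close>

lemma cmc1_laplacian_eq:
  assumes n: "lorentz n n = -1" "lorentz n x = 0" "lorentz n u = 0" "lorentz n v = 0"
    and orientation: "det (vector [u, v, n, x] :: real^4^4) > 0"
    and x: "lorentz x x = 1" "lorentz u x = 0" "lorentz v x = 0"
    and conformal: "lorentz u u = c" "lorentz v v = c" "lorentz u v = 0" "c > 0"
    and L: "lorentz L u = 0" "lorentz L v = 0" "lorentz L x = - 2 * c" "lorentz L n = 2 * c"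
  shows "L = (- 2 * c) *\<^sub>R x + 2 *\<^sub>R lorentz_cross u v x"
proof -
  have xs: "lorentz x u = 0" "lorentz x v = 0" "lorentz x n = 0"
    using x(2,3) n(2) lorentz_commute by metis+
  have "(det (vector [u, v, n, x] :: real^4^4))\<^sup>2 = c\<^sup>2"
    using det_lorentz_orthogonal_frame_power2[of u v n x] n x conformal
    by (simp add: lorentz_commute power2_eq_square)
  then have "det (vector [u, v, n, x] :: real^4^4) = c"
    using orientation conformal(4) by (simp add: power2_eq_iff)
  then have cross_n: "lorentz (lorentz_cross u v x) n = c"
    by (simp add: lorentz_lorentz_cross)
  have cross_tangent: "lorentz (lorentz_cross u v x) u = 0"
      "lorentz (lorentz_cross u v x) v = 0" "lorentz (lorentz_cross u v x) x = 0"
    unfolding lorentz_lorentz_cross det_4 vector_4 by (simp_all add: algebra_simps)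
  have "L + (2 * c) *\<^sub>R x - 2 *\<^sub>R lorentz_cross u v x = 0"
    by (rule lorentz_frame_nondegenerate[OF less_imp_neq[OF orientation, symmetric]])
       (simp_all add: lorentz_simps L x xs cross_tangent cross_n)
  then show ?thesis
    by (simp add: algebra_simps)
qed

definition adjugate :: "complex^2^2 \<Rightarrow> complex^2^2" where
  "adjugate A = vector [vector [A$2$2, - A$1$2], vector [- A$2$1, A$1$1]]"

lemmas mat2_simps = vec_eq_iff forall_2 matrix_matrix_mult_def sum_2 det_2 adjugate_def
  herm_def hconj_def e3_def mat_def

lemma adjugate_mult: "A ** adjugate A = mat (det A)" "adjugate A ** A = mat (det A)"
  by (simp_all add: mat2_simps algebra_simps)

lemma adjugate_simps:
  "adjugate (A + B) = adjugate A + adjugate B" "adjugate (A - B) = adjugate A - adjugate B"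
  "adjugate (- A) = - adjugate A" "adjugate (k *\<^sub>m A) = k *\<^sub>m adjugate A"
  "adjugate (A ** B) = adjugate B ** adjugate A" "adjugate (adjugate A) = A"
  by (simp_all add: mat2_simps algebra_simps)

lemma det_adjugate: "det (adjugate A) = det A"
  by (simp add: mat2_simps)

lemma det_mscale: "det (k *\<^sub>m A) = k\<^sup>2 * det (A :: complex^2^2)"
  by (simp add: det_2 algebra_simps power2_eq_square)

lemma matrix_inv_unique:
  fixes A :: "'a::field^'n^'n"
  assumes "A ** B = mat 1" "B ** A = mat 1"
  shows "matrix_inv A = B"
  unfolding matrix_inv_def
  using assms by (intro some_equality) (metis matrix_mul_assoc matrix_mul_lid matrix_mul_rid)+

lemma matrix_inv_eq_adjugate: "det A = 1 \<Longrightarrow> matrix_inv A = adjugate A"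
  by (simp add: matrix_inv_unique adjugate_mult)

lemma hconj_simps:
  "hconj (A + B) = hconj A + hconj B" "hconj (A - B) = hconj A - hconj B" "hconj (- A) = - hconj A"
  "hconj (k *\<^sub>m A) = cnj k *\<^sub>m hconj A" "hconj (A ** B) = hconj B ** hconj A"
  "hconj (hconj A) = A" "hconj (herm x) = herm x" "hconj e3 = e3"
  by (simp_all add: mat2_simps algebra_simps)

lemma det_hconj: "det (hconj A) = cnj (det A)"
  by (simp add: mat2_simps algebra_simps)

lemma herm_simps:
  "herm (x + y) = herm x + herm y" "herm (x - y) = herm x - herm y"
  "herm (k *\<^sub>R x) = of_real k *\<^sub>m herm x"
  by (simp_all add: mat2_simps algebra_simps)

lemma det_herm: "det (herm x) = - of_real (lorentz x x)"
  unfolding lorentz_def by (simp add: mat2_simps complex_eq_iff algebra_simps)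

lemma det_herm_polar:
  "herm u $1$1 * herm v $2$2 + herm u $2$2 * herm v $1$1
     - herm u $1$2 * herm v $2$1 - herm u $2$1 * herm v $1$2 = of_real (- 2 * lorentz u v)"
  unfolding lorentz_def by (simp add: mat2_simps complex_eq_iff algebra_simps)

lemma de_sitter_iff: "x \<in> de_sitter \<longleftrightarrow> lorentz x x = 1"
  unfolding de_sitter_def det_herm
  by (metis (mono_tags) mem_Collect_eq neg_equal_iff_equal of_real_1 of_real_eq_iff)

lemma herm_mult_adjugate_self:
  "herm x ** adjugate (herm x) = (- of_real (lorentz x x)) *\<^sub>m mat 1"
  "adjugate (herm x) ** herm x = (- of_real (lorentz x x)) *\<^sub>m mat 1"
  by (simp_all add: adjugate_mult det_herm vec_eq_iff mat_def)

lemma herm_mult_adjugate_orthogonal: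
  assumes "lorentz u x = 0"
  shows "herm u ** adjugate (herm x) = - (herm x ** adjugate (herm u))"
proof -
  have "herm u ** adjugate (herm x) + herm x ** adjugate (herm u)
      = (- of_real (2 * lorentz u x)) *\<^sub>m mat 1"
    unfolding lorentz_def by (simp add: mat2_simps complex_eq_iff algebra_simps)
  then show ?thesis
    using assms by (simp add: mscale_simps eq_neg_iff_add_eq_0)
qed

lemma herm_adjugate_cancel:
  assumes "lorentz x x = 1" "lorentz v x = 0"
  shows "herm u ** adjugate (herm x) ** herm v ** adjugate (herm x) = herm u ** adjugate (herm v)"
proof -
  have "herm u ** adjugate (herm x) ** herm v ** adjugate (herm x)
      = herm u ** adjugate (herm x) ** (herm v ** adjugate (herm x))"
    by (simp only: matrix_mul_assoc)
  also have "\<dots> = - (herm u ** (adjugate (herm x) ** herm x) ** adjugate (herm v))"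
    by (simp add: herm_mult_adjugate_orthogonal[OF assms(2)] matrix_mult_simps)
  finally show ?thesis
    by (simp add: herm_mult_adjugate_self assms(1) matrix_mult_simps mscale_simps)
qed

lemma herm_lorentz_cross:
  "2 *\<^sub>m herm (lorentz_cross u v x)
     = (- \<i>) *\<^sub>m (herm u ** adjugate (herm x) ** herm v - herm v ** adjugate (herm x) ** herm u)"
  unfolding lorentz_cross_def Let_def
  by (simp add: mat2_simps vector_4 complex_eq_iff algebra_simps)

lemma herm_laplacian_identity:
  assumes x: "lorentz x x = 1" "lorentz u x = 0" "lorentz v x = 0"
    and conformal: "lorentz u u = c" "lorentz v v = c"
    and L: "L = (- 2 * c) *\<^sub>R x + 2 *\<^sub>R lorentz_cross u v x"
  shows "herm L ** adjugate (herm x)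
    + (herm u - \<i> *\<^sub>m herm v) ** adjugate (herm u + \<i> *\<^sub>m herm v) = 0"
proof -
  let ?X = "herm x" and ?U = "herm u" and ?V = "herm v"
  have "herm L = (- 2 * of_real c) *\<^sub>m ?X
      + (- \<i>) *\<^sub>m (?U ** adjugate ?X ** ?V - ?V ** adjugate ?X ** ?U)"
    unfolding L herm_lorentz_cross[symmetric] herm_simps by simp
  then have "herm L ** adjugate ?X = (- 2 * of_real c) *\<^sub>m (?X ** adjugate ?X)
      + (- \<i>) *\<^sub>m (?U ** adjugate ?X ** ?V ** adjugate ?X - ?V ** adjugate ?X ** ?U ** adjugate ?X)"
    by (simp add: matrix_mult_simps)
  also have "\<dots> = (2 * of_real c) *\<^sub>m mat 1
      + (- \<i>) *\<^sub>m (?U ** adjugate ?V - ?V ** adjugate ?U)"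
    unfolding herm_adjugate_cancel[OF x(1,2)] herm_adjugate_cancel[OF x(1,3)]
    by (simp add: herm_mult_adjugate_self x mscale_simps)
  finally have laplacian: "herm L ** adjugate ?X = \<dots>" .
  have "(?U - \<i> *\<^sub>m ?V) ** adjugate (?U + \<i> *\<^sub>m ?V)
      = ?U ** adjugate ?U + ?V ** adjugate ?V + \<i> *\<^sub>m (?U ** adjugate ?V - ?V ** adjugate ?U)"
    by (simp add: matrix_mult_simps mscale_simps adjugate_simps)
  then show ?thesis
    unfolding laplacian by (simp add: herm_mult_adjugate_self conformal vec_eq_iff algebra_simps)
qed

lemma bounded_linear_herm: "bounded_linear herm"
  and bounded_linear_adjugate: "bounded_linear adjugate"
  and bounded_linear_hconj: "bounded_linear hconj"
  and bounded_linear_mscale: "bounded_linear (\<lambda>A :: complex^'m^'n. k *\<^sub>m A)"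
  unfolding linear_conv_bounded_linear[symmetric]
  by (auto intro!: linearI simp: mat2_simps distrib_left distrib_right)
     (auto simp: scaleR_conv_of_real algebra_simps)

lemmas [derivative_intros] =
  bounded_linear_herm[THEN bounded_linear.has_derivative]
  bounded_linear_adjugate[THEN bounded_linear.has_derivative]
  bounded_linear_hconj[THEN bounded_linear.has_derivative]
  bounded_linear_mscale[THEN bounded_linear.has_derivative]
  bounded_bilinear.FDERIV[OF bounded_bilinear_matrix_matrix_mult]

lemmas [continuous_intros] =
  bounded_linear_herm[THEN bounded_linear.continuous_on]
  bounded_linear_adjugate[THEN bounded_linear.continuous_on]
  bounded_linear_hconj[THEN bounded_linear.continuous_on]
  bounded_linear_mscale[THEN bounded_linear.continuous_on]
  bounded_bilinear.continuous_on[OF bounded_bilinear_matrix_matrix_mult]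
  bounded_bilinear.continuous_on[OF bounded_bilinear_lorentz]

section \<open>The equation of CMC-1 faces\<close>

lemma pd_lorentz:
  assumes "f differentiable (at z)" "g differentiable (at z)"
  shows "pd i (\<lambda>w. lorentz (f w) (g w)) z = lorentz (f z) (pd i g z) + lorentz (pd i f z) (g z)"
  using bounded_bilinear.FDERIV[OF bounded_bilinear_lorentz
      assms[unfolded frechet_derivative_works]]
  by (simp add: pd_eqI pd_def[of _ f] pd_def[of _ g])

lemma pd_eq_on_open:
  assumes "open S" "z \<in> S" "\<And>w. w \<in> S \<Longrightarrow> f w = g w"
  shows "pd i f z = pd i g z"
proof -
  have "(f has_derivative D) (at z) \<longleftrightarrow> (g has_derivative D) (at z)" for D
    using assms by (metis has_derivative_transform_within_open)
  then show ?thesis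
    by (simp add: pd_def frechet_derivative_def)
qed

lemma pd_const: "pd i (\<lambda>w. k) z = 0"
  by (simp add: pd_eqI[OF has_derivative_const])

lemma lorentz_pd_eq_zero_if_const_norm:
  assumes "open S" "z \<in> S" "f differentiable (at z)" "\<And>w. w \<in> S \<Longrightarrow> lorentz (f w) (f w) = k"
  shows "lorentz (pd i f z) (f z) = 0"
  using pd_eq_on_open[OF assms(1,2,4), where i = i] pd_lorentz[OF assms(3,3), of i]
  by (simp add: pd_const lorentz_commute)

definition laplacian :: "(complex \<Rightarrow> 'a::real_normed_vector) \<Rightarrow> complex \<Rightarrow> 'a" where
  "laplacian f z = pd 1 (pd 1 f) z + pd 2 (pd 2 f) z"

lemma lorentz_laplacian_if_const_norm:
  assumes S: "open S" "z \<in> S" and f: "smooth_map_on S f"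
    and norm: "\<And>w. w \<in> S \<Longrightarrow> lorentz (f w) (f w) = k"
  shows "lorentz (laplacian f z) (f z)
    = - (lorentz (pd 1 f z) (pd 1 f z) + lorentz (pd 2 f z) (pd 2 f z))"
proof -
  note diff = smooth_map_on_imp_differentiable
  have "lorentz (pd i f w) (f w) = 0" if "w \<in> S" for i w
    by (rule lorentz_pd_eq_zero_if_const_norm[OF S(1) that diff[OF f that] norm])
  then have "pd i (\<lambda>w. lorentz (pd i f w) (f w)) z = 0" for i
    using pd_eq_on_open[OF S, of "\<lambda>w. lorentz (pd i f w) (f w)" "\<lambda>w. 0"] by (simp add: pd_const)
  then have "lorentz (pd i f z) (pd i f z) + lorentz (pd i (pd i f) z) (f z) = 0" for i
    using pd_lorentz[OF diff[OF smooth_map_on_pd[OF f] S(2)] diff[OF f S(2)]] by metis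
  from this[of 1] this[of 2] show ?thesis
    by (simp add: laplacian_def lorentz_simps)
qed

lemma lorentz_laplacian_pd_if_isothermal:
  assumes S: "open S" "z \<in> S" and f: "smooth_map_on S f"
    and isothermal: "\<And>w. w \<in> S \<Longrightarrow> lorentz (pd 1 f w) (pd 2 f w) = 0"
      "\<And>w. w \<in> S \<Longrightarrow> lorentz (pd 1 f w) (pd 1 f w) = lorentz (pd 2 f w) (pd 2 f w)"
  shows "lorentz (laplacian f z) (pd 1 f z) = 0" "lorentz (laplacian f z) (pd 2 f z) = 0"
proof -
  have diff: "pd i f differentiable (at z)" for i
    using smooth_map_on_imp_differentiable[OF smooth_map_on_pd[OF f] S(2)] .
  have orthogonal: "lorentz (pd 1 f z) (pd i (pd 2 f) z) + lorentz (pd i (pd 1 f) z) (pd 2 f z) = 0"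
    for i
    using pd_eq_on_open[OF S, of "\<lambda>w. lorentz (pd 1 f w) (pd 2 f w)" "\<lambda>w. 0" i] isothermal(1)
      pd_lorentz[OF diff diff, of i]
    by (simp add: pd_const)
  have same_norm: "lorentz (pd 1 f z) (pd i (pd 1 f) z) = lorentz (pd 2 f z) (pd i (pd 2 f) z)"
    for i
    using pd_eq_on_open[OF S, of "\<lambda>w. lorentz (pd 1 f w) (pd 1 f w)"
        "\<lambda>w. lorentz (pd 2 f w) (pd 2 f w)" i] isothermal(2)
      pd_lorentz[OF diff diff, of i]
    by (simp add: lorentz_commute)
  have mixed: "pd 2 (pd 1 f) z = pd 1 (pd 2 f) z"
    by (rule pd_commute[OF S f])
  show "lorentz (laplacian f z) (pd 1 f z) = 0"
    using orthogonal[of 2] same_norm[of 1] mixed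
    by (simp add: laplacian_def lorentz_simps lorentz_commute[of "pd _ f z"])
  show "lorentz (laplacian f z) (pd 2 f z) = 0"
    using orthogonal[of 1] same_norm[of 2] mixed
    by (simp add: laplacian_def lorentz_simps lorentz_commute[of "pd _ f z"])
qed

lemma ds2_nth: "ds2 f z $ i $ j = lorentz (pd i f z) (pd j f z)"
  by (simp add: ds2_def induced_def pd_def)

lemma ds2_eq_matD:
  assumes "ds2 f z = mat c"
  shows "lorentz (pd 1 f z) (pd 1 f z) = c" "lorentz (pd 2 f z) (pd 2 f z) = c"
    "lorentz (pd 1 f z) (pd 2 f z) = 0"
  using assms by (simp_all add: mat_def flip: ds2_nth)

lemma matrix_inv_mat:
  assumes "c \<noteq> 0"
  shows "matrix_inv (mat c :: real^'n^'n) = mat (1 / c)"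
proof (rule matrix_inv_unique)
  have "(mat a :: real^'n^'n) = a *\<^sub>R mat 1" for a
    by (simp add: vec_eq_iff mat_def)
  then show "(mat c :: real^'n^'n) ** mat (1 / c) = mat 1"
    "mat (1 / c) ** (mat c :: real^'n^'n) = mat 1"
    using assms by (metis (no_types) scaleR_one matrix_mul_lid nonzero_divide_eq_eq
        scaleR_scaleR scalar_matrix_assoc mult.commute)+
qed

lemma mean_curvature_isothermal:
  assumes "ds2 f z = mat c" "c \<noteq> 0"
  shows "mean_curvature f z n = lorentz (laplacian f z) n / (2 * c)"
  using assms(2) unfolding mean_curvature_def assms(1) matrix_inv_mat[OF assms(2)]
  by (simp add: trace_def sum_2 matrix_matrix_mult_def mat_def second_form_def laplacian_def
      lorentz_simps add_divide_distrib)

lemma pos_def_det_neq_zero: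
  assumes "pos_def A"
  shows "det A \<noteq> 0"
proof
  assume "det A = 0"
  then obtain v where "v \<noteq> 0" "A *v v = 0"
    by (metis invertible_det_nz invertible_left_inverse matrix_left_invertible_ker)
  then show False
    using assms unfolding pos_def_def by (metis inner_zero_right less_irrefl)
qed

lemma cmc1_face_imp_open: "cmc1_face M f \<Longrightarrow> open M"
  and cmc1_face_imp_smooth: "cmc1_face M f \<Longrightarrow> smooth_map_on M f"
  and cmc1_face_imp_de_sitter: "cmc1_face M f \<Longrightarrow> z \<in> M \<Longrightarrow> lorentz (f z) (f z) = 1"
  by (auto simp: cmc1_face_def simp flip: de_sitter_iff)

lemma cmc1_face_imp_differentiable: "cmc1_face M f \<Longrightarrow> z \<in> M \<Longrightarrow> f differentiable (at z)"
  using cmc1_face_imp_smooth smooth_map_on_imp_differentiable by blast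

lemma cmc1_face_tangent:
  assumes "cmc1_face M f" "z \<in> M"
  shows "lorentz (pd i f z) (f z) = 0"
  using assms
  by (intro lorentz_pd_eq_zero_if_const_norm[of M z f 1])
     (simp_all add: cmc1_face_imp_open cmc1_face_imp_differentiable cmc1_face_imp_de_sitter)

lemma cmc1_face_regular_set:
  assumes "cmc1_face M f"
  obtains W where "open W" "W \<subseteq> M" "M \<subseteq> closure W" "spacelike_cmc1_on W f"
    "\<And>w. w \<in> W \<Longrightarrow> \<exists>c>0. ds2 f w = mat c"
proof -
  obtain W where W: "open W" "W \<subseteq> M" "M \<subseteq> closure W" "spacelike_cmc1_on W f"
    using assms unfolding cmc1_face_def by blast
  have "w \<in> M - singular_set M f" if "w \<in> W" for w
    using that W pos_def_det_neq_zero unfolding spacelike_cmc1_on_def singular_set_def by auto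
  then have "\<exists>c>0. ds2 f w = mat c" if "w \<in> W" for w
    using assms that unfolding cmc1_face_def by blast
  with W that show thesis by blast
qed

lemma cmc1_face_isothermal:
  assumes face: "cmc1_face M f" and z: "z \<in> M"
  shows "lorentz (pd 1 f z) (pd 2 f z) = 0"
    "lorentz (pd 1 f z) (pd 1 f z) = lorentz (pd 2 f z) (pd 2 f z)"
proof -
  obtain W where W: "W \<subseteq> M" "M \<subseteq> closure W" "\<And>w. w \<in> W \<Longrightarrow> \<exists>c>0. ds2 f w = mat c"
    using cmc1_face_regular_set[OF face] by metis
  then have regular: "lorentz (pd 1 f w) (pd 2 f w) = 0"
    "lorentz (pd 1 f w) (pd 1 f w) = lorentz (pd 2 f w) (pd 2 f w)" if "w \<in> W" for w
    using ds2_eq_matD that by metis+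
  have cont: "continuous_on M (pd i f)" for i
    by (intro smooth_map_on_imp_continuous_on smooth_map_on_pd cmc1_face_imp_smooth face)
  show "lorentz (pd 1 f z) (pd 2 f z) = 0"
    by (rule continuous_on_eq_dense[OF _ _ W(1,2) regular(1) z]) (intro continuous_intros cont)+
  show "lorentz (pd 1 f z) (pd 1 f z) = lorentz (pd 2 f z) (pd 2 f z)"
    by (rule continuous_on_eq_dense[OF _ _ W(1,2) regular(2) z]) (intro continuous_intros cont)+
qed

lemma cmc1_face_laplacian_regular:
  assumes face: "cmc1_face M f" and W: "open W" "W \<subseteq> M" "spacelike_cmc1_on W f"
    and w: "w \<in> W" and metric: "ds2 f w = mat c" "c > 0"
  shows "laplacian f w = (- 2 * c) *\<^sub>R f w + 2 *\<^sub>R lorentz_cross (pd 1 f w) (pd 2 f w) (f w)"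
proof -
  have wM: "w \<in> M" and open_M: "open M" and smooth: "smooth_map_on M f"
    using w W(2) face cmc1_face_imp_open cmc1_face_imp_smooth by auto
  obtain n where n: "unit_normal f w n" "mean_curvature f w n = 1"
    using W(3) w unfolding spacelike_cmc1_on_def by blast
  show ?thesis
  proof (rule cmc1_laplacian_eq[of n])
    show "lorentz n n = -1" "lorentz n (f w) = 0" "lorentz n (pd 1 f w) = 0"
      "lorentz n (pd 2 f w) = 0" "det (vector [pd 1 f w, pd 2 f w, n, f w] :: real^4^4) > 0"
      using n(1) by (simp_all add: unit_normal_def)
    show "lorentz (f w) (f w) = 1" "lorentz (pd 1 f w) (f w) = 0" "lorentz (pd 2 f w) (f w) = 0"
      using face wM by (simp_all add: cmc1_face_imp_de_sitter cmc1_face_tangent)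
    show "lorentz (pd 1 f w) (pd 1 f w) = c" "lorentz (pd 2 f w) (pd 2 f w) = c"
      "lorentz (pd 1 f w) (pd 2 f w) = 0" "c > 0"
      using metric by (simp_all add: ds2_eq_matD)
    show "lorentz (laplacian f w) (pd 1 f w) = 0" "lorentz (laplacian f w) (pd 2 f w) = 0"
      by (rule lorentz_laplacian_pd_if_isothermal[OF open_M wM smooth
          cmc1_face_isothermal[OF face]];
          assumption)+
    show "lorentz (laplacian f w) (f w) = - 2 * c"
      using lorentz_laplacian_if_const_norm[OF open_M wM smooth cmc1_face_imp_de_sitter[OF face]]
      by (simp add: ds2_eq_matD[OF metric(1)])
    show "lorentz (laplacian f w) n = 2 * c"
      using n(2) metric(2) mean_curvature_isothermal[OF metric(1)] by (simp add: field_simps)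
  qed
qed

definition herm_dz :: "(complex \<Rightarrow> real^4) \<Rightarrow> complex \<Rightarrow> complex^2^2" where
  "herm_dz f z = (1 / 2) *\<^sub>m (herm (pd 1 f z) - \<i> *\<^sub>m herm (pd 2 f z))"

lemma hconj_herm_dz: "hconj (herm_dz f z) = (1 / 2) *\<^sub>m (herm (pd 1 f z) + \<i> *\<^sub>m herm (pd 2 f z))"
  by (simp add: herm_dz_def hconj_simps mscale_simps)

lemma cmc1_face_laplacian:
  assumes face: "cmc1_face M f" and z: "z \<in> M"
  shows "herm (laplacian f z) ** adjugate (herm (f z))
    + 4 *\<^sub>m (herm_dz f z ** adjugate (hconj (herm_dz f z))) = 0"
proof -
  obtain W where W: "open W" "W \<subseteq> M" "M \<subseteq> closure W" "spacelike_cmc1_on W f"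
    and conformal: "\<And>w. w \<in> W \<Longrightarrow> \<exists>c>0. ds2 f w = mat c"
    using cmc1_face_regular_set[OF face] by metis
  note smooth = cmc1_face_imp_smooth[OF face]
  have regular: "herm (laplacian f w) ** adjugate (herm (f w))
    + 4 *\<^sub>m (herm_dz f w ** adjugate (hconj (herm_dz f w))) = 0" if w: "w \<in> W" for w
  proof -
    obtain c where metric: "ds2 f w = mat c" "c > 0"
      using conformal[OF w] by blast
    have "w \<in> M" using w W(2) by blast
    then have "herm (laplacian f w) ** adjugate (herm (f w))
        + (herm (pd 1 f w) - \<i> *\<^sub>m herm (pd 2 f w))
          ** adjugate (herm (pd 1 f w) + \<i> *\<^sub>m herm (pd 2 f w)) = 0"
      using face
      by (intro herm_laplacian_identity[where c = c]
          cmc1_face_laplacian_regular[OF face W(1,2,4) w metric])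
         (simp_all add: cmc1_face_imp_de_sitter cmc1_face_tangent ds2_eq_matD[OF metric(1)])
    then show ?thesis
      unfolding hconj_herm_dz
      by (simp add: herm_dz_def adjugate_simps matrix_mult_simps mscale_simps)
  qed
  show ?thesis
    by (rule continuous_on_eq_dense[OF _ continuous_on_const W(2,3) regular z])
       (unfold laplacian_def herm_dz_def,
        intro continuous_intros smooth_map_on_imp_continuous_on smooth_map_on_pd smooth)
qed

section \<open>The logarithmic derivative of a CMC-1 face\<close>

text \<open>
  With \<open>X = herm \<circ> f\<close> this is \<open>X\<^sub>z X\<^sup>-\<^sup>1\<close>, since \<open>det X = -1\<close>.
\<close>

definition log_deriv :: "(complex \<Rightarrow> real^4) \<Rightarrow> complex \<Rightarrow> complex^2^2" where
  "log_deriv f z = - (herm_dz f z ** adjugate (herm (f z)))"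

lemma has_derivative_log_deriv:
  assumes "smooth_map_on S f" "z \<in> S"
  shows "(log_deriv f has_derivative
        (\<lambda>h. Re h *\<^sub>R pd 1 (log_deriv f) z + Im h *\<^sub>R pd 2 (log_deriv f) z))
      (at z)"
    "pd i (log_deriv f) z = - (((1 / 2) *\<^sub>m (herm (pd i (pd 1 f) z) - \<i> *\<^sub>m herm (pd i (pd 2 f) z)))
      ** adjugate (herm (f z)) + herm_dz f z ** adjugate (herm (pd i f z)))"
proof -
  have df: "(f has_derivative frechet_derivative f (at z)) (at z)"
    and dpd: "(pd k f has_derivative frechet_derivative (pd k f) (at z)) (at z)" for k
    using assms smooth_map_on_imp_differentiable smooth_map_on_pd
    unfolding frechet_derivative_works[symmetric] by blast+
  have "(log_deriv f has_derivative
      (\<lambda>h. - (herm_dz f z ** adjugate (herm (frechet_derivative f (at z) h))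
      + ((1 / 2) *\<^sub>m (herm (frechet_derivative (pd 1 f) (at z) h)
        - \<i> *\<^sub>m herm (frechet_derivative (pd 2 f) (at z) h))) ** adjugate (herm (f z))))) (at z)"
    unfolding log_deriv_def[abs_def] herm_dz_def by (intro derivative_intros df dpd)
  from pd_eqI[OF this] has_derivative_pd[OF differentiableI[OF this]] show
    "(log_deriv f has_derivative
      (\<lambda>h. Re h *\<^sub>R pd 1 (log_deriv f) z + Im h *\<^sub>R pd 2 (log_deriv f) z))
      (at z)"
    "pd i (log_deriv f) z = - (((1 / 2) *\<^sub>m (herm (pd i (pd 1 f) z) - \<i> *\<^sub>m herm (pd i (pd 2 f) z)))
      ** adjugate (herm (f z)) + herm_dz f z ** adjugate (herm (pd i f z)))"
    by (simp_all add: pd_def[of _ f] pd_def[of _ "pd _ f"] add.commute)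
qed

lemma cmc1_face_pd_log_deriv:
  assumes face: "cmc1_face M f" and z: "z \<in> M"
  shows "pd 2 (log_deriv f) z = \<i> *\<^sub>m pd 1 (log_deriv f) z"
proof -
  note smooth = cmc1_face_imp_smooth[OF face]
  have mixed: "pd 2 (pd 1 f) z = pd 1 (pd 2 f) z"
    by (rule pd_commute[OF cmc1_face_imp_open[OF face] z smooth])
  have "pd 1 (log_deriv f) z + \<i> *\<^sub>m pd 2 (log_deriv f) z
      = (- (1 / 2)) *\<^sub>m (herm (laplacian f z) ** adjugate (herm (f z))
          + 4 *\<^sub>m (herm_dz f z ** adjugate (hconj (herm_dz f z))))"
    unfolding has_derivative_log_deriv(2)[OF smooth z] mixed laplacian_def hconj_herm_dz
    by (simp add: herm_simps adjugate_simps matrix_mult_simps mscale_simps)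
  then have dbar: "pd 1 (log_deriv f) z + \<i> *\<^sub>m pd 2 (log_deriv f) z = 0"
    unfolding cmc1_face_laplacian[OF face z] by (simp add: mscale_simps)
  have "pd 2 (log_deriv f) z
      = \<i> *\<^sub>m pd 1 (log_deriv f) z - \<i> *\<^sub>m (pd 1 (log_deriv f) z + \<i> *\<^sub>m pd 2 (log_deriv f) z)"
    by (simp add: mscale_simps)
  then show ?thesis
    unfolding dbar by (simp add: mscale_simps)
qed

lemma log_deriv_holomorphic:
  assumes face: "cmc1_face M f"
  shows "log_deriv f matrix_holomorphic_on M"
proof (rule matrix_holomorphic_on_open[OF cmc1_face_imp_open[OF face]])
  fix z assume z: "z \<in> M"
  show "(log_deriv f has_matrix_derivative pd 1 (log_deriv f) z) (at z)"
    using has_matrix_derivative_of_has_derivative[OF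
        has_derivative_log_deriv(1)[OF cmc1_face_imp_smooth[OF face] z]]
      cmc1_face_pd_log_deriv[OF face z]
    by simp
qed

context
  fixes M f z
  assumes face: "cmc1_face M f" and z: "z \<in> M"
begin

lemma log_deriv_mult_herm: "log_deriv f z ** herm (f z) = herm_dz f z"
proof -
  have "log_deriv f z ** herm (f z) = - (herm_dz f z ** (adjugate (herm (f z)) ** herm (f z)))"
    by (simp add: log_deriv_def matrix_mult_simps)
  then show ?thesis
    using cmc1_face_imp_de_sitter[OF face z]
    by (simp add: herm_mult_adjugate_self matrix_mult_simps mscale_simps)
qed

lemma adjugate_log_deriv: "adjugate (log_deriv f z) = - log_deriv f z"
proof -
  have "herm (pd i f z) ** adjugate (herm (f z)) = - (herm (f z) ** adjugate (herm (pd i f z)))"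
    for i
    by (rule herm_mult_adjugate_orthogonal[OF cmc1_face_tangent[OF face z]])
  then have "herm_dz f z ** adjugate (herm (f z)) = - (herm (f z) ** adjugate (herm_dz f z))"
    by (simp add: herm_dz_def matrix_mult_simps mscale_simps adjugate_simps)
  then show ?thesis
    by (simp add: log_deriv_def adjugate_simps)
qed

lemma det_log_deriv: "det (log_deriv f z) = 0"
proof -
  define U V where "U = herm (pd 1 f z)" and "V = herm (pd 2 f z)"
  note isothermal = cmc1_face_isothermal[OF face z]
  have "4 * det (herm_dz f z)
      = det U - det V - \<i> * (U$1$1 * V$2$2 + U$2$2 * V$1$1 - U$1$2 * V$2$1 - U$2$1 * V$1$2)"
    by (simp add: herm_dz_def det_2 algebra_simps flip: U_def V_def)
  also have "\<dots> = 0"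
    unfolding U_def V_def det_herm_polar by (simp add: det_herm isothermal)
  finally have "det (herm_dz f z) = 0"
    by simp
  moreover have "det (- A) = det A" for A :: "complex^2^2"
    by (simp add: det_2)
  ultimately show ?thesis
    by (simp add: log_deriv_def det_mul)
qed

lemma log_deriv_neq_zero: "log_deriv f z \<noteq> 0"
proof
  assume "log_deriv f z = 0"
  then have "herm_dz f z = 0"
    using log_deriv_mult_herm by (simp add: matrix_mult_simps)
  then have "herm (pd 1 f z) = \<i> *\<^sub>m herm (pd 2 f z)"
    by (simp add: herm_dz_def vec_eq_iff)
  then have "pd 1 f z = 0 \<and> pd 2 f z = 0"
    by (auto simp: mat2_simps complex_eq_iff forall_4)
  then have "(f has_derivative (\<lambda>h. 0)) (at z)"
    using has_derivative_pd[OF cmc1_face_imp_differentiable[OF face z]] by simp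
  then have "frechet_derivative f (at z) = (\<lambda>h. 0)"
    using frechet_derivative_at by metis
  then show False
    using face z unfolding cmc1_face_def by blast
qed

end

section \<open>Null frames\<close>

lemma SL2_frame_of_frame:
  assumes A: "A ** e3 ** hconj A = herm x" and x: "lorentz x x = 1"
  obtains F where "det F = 1" "F ** e3 ** hconj F = herm x"
proof
  define D :: "complex^2^2" where "D = vector [vector [1 / det A, 0], vector [0, 1]]"
  have "det (A ** e3 ** hconj A) = - (det A * cnj (det A))"
    by (simp add: det_mul det_hconj) (simp add: e3_def det_2 algebra_simps)
  then have norm: "det A * cnj (det A) = 1"
    by (simp add: A det_herm x)
  then have "det A \<noteq> 0"
    by auto
  then show "det (A ** D) = 1"
    by (simp add: det_mul) (simp add: D_def det_2)
  have "D ** e3 ** hconj D = e3"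
    using norm by (simp add: D_def mat2_simps)
  then have "A ** D ** e3 ** hconj (A ** D) = A ** e3 ** hconj A"
    by (simp add: hconj_simps matrix_mult_simps) (metis matrix_mul_assoc)
  then show "A ** D ** e3 ** hconj (A ** D) = herm x"
    using A by simp
qed

lemma unit_complex_rotates_to_norm:
  obtains \<epsilon> where "\<epsilon> * cnj \<epsilon> = 1" "z * \<epsilon> = of_real (cmod z)"
proof (cases "z = 0")
  case True
  then show thesis
    by (intro that[of 1]) simp_all
next
  case False
  moreover have "z * cnj z = of_real (cmod z) * of_real (cmod z)"
    by (simp flip: complex_norm_square power2_eq_square of_real_mult)
  ultimately show thesis
    by (intro that[of "cnj z / of_real (cmod z)"]) (simp_all add: mult.commute[of "cnj z"])
qed

lemma sub_divide_eq_self_if_power2_eq: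
  fixes b \<alpha> \<delta> :: real
  assumes "b\<^sup>2 = 1 + \<alpha> * \<delta>" "b + 1 \<noteq> 0"
  shows "2 * (\<delta> * b / (b + 1)) - \<alpha> * (\<delta> / (b + 1))\<^sup>2 = \<delta>"
proof -
  have "2 * (\<delta> * b / (b + 1)) - \<alpha> * (\<delta> / (b + 1))\<^sup>2 = \<delta> * (2 * b * (b + 1) - \<alpha> * \<delta>) / (b + 1)\<^sup>2"
    using assms(2) by (simp add: divide_simps power2_eq_square) (simp add: algebra_simps)
  also have "2 * b * (b + 1) - \<alpha> * \<delta> = (b + 1)\<^sup>2"
    using assms(1) by (simp add: power2_eq_square algebra_simps)
  finally show ?thesis
    using assms(2) by simp
qed

lemma de_sitter_frame_exists:
  assumes x: "lorentz x x = 1"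
  obtains F where "det F = 1" "F ** e3 ** hconj F = herm x"
proof -
  define \<alpha> \<delta> where "\<alpha> = x$1 + x$4" and "\<delta> = x$1 - x$4"
  define \<beta> where "\<beta> = of_real (x$2) + \<i> * of_real (x$3)"
  define b where "b = cmod \<beta>"
  have "b\<^sup>2 = (x$2)\<^sup>2 + (x$3)\<^sup>2"
    by (simp add: b_def \<beta>_def cmod_power2)
  then have "b\<^sup>2 = 1 + \<alpha> * \<delta>"
    using x by (simp add: lorentz_def \<alpha>_def \<delta>_def power2_eq_square algebra_simps)
  moreover have "b \<ge> 0"
    by (simp add: b_def)
  ultimately have entry: "2 * (\<delta> * b / (b + 1)) - \<alpha> * (\<delta> / (b + 1))\<^sup>2 = \<delta>"
    by (intro sub_divide_eq_self_if_power2_eq) simp_all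
  obtain \<epsilon> where rotation: "\<epsilon> * cnj \<epsilon> = 1" "\<beta> * \<epsilon> = of_real b"
    unfolding b_def by (rule unit_complex_rotates_to_norm)
  define k where "k = of_real (- \<delta> / (b + 1)) * \<epsilon>"
  define p q where "p = (\<alpha> + 1) / 2" and "q = (\<alpha> - 1) / 2"
  define A :: "complex^2^2" where
    "A = vector [vector [of_real p, of_real q],
      vector [cnj \<beta> + of_real q * k, cnj \<beta> + of_real p * k]]"
  have pq: "p - q = 1" "p\<^sup>2 - q\<^sup>2 = \<alpha>"
    by (simp_all add: p_def q_def power2_eq_square field_simps)
  have "\<beta> * k = of_real (- \<delta> / (b + 1)) * (\<beta> * \<epsilon>)"
    and "k * cnj k = of_real ((- \<delta> / (b + 1))\<^sup>2) * (\<epsilon> * cnj \<epsilon>)"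
    by (simp_all add: k_def power2_eq_square mult_ac)
  then have products: "\<beta> * k = of_real (- \<delta> * b / (b + 1))" "k * cnj k = of_real ((\<delta> / (b + 1))\<^sup>2)"
    by (simp_all add: rotation power2_eq_square)
  have herm_x: "herm x = vector [vector [of_real (p\<^sup>2 - q\<^sup>2), of_real (p - q) * \<beta>],
      vector [of_real (p - q) * cnj \<beta>, of_real \<delta>]]"
    unfolding pq by (simp add: mat2_simps \<alpha>_def \<beta>_def \<delta>_def)
  have "(cnj \<beta> + of_real q * k) * (\<beta> + of_real q * cnj k)
      - (cnj \<beta> + of_real p * k) * (\<beta> + of_real p * cnj k)
      = - of_real (p - q) * (\<beta> * k + cnj (\<beta> * k)) - of_real (p\<^sup>2 - q\<^sup>2) * (k * cnj k)"
    by (simp add: power2_eq_square algebra_simps)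
  also have "\<dots> = of_real (2 * (\<delta> * b / (b + 1)) - \<alpha> * (\<delta> / (b + 1))\<^sup>2)"
    unfolding products pq by (simp only: complex_cnj_complex_of_real) simp
  finally have "A ** e3 ** hconj A = herm x"
    unfolding herm_x entry by (simp add: A_def mat2_simps power2_eq_square algebra_simps)
  then show thesis
    using SL2_frame_of_frame[OF _ x] that by blast
qed

lemma open_left_half_plane: "open left_half_plane"
  and convex_left_half_plane: "convex left_half_plane"
  unfolding left_half_plane_def by (auto simp: open_halfspace_Re_lt convex_halfspace_Re_lt)

lemma exp_in_punctured_disk: "w \<in> left_half_plane \<Longrightarrow> exp w \<in> punctured_disk 1"
  by (simp add: left_half_plane_def punctured_disk_def)

abbreviation deck_period :: complex where
  "deck_period \<equiv> 2 * of_real pi * \<i>"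

lemma add_deck_period_in_left_half_plane:
  "w \<in> left_half_plane \<Longrightarrow> w + deck_period \<in> left_half_plane"
  by (simp add: left_half_plane_def)

definition has_monodromy :: "(complex \<Rightarrow> complex^2^2) \<Rightarrow> complex^2^2 \<Rightarrow> bool" where
  "has_monodromy F \<rho> \<longleftrightarrow> (\<forall>w\<in>left_half_plane. F (w + deck_period) = F w ** \<rho>)"

text \<open>
  The condition on the adjugate says that the trace is zero.
\<close>

definition null_matrix :: "complex^2^2 \<Rightarrow> bool" where
  "null_matrix N \<longleftrightarrow> adjugate N = - N \<and> det N = 0"

definition null_frame ::
    "(complex \<Rightarrow> real^4) \<Rightarrow> (complex \<Rightarrow> complex^2^2) \<Rightarrow> (complex \<Rightarrow> complex^2^2) \<Rightarrow> bool" where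
  "null_frame f F N \<longleftrightarrow> N matrix_holomorphic_on left_half_plane \<and>
     (\<forall>w\<in>left_half_plane. (F has_matrix_derivative F w ** N w) (at w) \<and> det (F w) = 1 \<and>
        herm (f (exp w)) = F w ** e3 ** hconj (F w) \<and> null_matrix (N w))"

lemma has_matrix_derivative_adjugate:
  assumes "(F has_matrix_derivative D) (at w)"
  shows "((\<lambda>w. adjugate (F w)) has_matrix_derivative adjugate D) (at w)"
  using bounded_linear.has_derivative[OF bounded_linear_adjugate
      assms[unfolded has_matrix_derivative_def]]
  by (simp add: has_matrix_derivative_def adjugate_simps)

definition log_deriv_exp :: "(complex \<Rightarrow> real^4) \<Rightarrow> complex \<Rightarrow> complex^2^2" where
  "log_deriv_exp f w = exp w *\<^sub>m log_deriv f (exp w)"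

lemma log_deriv_exp_periodic: "log_deriv_exp f (w + deck_period) = log_deriv_exp f w"
  by (simp add: log_deriv_exp_def exp_add exp_two_pi_i)

lemma log_deriv_exp_holomorphic:
  assumes "cmc1_face (punctured_disk 1) f"
  shows "log_deriv_exp f matrix_holomorphic_on left_half_plane"
proof -
  have "(\<lambda>z. log_deriv f z $ i $ j) \<circ> exp holomorphic_on left_half_plane" for i j
    using matrix_holomorphic_onD[OF log_deriv_holomorphic[OF assms]]
    by (rule holomorphic_on_compose_gen[rotated])
       (auto intro!: holomorphic_intros exp_in_punctured_disk)
  then show ?thesis
    by (auto simp: matrix_holomorphic_on_def log_deriv_exp_def o_def intro!: holomorphic_intros)
qed

lemma has_derivative_herm_exp:
  assumes face: "cmc1_face (punctured_disk 1) f" and w: "w \<in> left_half_plane"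
  defines "Y \<equiv> log_deriv_exp f w ** herm (f (exp w))"
  shows "((\<lambda>w. herm (f (exp w))) has_derivative (\<lambda>h. h *\<^sub>m Y + hconj (h *\<^sub>m Y))) (at w)"
proof -
  note z = exp_in_punctured_disk[OF w]
  have Y: "Y = exp w *\<^sub>m herm_dz f (exp w)"
    unfolding Y_def log_deriv_exp_def
    by (simp add: matrix_mult_simps log_deriv_mult_herm[OF face z])
  have split: "of_real (Re c) *\<^sub>m herm (pd 1 f z) + of_real (Im c) *\<^sub>m herm (pd 2 f z)
      = c *\<^sub>m herm_dz f z + hconj (c *\<^sub>m herm_dz f z)" for c z
  proof -
    have "complex_of_real (Re c) = (c + cnj c) / 2" "complex_of_real (Im c) = \<i> * (cnj c - c) / 2"
      by (simp_all add: complex_eq_iff)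
    then show ?thesis
      unfolding hconj_simps hconj_herm_dz
      by (simp only:) (simp add: herm_dz_def vec_eq_iff field_simps)
  qed
  have "(exp has_derivative (\<lambda>h. exp w * h)) (at w)"
    using DERIV_exp[of w] by (simp add: has_field_derivative_def)
  from diff_chain_at[OF this has_derivative_pd[OF cmc1_face_imp_differentiable[OF face z]]]
  have "((\<lambda>w. herm (f (exp w))) has_derivative
      (\<lambda>h. herm (Re (exp w * h) *\<^sub>R pd 1 f (exp w) + Im (exp w * h) *\<^sub>R pd 2 f (exp w)))) (at w)"
    by (intro derivative_intros) (simp add: o_def)
  then show ?thesis
    unfolding herm_simps split Y by (simp add: mscale_simps mult.commute)
qed

lemma adjugate_inverse:
  assumes "det A = 1"
  shows "A ** adjugate A = mat 1" "adjugate A ** A = mat 1"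
    "A ** (adjugate A ** B) = B" "adjugate A ** (A ** B) = B"
  using assms by (simp_all add: adjugate_mult matrix_mul_assoc)

context
  fixes f
  assumes face: "cmc1_face (punctured_disk 1) f"
begin

lemma adjugate_log_deriv_exp:
  "w \<in> left_half_plane \<Longrightarrow> adjugate (log_deriv_exp f w) = - log_deriv_exp f w"
  using adjugate_log_deriv[OF face exp_in_punctured_disk]
  by (simp add: log_deriv_exp_def adjugate_simps mscale_simps)

lemma det_log_deriv_exp: "w \<in> left_half_plane \<Longrightarrow> det (log_deriv_exp f w) = 0"
  using det_log_deriv[OF face exp_in_punctured_disk] by (simp add: log_deriv_exp_def det_mscale)

lemma log_deriv_exp_neq_zero: "w \<in> left_half_plane \<Longrightarrow> log_deriv_exp f w \<noteq> 0"
  using log_deriv_neq_zero[OF face exp_in_punctured_disk]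
  by (auto simp: log_deriv_exp_def vec_eq_iff)

context
  fixes F :: "complex \<Rightarrow> complex^2^2"
  assumes F: "\<And>w. w \<in> left_half_plane \<Longrightarrow> (F has_matrix_derivative log_deriv_exp f w ** F w) (at w)"
begin

lemma adjugate_solution_derivative:
  assumes "w \<in> left_half_plane"
  shows "((\<lambda>w. adjugate (F w)) has_matrix_derivative
    - (adjugate (F w) ** log_deriv_exp f w)) (at w)"
  using has_matrix_derivative_adjugate[OF F[OF assms]]
  by (simp add: adjugate_simps adjugate_log_deriv_exp assms matrix_mult_simps)

lemma det_solution_const:
  assumes "v \<in> left_half_plane" "w \<in> left_half_plane"
  shows "det (F v) = det (F w)"
proof -
  have "adjugate (F v) ** F v = adjugate (F w) ** F w"
    using has_matrix_derivative_mult[OF adjugate_solution_derivative F]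
    by (intro has_matrix_derivative_zero_unique[OF open_left_half_plane
          convex_connected[OF convex_left_half_plane] _ assms])
       (simp add: matrix_mult_simps)
  then show ?thesis
    by (simp add: adjugate_mult mat_def vec_eq_iff forall_2)
qed

lemma solution_translate_const:
  assumes "v \<in> left_half_plane" "w \<in> left_half_plane"
  shows "adjugate (F v) ** F (v + deck_period) = adjugate (F w) ** F (w + deck_period)"
proof (rule has_matrix_derivative_zero_unique[OF open_left_half_plane
      convex_connected[OF convex_left_half_plane] _ assms])
  fix u assume u: "u \<in> left_half_plane"
  have "((\<lambda>w. F (w + deck_period)) has_matrix_derivative
      log_deriv_exp f u ** F (u + deck_period)) (at u)"
    using has_matrix_derivative_shift[OF F[OF add_deck_period_in_left_half_plane[OF u]]]
    by (simp add: log_deriv_exp_periodic)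
  from has_matrix_derivative_mult[OF adjugate_solution_derivative[OF u] this]
  show "((\<lambda>w. adjugate (F w) ** F (w + deck_period)) has_matrix_derivative 0) (at u)"
    by (simp add: matrix_mult_simps)
qed

lemma herm_solution_const:
  assumes "v \<in> left_half_plane" "w \<in> left_half_plane"
  shows "adjugate (F v) ** herm (f (exp v)) ** hconj (adjugate (F v))
    = adjugate (F w) ** herm (f (exp w)) ** hconj (adjugate (F w))"
proof (rule has_derivative_zero_unique_connected[OF open_left_half_plane
      convex_connected[OF convex_left_half_plane] _ assms])
  fix u assume u: "u \<in> left_half_plane"
  define K A X where "K = adjugate (F u)" and "A = log_deriv_exp f u" and "X = herm (f (exp u))"
  have dK: "((\<lambda>w. adjugate (F w)) has_derivative (\<lambda>h. - (h *\<^sub>m (K ** A)))) (at u)"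
    using adjugate_solution_derivative[OF u]
    by (simp add: has_matrix_derivative_def K_def A_def mscale_simps)
  have dX: "((\<lambda>w. herm (f (exp w))) has_derivative
      (\<lambda>h. h *\<^sub>m (A ** X) + hconj (h *\<^sub>m (A ** X)))) (at u)"
    using has_derivative_herm_exp[OF face u] by (simp add: A_def X_def)
  have "hconj X = X"
    by (simp add: X_def hconj_simps)
  have "((\<lambda>w. adjugate (F w) ** herm (f (exp w)) ** hconj (adjugate (F w))) has_derivative
      (\<lambda>h. K ** X ** hconj (- (h *\<^sub>m (K ** A)))
        + (K ** (h *\<^sub>m (A ** X) + hconj (h *\<^sub>m (A ** X)))
          + (- (h *\<^sub>m (K ** A))) ** X) ** hconj K)) (at u)"
    unfolding K_def X_def by (intro derivative_intros dK[unfolded K_def] dX[unfolded X_def])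
  then show "((\<lambda>w. adjugate (F w) ** herm (f (exp w)) ** hconj (adjugate (F w)))
      has_derivative (\<lambda>h. 0)) (at u)"
    by (simp add: matrix_mult_simps mscale_simps hconj_simps \<open>hconj X = X\<close>)
qed

end

end

lemma holomorphic_lift_exists:
  assumes face: "cmc1_face (punctured_disk 1) f"
  obtains F where
    "\<And>w. w \<in> left_half_plane \<Longrightarrow> (F has_matrix_derivative log_deriv_exp f w ** F w) (at w)"
    "\<And>w. w \<in> left_half_plane \<Longrightarrow> det (F w) = 1"
    "\<And>w. w \<in> left_half_plane \<Longrightarrow> herm (f (exp w)) = F w ** e3 ** hconj (F w)"
proof -
  define w0 :: complex where "w0 = -1"
  have w0: "w0 \<in> left_half_plane"
    by (simp add: w0_def left_half_plane_def)
  obtain F0 where F0: "det F0 = 1" "F0 ** e3 ** hconj F0 = herm (f (exp w0))"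
    using de_sitter_frame_exists cmc1_face_imp_de_sitter[OF face exp_in_punctured_disk[OF w0]]
    by blast
  obtain F where F: "F w0 = F0"
    "\<And>w. w \<in> left_half_plane \<Longrightarrow> (F has_matrix_derivative log_deriv_exp f w ** F w) (at w)"
    using holomorphic_linear_ode[OF open_left_half_plane convex_left_half_plane w0
        log_deriv_exp_holomorphic[OF face]] by blast
  have det: "det (F w) = 1" if "w \<in> left_half_plane" for w
    using det_solution_const[OF face F(2) w0 that] F0 F(1) by simp
  have "herm (f (exp w)) = F w ** e3 ** hconj (F w)" if w: "w \<in> left_half_plane" for w
  proof -
    have "adjugate (F w) ** herm (f (exp w)) ** hconj (adjugate (F w))
        = adjugate F0 ** (F0 ** e3 ** hconj F0) ** hconj (adjugate F0)"
      using herm_solution_const[OF face F(2) w w0] F0(2) F(1) by simp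
    also have "\<dots> = (adjugate F0 ** F0) ** e3 ** hconj (adjugate F0 ** F0)"
      by (simp add: hconj_simps matrix_mult_simps)
    also have "\<dots> = e3"
      by (simp add: adjugate_inverse F0(1)) (simp add: mat2_simps)
    finally have "F w ** e3 ** hconj (F w)
        = (F w ** adjugate (F w)) ** herm (f (exp w)) ** hconj (F w ** adjugate (F w))"
      by (simp add: hconj_simps matrix_mult_simps) (metis matrix_mul_assoc)
    then show ?thesis
      by (simp add: adjugate_inverse det[OF w]) (simp add: mat2_simps)
  qed
  then show thesis
    using that F(2) det by blast
qed

lemma holomorphic_lift_monodromy:
  assumes face: "cmc1_face (punctured_disk 1) f"
    and F: "\<And>w. w \<in> left_half_plane \<Longrightarrow> (F has_matrix_derivative log_deriv_exp f w ** F w) (at w)"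
      "\<And>w. w \<in> left_half_plane \<Longrightarrow> det (F w) = 1"
      "\<And>w. w \<in> left_half_plane \<Longrightarrow> herm (f (exp w)) = F w ** e3 ** hconj (F w)"
  obtains \<rho> where "\<rho> \<in> SU11" "has_monodromy F \<rho>"
proof -
  define w0 :: complex where "w0 = -1"
  have w0: "w0 \<in> left_half_plane"
    by (simp add: w0_def left_half_plane_def)
  define \<rho> where "\<rho> = adjugate (F w0) ** F (w0 + deck_period)"
  have "F (w + deck_period) = F w ** \<rho>" if "w \<in> left_half_plane" for w
    using solution_translate_const[OF face F(1) w0 that]
    by (simp add: \<rho>_def adjugate_inverse F(2) that)
  then have monodromy: "has_monodromy F \<rho>"
    by (simp add: has_monodromy_def)
  have "det \<rho> = 1"
    using w0 add_deck_period_in_left_half_plane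
    by (simp add: \<rho>_def det_mul det_adjugate F(2))
  moreover have "\<rho> ** e3 ** hconj \<rho> = e3"
  proof -
    have "\<rho> ** e3 ** hconj \<rho>
        = adjugate (F w0) ** herm (f (exp (w0 + deck_period))) ** hconj (adjugate (F w0))"
      using w0 add_deck_period_in_left_half_plane
      by (simp add: \<rho>_def F(3) hconj_simps matrix_mult_simps)
    also have "\<dots> = (adjugate (F w0) ** F w0) ** e3 ** hconj (adjugate (F w0) ** F w0)"
      using w0 by (simp add: exp_add exp_two_pi_i F(3) hconj_simps matrix_mult_simps)
    also have "\<dots> = e3"
      by (simp add: adjugate_inverse F(2) w0) (simp add: mat2_simps)
    finally show ?thesis .
  qed
  ultimately have "\<rho> \<in> SU11"
    by (simp add: SU11_def SL2C_def)
  with monodromy show thesis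
    using that by blast
qed

lemma null_frame_exists:
  assumes face: "cmc1_face (punctured_disk 1) f"
  obtains F N \<rho> where "null_frame f F N" "\<And>w. w \<in> left_half_plane \<Longrightarrow> N w \<noteq> 0"
    "\<rho> \<in> SU11" "has_monodromy F \<rho>"
proof -
  obtain F where F:
    "\<And>w. w \<in> left_half_plane \<Longrightarrow> (F has_matrix_derivative log_deriv_exp f w ** F w) (at w)"
    "\<And>w. w \<in> left_half_plane \<Longrightarrow> det (F w) = 1"
    "\<And>w. w \<in> left_half_plane \<Longrightarrow> herm (f (exp w)) = F w ** e3 ** hconj (F w)"
    using holomorphic_lift_exists[OF face] by blast
  define N where "N = (\<lambda>w. adjugate (F w) ** log_deriv_exp f w ** F w)"
  have FN: "F w ** N w = log_deriv_exp f w ** F w" if "w \<in> left_half_plane" for w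
    by (simp add: N_def adjugate_inverse F(2) that flip: matrix_mul_assoc)
  have "F matrix_holomorphic_on left_half_plane"
    by (rule matrix_holomorphic_on_open[OF open_left_half_plane F(1)])
  moreover have "(\<lambda>w. adjugate (F w)) matrix_holomorphic_on left_half_plane"
    by (rule matrix_holomorphic_on_open[OF open_left_half_plane
          adjugate_solution_derivative[OF face F(1)]])
  ultimately have "N matrix_holomorphic_on left_half_plane"
    unfolding N_def
    by (intro matrix_holomorphic_on_mult log_deriv_exp_holomorphic[OF face])
  moreover have "null_matrix (N w)" if "w \<in> left_half_plane" for w
    using that face
    by (simp add: null_matrix_def N_def adjugate_simps adjugate_log_deriv_exp det_mul
        det_log_deriv_exp matrix_mult_simps)
  ultimately have "null_frame f F N"
    using F FN by (simp add: null_frame_def)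
  moreover have "N w \<noteq> 0" if w: "w \<in> left_half_plane" for w
  proof
    assume "N w = 0"
    then have "log_deriv_exp f w ** (F w ** adjugate (F w)) = 0"
      using FN[OF w] by (simp add: matrix_mult_simps)
    then show False
      using log_deriv_exp_neq_zero[OF face w] by (simp add: adjugate_inverse F(2) w)
  qed
  moreover obtain \<rho> where "\<rho> \<in> SU11" "has_monodromy F \<rho>"
    using holomorphic_lift_monodromy[OF face F] by blast
  ultimately show thesis
    using that by blast
qed

section \<open>The group SU(1,1)\<close>

lemma det_SU11: "P \<in> SU11 \<Longrightarrow> det P = 1"
  by (simp add: SU11_def SL2C_def)

lemma SU11_mult: "P \<in> SU11 \<Longrightarrow> Q \<in> SU11 \<Longrightarrow> P ** Q \<in> SU11"
proof -
  assume P: "P \<in> SU11" and Q: "Q \<in> SU11"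
  have "P ** Q ** e3 ** hconj (P ** Q) = P ** (Q ** e3 ** hconj Q) ** hconj P"
    by (simp add: hconj_simps matrix_mul_assoc)
  then show "P ** Q \<in> SU11"
    using P Q by (simp add: SU11_def SL2C_def det_mul)
qed

definition su11 :: "complex \<Rightarrow> complex \<Rightarrow> complex^2^2" where
  "su11 p q = vector [vector [p, q], vector [cnj q, cnj p]]"

lemma su11_mem_SU11:
  assumes "(cmod p)\<^sup>2 - (cmod q)\<^sup>2 = 1"
  shows "su11 p q \<in> SU11"
proof -
  have "p * cnj p - q * cnj q = 1"
    using assms by (simp only: complex_norm_square[symmetric] of_real_diff[symmetric]) simp
  then show ?thesis
    unfolding SU11_def SL2C_def su11_def by (auto simp: mat2_simps algebra_simps)
qed

lemma SU11_E:
  assumes "\<rho> \<in> SU11"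
  obtains p q where "\<rho> = su11 p q" "(cmod p)\<^sup>2 - (cmod q)\<^sup>2 = 1"
proof -
  define p q r s where "p = \<rho>$1$1" and "q = \<rho>$1$2" and "r = \<rho>$2$1" and "s = \<rho>$2$2"
  have det: "p * s - q * r = 1"
    using det_SU11[OF assms] by (simp add: det_2 p_def q_def r_def s_def)
  have "\<rho> ** e3 ** hconj \<rho> = e3"
    using assms by (simp add: SU11_def)
  then have norm: "p * cnj p - q * cnj q = 1" and orthogonal: "r * cnj p = s * cnj q"
    by (simp_all add: mat2_simps p_def q_def r_def s_def)
  have "cnj p = p * cnj p * s - q * (r * cnj p)" "cnj q = p * (s * cnj q) - q * cnj q * r"
    using arg_cong[OF det, of "\<lambda>x. cnj p * x"] arg_cong[OF det, of "\<lambda>x. cnj q * x"]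
    by (simp_all add: algebra_simps)
  then have "cnj p = (p * cnj p - q * cnj q) * s" "cnj q = (p * cnj p - q * cnj q) * r"
    by (simp_all add: orthogonal algebra_simps)
  then have "s = cnj p" "r = cnj q"
    unfolding norm by simp_all
  then have "\<rho> = su11 p q"
    by (simp add: su11_def p_def q_def r_def s_def vec_eq_iff forall_2)
  moreover have "complex_of_real ((cmod p)\<^sup>2 - (cmod q)\<^sup>2) = of_real 1"
    unfolding of_real_diff complex_norm_square norm by simp
  then have "(cmod p)\<^sup>2 - (cmod q)\<^sup>2 = 1"
    using of_real_eq_iff by blast
  ultimately show thesis
    using that by blast
qed

lemma SU11_adjugate:
  assumes "P \<in> SU11"
  shows "adjugate P \<in> SU11"
proof -
  obtain p q where "P = su11 p q" "(cmod p)\<^sup>2 - (cmod q)\<^sup>2 = 1"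
    using SU11_E[OF assms] .
  moreover have "adjugate (su11 p q) = su11 (cnj p) (- q)"
    by (simp add: su11_def mat2_simps)
  ultimately show ?thesis
    using su11_mem_SU11[of "cnj p" "- q"] by simp
qed

lemma conj_SU11I:
  assumes pos: "(cmod \<alpha>)\<^sup>2 > (cmod \<beta>)\<^sup>2" and eq: "A ** su11 \<alpha> \<beta> = su11 \<alpha> \<beta> ** B"
  shows "conj_SU11 A B"
proof -
  define m where "m = (cmod \<alpha>)\<^sup>2 - (cmod \<beta>)\<^sup>2"
  define k where "k = 1 / sqrt m"
  define P where "P = su11 (of_real k * \<alpha>) (of_real k * \<beta>)"
  have "m > 0"
    using pos by (simp only: m_def diff_gt_0_iff_gt)
  then have "k\<^sup>2 * m = 1"
    by (simp add: k_def power_divide)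
  then have P: "P \<in> SU11"
    unfolding P_def m_def
    by (intro su11_mem_SU11) (simp add: norm_mult power_mult_distrib algebra_simps)
  have "P = of_real k *\<^sub>m su11 \<alpha> \<beta>"
    by (simp add: P_def su11_def mat2_simps)
  then have "P ** B = A ** P"
    by (simp add: matrix_mult_simps eq)
  then have "P ** B ** adjugate P = A ** (P ** adjugate P)"
    by (simp add: matrix_mul_assoc)
  then have "A = P ** B ** matrix_inv P"
    by (simp add: adjugate_inverse matrix_inv_eq_adjugate det_SU11[OF P])
  with P show ?thesis
    unfolding conj_SU11_def by blast
qed

lemma conj_SU11_refl: "conj_SU11 A A"
  by (rule conj_SU11I[of 0 1]) (simp_all add: su11_def mat2_simps)

lemma conj_SU11_uminus: "conj_SU11 A B \<Longrightarrow> conj_SU11 (- A) (- B)"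
  unfolding conj_SU11_def by (auto simp: matrix_mult_simps)

lemma conj_SU11_imp_trace_eq:
  assumes "conj_SU11 A B"
  shows "trace A = trace B"
proof -
  obtain P where P: "P \<in> SU11" "A = P ** B ** matrix_inv P"
    using assms unfolding conj_SU11_def by blast
  then have "trace A = trace (P ** B ** adjugate P)"
    by (simp add: matrix_inv_eq_adjugate det_SU11)
  also have "\<dots> = trace (adjugate P ** (P ** B))"
    by (rule trace_mul_sym)
  finally show ?thesis
    by (simp only: adjugate_inverse det_SU11[OF P(1)])
qed

lemma Re_su11_eq_if_conj_SU11:
  assumes "conj_SU11 (su11 p q) B" "trace B = of_real (2 * c)"
  shows "Re p = c"
proof -
  have "trace (su11 p q) = of_real (2 * Re p)"
    by (simp add: trace_def sum_2 su11_def complex_eq_iff)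
  then show ?thesis
    using conj_SU11_imp_trace_eq[OF assms(1)] assms(2)
    by (metis of_real_eq_iff mult_cancel_left zero_neq_numeral)
qed

lemma hyperbolic_su11_imp_Re_gt_1:
  assumes "hyperbolic (su11 p q)"
  shows "\<bar>Re p\<bar> > 1"
proof -
  obtain t where t: "t > 0"
    "conj_SU11 (su11 p q) (Lambda_h t) \<or> conj_SU11 (su11 p q) (- Lambda_h t)"
    using assms unfolding hyperbolic_def by blast
  have "trace (Lambda_h t) = of_real (2 * cosh t)" "trace (- Lambda_h t) = of_real (2 * - cosh t)"
    by (simp_all add: trace_def sum_2 Lambda_h_def)
  then have "Re p = cosh t \<or> Re p = - cosh t"
    using t(2) Re_su11_eq_if_conj_SU11 by blast
  moreover have "cosh t > 1"
    using cosh_real_ge_1[of t] cosh_real_one_iff[of t] t(1) by linarith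
  ultimately show ?thesis by auto
qed

lemma su11_diagonalized_by_eigenvectors:
  assumes unit: "cmod e = 1"
    and eigen: "p * \<alpha> + q * cnj \<beta> = \<alpha> * e" "cnj q * \<alpha> + cnj p * cnj \<beta> = cnj \<beta> * e"
  shows "su11 p q ** su11 \<alpha> \<beta> = su11 \<alpha> \<beta> ** Lambda_e (Arg e)"
proof -
  have "cis (Arg e) = e"
    using cis_Arg[of e] unit by (force simp: sgn_div_norm)
  then have "cis (Arg e) = e" "cis (- Arg e) = cnj e"
    by (simp_all flip: cis_cnj)
  moreover have "q * cnj \<alpha> + p * \<beta> = \<beta> * cnj e" "cnj p * cnj \<alpha> + cnj q * \<beta> = cnj \<alpha> * cnj e"
    using arg_cong[OF eigen(2), of cnj] arg_cong[OF eigen(1), of cnj]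
    by (simp_all only: complex_cnj_add complex_cnj_mult complex_cnj_cnj)
  ultimately show ?thesis
    using eigen by (simp add: su11_def Lambda_e_def mat2_simps add.commute)
qed

text \<open>
  The columns of the conjugating matrix are the eigenvectors \<open>(\<alpha>, cnj \<beta>)\<close> and \<open>(\<beta>, cnj \<alpha>)\<close>; the
  sign of \<open>\<kappa>\<close> makes \<open>(\<alpha>, cnj \<beta>)\<close> the one with \<open>cmod \<alpha> > cmod \<beta>\<close>.
\<close>

lemma elliptic_su11:
  assumes det: "(cmod p)\<^sup>2 - (cmod q)\<^sup>2 = 1" and trace: "\<bar>Re p\<bar> < 1"
  shows "elliptic (su11 p q)"
proof -
  define \<tau> \<sigma> where "\<tau> = Re p" and "\<sigma> = Im p"
  have p: "p = of_real \<tau> + \<i> * of_real \<sigma>"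
    by (simp add: \<tau>_def \<sigma>_def complex_eq_iff)
  have norm_q: "(cmod q)\<^sup>2 = \<tau>\<^sup>2 + \<sigma>\<^sup>2 - 1"
    using det by (simp add: cmod_power2[of p] \<tau>_def \<sigma>_def)
  have \<tau>: "\<tau>\<^sup>2 < 1"
    using trace by (simp add: \<tau>_def abs_square_less_1)
  then have "\<sigma> \<noteq> 0"
    using norm_q zero_le_power2[of "cmod q"] by auto
  define \<kappa> where "\<kappa> = sgn \<sigma> * sqrt (1 - \<tau>\<^sup>2)"
  have \<kappa>: "\<kappa>\<^sup>2 = 1 - \<tau>\<^sup>2" "\<kappa> * \<sigma> > 0"
    using \<tau> \<open>\<sigma> \<noteq> 0\<close>
    by (auto simp: \<kappa>_def power_mult_distrib sgn_if zero_less_mult_iff mult_less_0_iff)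
  define e where "e = of_real \<tau> + \<i> * of_real \<kappa>"
  have unit: "cmod e = 1"
    using \<kappa>(1) by (simp add: e_def cmod_def)
  define \<alpha> where "\<alpha> = \<i> * of_real (\<kappa> + \<sigma>)"
  have "(cmod \<alpha>)\<^sup>2 - (cmod q)\<^sup>2 = (\<kappa> + \<sigma>)\<^sup>2 - (\<tau>\<^sup>2 + \<sigma>\<^sup>2 - 1)"
    unfolding \<alpha>_def norm_q norm_mult norm_of_real by simp
  also have "\<dots> = 2 * \<kappa>\<^sup>2 + 2 * (\<kappa> * \<sigma>)"
    using \<kappa>(1) by (simp add: power2_sum algebra_simps)
  also have "\<dots> > 0"
    using \<kappa>(2) by (simp add: add_nonneg_pos)
  finally have pos: "(cmod \<alpha>)\<^sup>2 > (cmod q)\<^sup>2"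
    by simp
  have "p * \<alpha> + q * cnj q - \<alpha> * e = of_real (\<kappa>\<^sup>2 - (1 - \<tau>\<^sup>2))"
    unfolding \<alpha>_def p e_def complex_norm_square[symmetric] norm_q
    by (simp add: algebra_simps power2_eq_square)
  then have "p * \<alpha> + q * cnj q = \<alpha> * e"
    by (simp add: \<kappa>(1))
  moreover have "cnj q * \<alpha> + cnj p * cnj q = cnj q * e"
    unfolding \<alpha>_def p e_def by (simp add: algebra_simps)
  ultimately have "conj_SU11 (su11 p q) (Lambda_e (Arg e))"
    by (intro conj_SU11I[OF pos] su11_diagonalized_by_eigenvectors unit)
  then show ?thesis
    using Arg_bounded[of e] unfolding elliptic_def by blast
qed

lemma su11_unipotent:
  assumes det: "(cmod p)\<^sup>2 - (cmod q)\<^sup>2 = 1" and trace: "Re p = 1"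
  shows "su11 p q = mat 1 \<or> (\<exists>t. t \<noteq> 0 \<and> conj_SU11 (su11 p q) (Lambda_p t))"
proof (cases "Im p = 0")
  case True
  then have "p = 1"
    using trace by (simp add: complex_eq_iff)
  moreover from this have "q = 0"
    using det by simp
  ultimately show ?thesis
    by (simp add: su11_def mat2_simps)
next
  case False
  define \<sigma> where "\<sigma> = Im p"
  have p: "p = 1 + \<i> * of_real \<sigma>"
    using trace by (simp add: \<sigma>_def complex_eq_iff)
  have "(cmod q)\<^sup>2 = \<sigma>\<^sup>2"
    using det trace by (simp add: cmod_power2[of p] \<sigma>_def)
  then have norm_q: "cmod q = \<bar>\<sigma>\<bar>"
    by (metis abs_norm_cancel real_sqrt_abs)
  define \<alpha> where "\<alpha> = csqrt (\<i> * q / of_real \<sigma>)"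
  have \<alpha>_square: "\<alpha> * \<alpha> = \<i> * q / of_real \<sigma>"
    unfolding \<alpha>_def by (metis power2_csqrt power2_eq_square)
  then have "cmod \<alpha> * cmod \<alpha> = 1"
    using False norm_q by (metis \<sigma>_def abs_eq_0 divide_self norm_divide norm_ii norm_mult
        norm_of_real mult_1)
  then have "\<alpha> * cnj \<alpha> = 1"
    by (simp add: power2_eq_square flip: complex_norm_square)
  moreover have "q = - \<i> * of_real \<sigma> * (\<alpha> * \<alpha>)"
    unfolding \<alpha>_square using False by (simp add: \<sigma>_def)
  ultimately have q_cnj_\<alpha>: "q * cnj \<alpha> = - \<i> * of_real \<sigma> * \<alpha>"
    by (metis (no_types, opaque_lifting) mult.assoc mult.right_neutral)
  then have "cnj q * \<alpha> = \<i> * of_real \<sigma> * cnj \<alpha>"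
    by (metis complex_cnj_cnj complex_cnj_complex_of_real complex_cnj_i complex_cnj_minus
        complex_cnj_mult minus_minus)
  with q_cnj_\<alpha> have "su11 p q ** su11 \<alpha> 0 = su11 \<alpha> 0 ** Lambda_p \<sigma>"
    by (simp add: su11_def Lambda_p_def mat2_simps p algebra_simps)
  moreover have "(cmod \<alpha>)\<^sup>2 > (cmod 0)\<^sup>2"
    using \<open>cmod \<alpha> * cmod \<alpha> = 1\<close> by (simp add: power2_eq_square)
  ultimately show ?thesis
    using conj_SU11I False unfolding \<sigma>_def by blast
qed

lemma su11_elliptic_or_parabolic:
  assumes det: "(cmod p)\<^sup>2 - (cmod q)\<^sup>2 = 1" and trace: "\<bar>Re p\<bar> \<le> 1"
  shows "elliptic (su11 p q) \<or> parabolic (su11 p q)"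
proof -
  have "Lambda_e 0 = mat 1" "Lambda_e pi = - mat 1"
    by (simp_all add: Lambda_e_def mat2_simps cis_pi flip: cis_cnj)
  then have elliptic_identity: "elliptic (mat 1)" "elliptic (- mat 1)"
    unfolding elliptic_def using conj_SU11_refl pi_gt_zero
    by (metis neg_less_0_iff_less order_less_imp_le,
        metis less_trans neg_less_0_iff_less order_refl)
  consider "\<bar>Re p\<bar> < 1" | "Re p = 1" | "Re (- p) = 1"
    using trace by fastforce
  then show ?thesis
  proof cases
    case 1
    then show ?thesis
      using elliptic_su11[OF det] by blast
  next
    case 2
    then show ?thesis
      using su11_unipotent[OF det] elliptic_identity unfolding parabolic_def by metis
  next
    case 3
    have neg: "su11 p q = - su11 (- p) (- q)"
      by (simp add: su11_def mat2_simps)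
    have "su11 (- p) (- q) = mat 1 \<or> (\<exists>t. t \<noteq> 0 \<and> conj_SU11 (su11 (- p) (- q)) (Lambda_p t))"
      using su11_unipotent[OF _ 3] det by simp
    then have "su11 p q = - mat 1 \<or> (\<exists>t. t \<noteq> 0 \<and> conj_SU11 (su11 p q) (- Lambda_p t))"
      unfolding neg using conj_SU11_uminus by metis
    then show ?thesis
      using elliptic_identity unfolding parabolic_def by metis
  qed
qed

section \<open>The metric in terms of a null frame\<close>

lemma null_matrix_entries:
  assumes "null_matrix N"
  shows "N$2$2 = - N$1$1" "N$1$1 * N$1$1 = - (N$1$2 * N$2$1)"
    "(cmod (N$1$1))\<^sup>2 = cmod (N$1$2) * cmod (N$2$1)"
proof -
  have "adjugate N $ 1 $ 1 = (- N) $ 1 $ 1"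
    using assms by (simp add: null_matrix_def)
  then show trace: "N$2$2 = - N$1$1"
    by (simp add: adjugate_def)
  have "N$1$1 * N$2$2 - N$1$2 * N$2$1 = 0"
    using assms by (simp add: null_matrix_def det_2)
  with trace show "N$1$1 * N$1$1 = - (N$1$2 * N$2$1)"
    by algebra
  from arg_cong[OF this, of cmod] show "(cmod (N$1$1))\<^sup>2 = cmod (N$1$2) * cmod (N$2$1)"
    by (simp add: norm_mult power2_eq_square)
qed

lemma null_matrix_conjugate: "null_matrix N \<Longrightarrow> null_matrix (adjugate P ** N ** P)"
  by (simp add: null_matrix_def adjugate_simps det_mul matrix_mult_simps)

text \<open>
  In terms of the Weierstrass data \<open>g = N\<^sub>1\<^sub>1 / N\<^sub>2\<^sub>1\<close> and \<open>\<omega> = N\<^sub>2\<^sub>1\<close> this is \<open>(1 - |g|\<^sup>2) |\<omega>|\<close>.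
\<close>

definition conformal_factor :: "complex^2^2 \<Rightarrow> real" where
  "conformal_factor N = cmod (N$2$1) - cmod (N$1$2)"

lemma det_null_matrix_hermitian_part:
  assumes "null_matrix N"
  shows "det (h *\<^sub>m (N ** e3) + hconj (h *\<^sub>m (N ** e3)))
    = - of_real ((cmod h * conformal_factor N)\<^sup>2)"
proof -
  define a b c where "a = h * N$1$1" and "b = h * N$1$2" and "c = h * N$2$1"
  have abc: "a * a + b * c = 0"
    using null_matrix_entries(2)[OF assms] by (simp add: a_def b_def c_def algebra_simps)
  have "det (h *\<^sub>m (N ** e3) + hconj (h *\<^sub>m (N ** e3)))
      = (a + cnj a) * (a + cnj a) - (- b + cnj c) * (c - cnj b)"
    using null_matrix_entries(1)[OF assms] by (simp add: mat2_simps a_def b_def c_def algebra_simps)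
  also have "\<dots> = 2 * (a * cnj a) - b * cnj b - c * cnj c + (a * a + b * c) + cnj (a * a + b * c)"
    by (simp add: algebra_simps)
  also have "\<dots> = of_real (2 * (cmod a)\<^sup>2 - (cmod b)\<^sup>2 - (cmod c)\<^sup>2)"
    unfolding abc by (simp flip: complex_norm_square)
  also have "2 * (cmod a)\<^sup>2 - (cmod b)\<^sup>2 - (cmod c)\<^sup>2 = - (cmod h * conformal_factor N)\<^sup>2"
    using null_matrix_entries(3)[OF assms]
    unfolding a_def b_def c_def conformal_factor_def norm_mult power_mult_distrib power2_diff
    by (simp add: algebra_simps)
  finally show ?thesis by simp
qed

lemma ds2_eq_matI:
  assumes f: "f differentiable (at z)" and norm: "\<And>v. induced f z v v = k * (cmod v)\<^sup>2"
  shows "ds2 f z = mat k"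
proof -
  define D where "D = frechet_derivative f (at z)"
  have norm_D: "lorentz (D v) (D v) = k * (cmod v)\<^sup>2" for v
    using norm by (simp add: induced_def D_def)
  have "D (1 + \<i>) = D 1 + D \<i>"
    unfolding D_def by (rule linear_add[OF linear_frechet_derivative[OF f]])
  then have "lorentz (D (1 + \<i>)) (D (1 + \<i>))
      = lorentz (D 1) (D 1) + lorentz (D \<i>) (D \<i>) + 2 * lorentz (D 1) (D \<i>)"
    by (simp add: lorentz_simps lorentz_commute[of "D \<i>" "D 1"])
  then have "lorentz (D 1) (D \<i>) = 0"
    by (simp add: norm_D cmod_power2)
  then show ?thesis
    using norm_D[of 1] norm_D[of \<i>] lorentz_commute[of "D \<i>" "D 1"]
    by (simp add: vec_eq_iff forall_2 ds2_nth pd_def coord_vec_def mat_def flip: D_def)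
qed

lemma null_frameD:
  assumes "null_frame f F N"
  shows "N matrix_holomorphic_on left_half_plane"
    "w \<in> left_half_plane \<Longrightarrow> (F has_matrix_derivative F w ** N w) (at w)"
    "w \<in> left_half_plane \<Longrightarrow> det (F w) = 1"
    "w \<in> left_half_plane \<Longrightarrow> herm (f (exp w)) = F w ** e3 ** hconj (F w)"
    "w \<in> left_half_plane \<Longrightarrow> null_matrix (N w)"
  using assms by (simp_all add: null_frame_def)

lemma null_frame_herm_derivative:
  assumes frame: "null_frame f F N" and w: "w \<in> left_half_plane"
  defines "Q \<equiv> \<lambda>h. h *\<^sub>m (N w ** e3) + hconj (h *\<^sub>m (N w ** e3))"
  shows "((\<lambda>w. herm (f (exp w))) has_derivative (\<lambda>h. F w ** Q h ** hconj (F w))) (at w)"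
proof -
  have dF: "(F has_derivative (\<lambda>h. h *\<^sub>m (F w ** N w))) (at w)"
    using null_frameD(2)[OF frame w] by (simp add: has_matrix_derivative_def)
  have "((\<lambda>w. F w ** e3 ** hconj (F w)) has_derivative (\<lambda>h. F w ** e3 ** hconj (h *\<^sub>m (F w ** N w))
      + (F w ** 0 + (h *\<^sub>m (F w ** N w)) ** e3) ** hconj (F w))) (at w)"
    by (intro derivative_intros dF)
  then have "((\<lambda>w. F w ** e3 ** hconj (F w)) has_derivative
      (\<lambda>h. F w ** Q h ** hconj (F w))) (at w)"
    by (simp add: Q_def hconj_simps matrix_mult_simps add.commute)
  then show ?thesis
    by (rule has_derivative_transform_within_open[OF _ open_left_half_plane w])
       (simp add: null_frameD(4)[OF frame])
qed

lemma null_frame_metric: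
  assumes frame: "null_frame f F N" and w: "w \<in> left_half_plane"
    and f: "f differentiable (at (exp w))"
  shows "ds2 f (exp w) = mat ((conformal_factor (N w) / cmod (exp w))\<^sup>2)"
proof (rule ds2_eq_matI[OF f])
  define D where "D = frechet_derivative f (at (exp w))"
  have "(exp has_derivative (\<lambda>h. exp w * h)) (at w)"
    using DERIV_exp[of w] by (simp add: has_field_derivative_def)
  from diff_chain_at[OF this f[unfolded frechet_derivative_works]]
  have "((\<lambda>w. herm (f (exp w))) has_derivative (\<lambda>h. herm (D (exp w * h)))) (at w)"
    by (intro derivative_intros) (simp add: o_def D_def)
  from has_derivative_unique[OF this null_frame_herm_derivative[OF frame w]]
  have "herm (D (exp w * h))
      = F w ** (h *\<^sub>m (N w ** e3) + hconj (h *\<^sub>m (N w ** e3))) ** hconj (F w)" for h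
    by (rule fun_cong)
  then have "det (herm (D (exp w * h))) = det (h *\<^sub>m (N w ** e3) + hconj (h *\<^sub>m (N w ** e3)))" for h
    by (simp add: det_mul det_hconj null_frameD(3)[OF frame w])
  then have "complex_of_real (lorentz (D (exp w * h)) (D (exp w * h)))
      = of_real ((cmod h * conformal_factor (N w))\<^sup>2)" for h
    unfolding det_herm det_null_matrix_hermitian_part[OF null_frameD(5)[OF frame w]] by simp
  then have "lorentz (D (exp w * h)) (D (exp w * h)) = (cmod h * conformal_factor (N w))\<^sup>2" for h
    using of_real_eq_iff by blast
  from this[of "_ / exp w"]
  show "induced f (exp w) v v = (conformal_factor (N w) / cmod (exp w))\<^sup>2 * (cmod v)\<^sup>2" for v
    by (simp add: induced_def D_def norm_divide power_mult_distrib power_divide)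
qed

section \<open>Null frames and null lifts\<close>

lemma null_frame_right_mult:
  assumes frame: "null_frame f F N" and P: "P \<in> SU11"
  shows "null_frame f (\<lambda>w. F w ** P) (\<lambda>w. adjugate P ** N w ** P)"
  unfolding null_frame_def
proof (intro conjI ballI)
  show "(\<lambda>w. adjugate P ** N w ** P) matrix_holomorphic_on left_half_plane"
    by (intro matrix_holomorphic_on_mult matrix_holomorphic_on_const null_frameD(1)[OF frame])
  fix w assume w: "w \<in> left_half_plane"
  have "F w ** P ** (adjugate P ** N w ** P) = F w ** (P ** adjugate P) ** N w ** P"
    by (simp only: matrix_mul_assoc)
  then show "((\<lambda>w. F w ** P) has_matrix_derivative F w ** P ** (adjugate P ** N w ** P)) (at w)"
    using has_matrix_derivative_mult[OF null_frameD(2)[OF frame w] has_matrix_derivative_const]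
    by (simp add: adjugate_inverse det_SU11[OF P] matrix_mult_simps)
  show "det (F w ** P) = 1"
    by (simp add: det_mul null_frameD(3)[OF frame w] det_SU11[OF P])
  have "F w ** P ** e3 ** hconj (F w ** P) = F w ** (P ** e3 ** hconj P) ** hconj (F w)"
    by (simp add: hconj_simps matrix_mul_assoc)
  also have "P ** e3 ** hconj P = e3"
    using P by (simp add: SU11_def)
  finally show "herm (f (exp w)) = F w ** P ** e3 ** hconj (F w ** P)"
    by (simp add: null_frameD(4)[OF frame w])
  show "null_matrix (adjugate P ** N w ** P)"
    by (rule null_matrix_conjugate[OF null_frameD(5)[OF frame w]])
qed

lemma has_monodromy_right_mult:
  assumes "has_monodromy F \<rho>" "det P = 1"
  shows "has_monodromy (\<lambda>w. F w ** P) (adjugate P ** \<rho> ** P)"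
proof -
  have "F w ** P ** (adjugate P ** \<rho> ** P) = F w ** (P ** adjugate P) ** \<rho> ** P" for w
    by (simp only: matrix_mul_assoc)
  then show ?thesis
    using assms by (simp add: has_monodromy_def adjugate_inverse)
qed

text \<open>
  If \<open>N\<^sub>2\<^sub>1\<close> vanishes identically then the Gauss map is constantly infinite; a boost in \<open>SU(1,1)\<close>
  moves this constant to a finite one.
\<close>

lemma null_frame_exists_nondegenerate:
  assumes face: "cmc1_face (punctured_disk 1) f"
  obtains F N \<rho> where "null_frame f F N" "\<And>w. w \<in> left_half_plane \<Longrightarrow> N w \<noteq> 0"
    "\<exists>w\<in>left_half_plane. N w $2$1 \<noteq> 0" "\<rho> \<in> SU11" "has_monodromy F \<rho>"
proof -
  obtain F N \<rho> where frame: "null_frame f F N"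
    and N: "\<And>w. w \<in> left_half_plane \<Longrightarrow> N w \<noteq> 0" and \<rho>: "\<rho> \<in> SU11" "has_monodromy F \<rho>"
    using null_frame_exists[OF face] by blast
  show thesis
  proof (cases "\<exists>w\<in>left_half_plane. N w $2$1 \<noteq> 0")
    case True
    then show ?thesis using that frame N \<rho> by blast
  next
    case False
    define P where "P = su11 (of_real (cosh 1)) (of_real (sinh 1))"
    have P: "P \<in> SU11"
      unfolding P_def by (intro su11_mem_SU11) (simp add: hyperbolic_pythagoras)
    have boosted: "adjugate P ** N w ** P \<noteq> 0" "(adjugate P ** N w ** P) $2$1 \<noteq> 0"
      if w: "w \<in> left_half_plane" for w
    proof -
      have "N w $2$1 = 0"
        using False w by blast
      moreover from this have "N w $1$1 = 0" "N w $2$2 = 0"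
        using null_matrix_entries[OF null_frameD(5)[OF frame w]] by auto
      ultimately have entries: "N w $1$1 = 0" "N w $2$1 = 0" "N w $2$2 = 0"
        by auto
      then have "N w $1$2 \<noteq> 0"
        using N[OF w] by (auto simp: vec_eq_iff forall_2)
      moreover have "(adjugate P ** N w ** P) $2$1 = - of_real ((sinh 1)\<^sup>2) * N w $1$2"
        using entries by (simp add: P_def su11_def adjugate_def matrix_matrix_mult_def sum_2
            power2_eq_square)
      ultimately show "(adjugate P ** N w ** P) $2$1 \<noteq> 0"
        by simp
      then show "adjugate P ** N w ** P \<noteq> 0"
        by auto
    qed
    have "- 1 \<in> left_half_plane"
      by (simp add: left_half_plane_def)
    then show ?thesis
      using that[OF null_frame_right_mult[OF frame P]] boosted \<rho>(1) P
        has_monodromy_right_mult[OF \<rho>(2) det_SU11[OF P]]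
      by (metis SU11_mult SU11_adjugate)
  qed
qed

lemma null_frame_matrix_deriv:
  assumes "null_frame f F N" "w \<in> left_half_plane"
  shows "matrix_deriv F w = F w ** N w" "matrix_inv (F w) ** matrix_deriv F w = N w"
proof -
  show deriv: "matrix_deriv F w = F w ** N w"
    using null_frameD(2)[OF assms]
    by (simp add: matrix_deriv_def has_matrix_derivative_iff vec_eq_iff DERIV_imp_deriv)
  have det: "det (F w) = 1"
    by (rule null_frameD(3)[OF assms])
  show "matrix_inv (F w) ** matrix_deriv F w = N w"
    unfolding deriv by (simp only: matrix_inv_eq_adjugate[OF det] adjugate_inverse[OF det])
qed

definition gauss_quotient :: "complex^2^2 \<Rightarrow> complex" where
  "gauss_quotient N = N$1$1 / N$2$1"

lemma null_matrix_eq_gauss_quotient: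
  assumes "null_matrix N" "N$2$1 \<noteq> 0"
  defines "g \<equiv> gauss_quotient N" and "\<omega> \<equiv> N$2$1"
  shows "N = vector [vector [g * \<omega>, - g\<^sup>2 * \<omega>], vector [\<omega>, - g * \<omega>]]"
proof -
  have "N$1$1 = g * \<omega>"
    using assms(2) by (simp add: g_def \<omega>_def gauss_quotient_def)
  moreover from this have "\<omega> * (N$1$2) = \<omega> * (- g\<^sup>2 * \<omega>)"
    using null_matrix_entries(2)[OF assms(1)] by (simp add: \<omega>_def power2_eq_square algebra_simps)
  then have "N$1$2 = - g\<^sup>2 * \<omega>"
    using assms(2) by (simp only: mult_cancel_left \<omega>_def) simp
  ultimately show ?thesis
    using null_matrix_entries(1)[OF assms(1)] by (simp add: vec_eq_iff forall_2 \<omega>_def)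
qed

lemma norm_gauss_quotient:
  assumes "null_matrix N" "N$2$1 \<noteq> 0"
  shows "(cmod (gauss_quotient N))\<^sup>2 * cmod (N$2$1) = cmod (N$1$2)"
    "cmod (N$2$1) * (1 - (cmod (gauss_quotient N))\<^sup>2) = conformal_factor N"
proof -
  have "N$1$2 = - (gauss_quotient N)\<^sup>2 * N$2$1"
    using arg_cong[OF null_matrix_eq_gauss_quotient[OF assms], of "\<lambda>M. M$1$2"] by simp
  then show "(cmod (gauss_quotient N))\<^sup>2 * cmod (N$2$1) = cmod (N$1$2)"
    by (simp add: norm_mult norm_power)
  then show "cmod (N$2$1) * (1 - (cmod (gauss_quotient N))\<^sup>2) = conformal_factor N"
    by (simp add: conformal_factor_def algebra_simps)
qed

definition gauss_map :: "(complex \<Rightarrow> complex^2^2) \<Rightarrow> complex \<Rightarrow> complex" where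
  "gauss_map N = remove_sings (\<lambda>w. gauss_quotient (N w))"

context
  fixes N :: "complex \<Rightarrow> complex^2^2" and S
  assumes S: "open S" "connected S" and hol: "N matrix_holomorphic_on S"
    and null: "\<And>w. w \<in> S \<Longrightarrow> null_matrix (N w)" and nonzero: "\<exists>w\<in>S. N w $2$1 \<noteq> 0"
begin

private lemma tendsto_entry: "p \<in> S \<Longrightarrow> ((\<lambda>w. N w $i$j) \<longlongrightarrow> N p $i$j) (at p)"
  using holomorphic_on_imp_continuous_on[OF matrix_holomorphic_onD[OF hol]] S(1)
  by (simp add: continuous_on_eq_continuous_at isCont_def)

private lemma entry_analytic: "(\<lambda>w. N w $i$j) analytic_on S"
  using matrix_holomorphic_onD[OF hol] S(1) by (simp add: analytic_on_open)

lemma gauss_map_nicely_meromorphic: "gauss_map N nicely_meromorphic_on S"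
  unfolding gauss_map_def gauss_quotient_def
  by (intro remove_sings_nicely_meromorphic meromorphic_on_divide analytic_on_imp_meromorphic_on
      entry_analytic)

lemma gauss_map_eq:
  assumes "w \<in> S" "N w $2$1 \<noteq> 0"
  shows "gauss_map N w = gauss_quotient (N w)"
proof -
  have "(\<lambda>w. gauss_quotient (N w)) analytic_on {w}"
    unfolding gauss_quotient_def
    using assms by (intro analytic_on_divide analytic_on_subset[OF entry_analytic]) auto
  then show ?thesis
    by (simp add: gauss_map_def)
qed

lemma eventually_gauss_map_eq:
  assumes p: "p \<in> S"
  shows "\<forall>\<^sub>F w in at p. w \<in> S \<and> N w $2$1 \<noteq> 0 \<and> gauss_map N w = gauss_quotient (N w)"
proof -
  have "\<forall>\<^sub>F w in at p. N w $2$1 \<noteq> 0"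
  proof (cases "N p $2$1 = 0")
    case True
    obtain q where "q \<in> S" "N q $2$1 \<noteq> 0"
      using nonzero by blast
    then obtain r where "0 < r" "\<And>z. z \<in> ball p r - {p} \<Longrightarrow> N z $2$1 \<noteq> 0"
      using isolated_zeros[OF matrix_holomorphic_onD[OF hol] S p True] by metis
    then show ?thesis
      unfolding eventually_at by (intro exI[of _ r]) (auto simp: dist_commute)
  next
    case False
    then show ?thesis
      using tendsto_entry[OF p] tendsto_imp_eventually_ne by blast
  qed
  moreover have "\<forall>\<^sub>F w in at p. w \<in> S"
    by (rule eventually_at_in_open'[OF S(1) p])
  ultimately show ?thesis
    by eventually_elim (simp add: gauss_map_eq)
qed

lemma gauss_map_not_pole:
  assumes w: "w \<in> S" "N w $2$1 \<noteq> 0"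
  shows "\<not> is_pole (gauss_map N) w"
proof -
  have "((\<lambda>u. gauss_quotient (N u)) \<longlongrightarrow> gauss_quotient (N w)) (at w)"
    unfolding gauss_quotient_def using w by (intro tendsto_divide tendsto_entry)
  moreover have "\<forall>\<^sub>F u in at w. gauss_quotient (N u) = gauss_map N u"
    using eventually_gauss_map_eq[OF w(1)] by eventually_elim simp
  ultimately have "(gauss_map N \<longlongrightarrow> gauss_quotient (N w)) (at w)"
    by (rule Lim_transform_eventually)
  then show ?thesis
    unfolding is_pole_def using not_tendsto_and_filterlim_at_infinity at_neq_bot by blast
qed

lemma null_matrix_eq_gauss_map:
  assumes w: "w \<in> S" "\<not> is_pole (gauss_map N) w"
  defines "g \<equiv> gauss_map N w" and "\<omega> \<equiv> N w $2$1"
  shows "N w = vector [vector [g * \<omega>, - g\<^sup>2 * \<omega>], vector [\<omega>, - g * \<omega>]]"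
proof -
  have gauss_map: "(gauss_map N \<longlongrightarrow> g) (at w)"
    using gauss_map_nicely_meromorphic w unfolding nicely_meromorphic_on_def g_def by blast
  have entries: "\<forall>\<^sub>F u in at w. gauss_map N u * N u $2$1 = N u $1$1 \<and>
      - (gauss_map N u)\<^sup>2 * N u $2$1 = N u $1$2"
    using eventually_gauss_map_eq[OF w(1)]
  proof eventually_elim
    case (elim u)
    then show ?case
      using null_matrix_eq_gauss_quotient[OF null[of u]] by (metis vector_2)
  qed
  have "((\<lambda>u. N u $1$1) \<longlongrightarrow> g * \<omega>) (at w)"
    by (rule Lim_transform_eventually[OF tendsto_mult[OF gauss_map tendsto_entry[OF w(1), of 2 1],
          folded \<omega>_def]])
       (use entries in eventually_elim, simp)
  then have "g * \<omega> = N w $1$1"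
    using tendsto_entry[OF w(1)] tendsto_unique[OF at_neq_bot] by blast
  moreover have "((\<lambda>u. N u $1$2) \<longlongrightarrow> - g\<^sup>2 * \<omega>) (at w)"
    by (rule Lim_transform_eventually[OF
          tendsto_mult[OF tendsto_minus[OF tendsto_power[OF gauss_map]]
            tendsto_entry[OF w(1), of 2 1], folded \<omega>_def]])
       (use entries in eventually_elim, simp)
  then have "- g\<^sup>2 * \<omega> = N w $1$2"
    using tendsto_entry[OF w(1)] tendsto_unique[OF at_neq_bot] by blast
  ultimately show ?thesis
    using null_matrix_entries(1)[OF null[OF w(1)]] by (simp add: vec_eq_iff forall_2 \<omega>_def)
qed

lemma gauss_map_metric_tendsto:
  assumes p: "p \<in> S"
  shows "((\<lambda>w. (1 + (cmod (gauss_map N w))\<^sup>2)\<^sup>2 * (cmod (N w $2$1))\<^sup>2)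
    \<longlongrightarrow> (cmod (N p $2$1) + cmod (N p $1$2))\<^sup>2) (at p)"
proof (rule Lim_transform_eventually)
  show "((\<lambda>w. (cmod (N w $2$1) + cmod (N w $1$2))\<^sup>2)
      \<longlongrightarrow> (cmod (N p $2$1) + cmod (N p $1$2))\<^sup>2) (at p)"
    by (intro tendsto_intros tendsto_entry p)
  show "\<forall>\<^sub>F w in at p. (cmod (N w $2$1) + cmod (N w $1$2))\<^sup>2
      = (1 + (cmod (gauss_map N w))\<^sup>2)\<^sup>2 * (cmod (N w $2$1))\<^sup>2"
    using eventually_gauss_map_eq[OF p]
  proof eventually_elim
    case (elim w)
    then have "cmod (N w $2$1) + cmod (N w $1$2) = (1 + (cmod (gauss_map N w))\<^sup>2) * cmod (N w $2$1)"
      using norm_gauss_quotient(1)[OF null[of w]] by (simp add: algebra_simps)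
    then show ?case
      by (simp add: power_mult_distrib)
  qed
qed

lemma gauss_map_norm_neq_one:
  assumes p: "p \<in> S" "conformal_factor (N p) \<noteq> 0"
  shows "\<exists>w\<in>S. \<not> is_pole (gauss_map N) w \<and> cmod (gauss_map N w) \<noteq> 1"
proof -
  have "((\<lambda>w. conformal_factor (N w)) \<longlongrightarrow> conformal_factor (N p)) (at p)"
    unfolding conformal_factor_def by (intro tendsto_intros tendsto_entry p)
  then have "\<forall>\<^sub>F w in at p. conformal_factor (N w) \<noteq> 0"
    using p(2) tendsto_imp_eventually_ne by blast
  with eventually_gauss_map_eq[OF p(1)]
  have "\<forall>\<^sub>F w in at p. w \<in> S \<and> \<not> is_pole (gauss_map N) w \<and> cmod (gauss_map N w) \<noteq> 1"
  proof eventually_elim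
    case (elim w)
    then show ?case
      using norm_gauss_quotient(2)[OF null[of w]] gauss_map_not_pole[of w] by auto
  qed
  then show ?thesis
    using eventually_happens[of _ "at p"] at_neq_bot by blast
qed

end

lemma null_lift_of_null_frame:
  assumes frame: "null_frame f F N" and N: "\<And>w. w \<in> left_half_plane \<Longrightarrow> N w \<noteq> 0"
    and nonzero: "\<exists>w\<in>left_half_plane. N w $2$1 \<noteq> 0"
    and nondegenerate: "\<exists>w\<in>left_half_plane. conformal_factor (N w) \<noteq> 0"
  shows "null_lift f F"
proof -
  note half_plane = open_left_half_plane convex_connected[OF convex_left_half_plane]
  note frameD = null_frameD[OF frame]
  note gauss = half_plane frameD(1,5) nonzero
  have "null_lift_data F (gauss_map N) (\<lambda>w. N w $2$1)"
    unfolding null_lift_data_def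
  proof (intro conjI ballI allI impI)
    show "gauss_map N nicely_meromorphic_on left_half_plane"
      by (rule gauss_map_nicely_meromorphic[OF gauss])
    show "(\<lambda>w. N w $2$1) holomorphic_on left_half_plane"
      by (rule matrix_holomorphic_onD[OF frameD(1)])
    show "(\<lambda>w. F w $ i $ j) holomorphic_on left_half_plane" for i j
      by (rule matrix_holomorphic_onD[OF matrix_holomorphic_on_open[OF half_plane(1) frameD(2)]])
    show "\<exists>w\<in>left_half_plane. \<not> is_pole (gauss_map N) w \<and> cmod (gauss_map N w) \<noteq> 1"
      using gauss_map_norm_neq_one[OF gauss] nondegenerate by blast
    show "F ` left_half_plane \<subseteq> SL2C"
      using frameD(3) by (auto simp: SL2C_def)
    fix w assume w: "w \<in> left_half_plane"
    show "\<exists>l>0. ((\<lambda>w. (1 + (cmod (gauss_map N w))\<^sup>2)\<^sup>2 * (cmod (N w $2$1))\<^sup>2) \<longlongrightarrow> l) (at w)"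
    proof (intro exI conjI)
      show "((\<lambda>w. (1 + (cmod (gauss_map N w))\<^sup>2)\<^sup>2 * (cmod (N w $2$1))\<^sup>2)
          \<longlongrightarrow> (cmod (N w $2$1) + cmod (N w $1$2))\<^sup>2) (at w)"
        by (rule gauss_map_metric_tendsto[OF gauss w])
      have "N w $2$1 \<noteq> 0 \<or> N w $1$2 \<noteq> 0"
        using N[OF w] null_matrix_entries[OF frameD(5)[OF w]] by (auto simp: vec_eq_iff forall_2)
      then show "0 < (cmod (N w $2$1) + cmod (N w $1$2))\<^sup>2"
        by (simp add: add_nonneg_eq_0_iff)
    qed
    show "matrix_deriv F w \<noteq> 0"
      using null_frame_matrix_deriv(2)[OF frame w] N[OF w] by (auto simp: matrix_mult_simps)
    assume not_pole: "\<not> is_pole (gauss_map N) w"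
    show "matrix_inv (F w) ** matrix_deriv F w =
        vector [vector [gauss_map N w * N w $2$1, - (gauss_map N w)\<^sup>2 * N w $2$1],
          vector [N w $2$1, - gauss_map N w * N w $2$1]]"
      unfolding null_frame_matrix_deriv(2)[OF frame w]
      by (rule null_matrix_eq_gauss_map[OF gauss w not_pole])
  qed
  then show ?thesis
    using frameD(4) unfolding null_lift_def by blast
qed

lemma holomorphic_eq_zero_off_poles:
  assumes g: "g meromorphic_on S" and S: "open S" and \<phi>: "\<phi> holomorphic_on S"
    and zero: "\<And>w. w \<in> S \<Longrightarrow> \<not> is_pole g w \<Longrightarrow> \<phi> w = 0" and w: "w \<in> S"
  shows "\<phi> w = (0 :: complex)"
proof -
  have "isolated_singularity_at g w"
    using g w meromorphic_on_isolated_singularity meromorphic_on_subset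
    by (metis empty_subsetI insert_subset)
  then have "\<forall>\<^sub>F u in at w. \<not> is_pole g u"
    by (rule eventually_not_pole)
  moreover have "\<forall>\<^sub>F u in at w. u \<in> S"
    by (rule eventually_at_in_open'[OF S w])
  ultimately have "\<forall>\<^sub>F u in at w. \<phi> u = 0"
    by eventually_elim (use zero in auto)
  moreover have "(\<phi> \<longlongrightarrow> \<phi> w) (at w)"
    using holomorphic_on_imp_continuous_on[OF \<phi>] S w
    by (simp add: continuous_on_eq_continuous_at isCont_def)
  ultimately have "((\<lambda>u. 0) \<longlongrightarrow> \<phi> w) (at w)"
    by (rule Lim_transform_eventually[rotated])
  then show ?thesis
    using tendsto_unique[OF at_neq_bot tendsto_const] by metis
qed

lemma matrix_deriv_holomorphic:
  assumes "F matrix_holomorphic_on S" "open S"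
  shows "w \<in> S \<Longrightarrow> (F has_matrix_derivative matrix_deriv F w) (at w)"
    "matrix_deriv F matrix_holomorphic_on S"
  using holomorphic_derivI[OF matrix_holomorphic_onD[OF assms(1)] assms(2)]
    holomorphic_deriv[OF matrix_holomorphic_onD[OF assms(1)] assms(2)]
  by (simp_all add: has_matrix_derivative_iff matrix_holomorphic_on_def matrix_deriv_def)

lemma null_matrix_iff:
  "null_matrix N \<longleftrightarrow> N$1$1 + N$2$2 = 0 \<and> N$1$1 * N$2$2 - N$1$2 * N$2$1 = 0"
  by (auto simp: null_matrix_def mat2_simps eq_neg_iff_add_eq_0 neg_eq_iff_add_eq_0 add.commute)

lemma null_frame_of_null_lift:
  assumes "null_lift f F"
  obtains N where "null_frame f F N"
proof -
  obtain g \<omega> where data: "null_lift_data F g \<omega>"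
    and X: "\<And>w. w \<in> left_half_plane \<Longrightarrow> herm (f (exp w)) = F w ** e3 ** hconj (F w)"
    using assms unfolding null_lift_def by blast
  have g: "g meromorphic_on left_half_plane"
    and det: "\<And>w. w \<in> left_half_plane \<Longrightarrow> det (F w) = 1"
    and weierstrass: "\<And>w. w \<in> left_half_plane \<Longrightarrow> \<not> is_pole g w \<Longrightarrow>
        matrix_inv (F w) ** matrix_deriv F w =
          vector [vector [g w * \<omega> w, - (g w)\<^sup>2 * \<omega> w], vector [\<omega> w, - g w * \<omega> w]]"
    using data unfolding null_lift_data_def SL2C_def nicely_meromorphic_on_def by blast+
  have F: "F matrix_holomorphic_on left_half_plane"
    using data by (simp add: null_lift_data_def matrix_holomorphic_on_def)
  note F' = matrix_deriv_holomorphic[OF F open_left_half_plane]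
  define N where "N = (\<lambda>w. adjugate (F w) ** matrix_deriv F w)"
  have N: "N matrix_holomorphic_on left_half_plane"
    unfolding N_def
    by (intro matrix_holomorphic_on_mult F'(2) matrix_holomorphic_on_open[OF open_left_half_plane
          has_matrix_derivative_adjugate[OF F'(1)]])
  have N_eq: "N w = vector [vector [g w * \<omega> w, - (g w)\<^sup>2 * \<omega> w], vector [\<omega> w, - g w * \<omega> w]]"
    if "w \<in> left_half_plane" "\<not> is_pole g w" for w
    using weierstrass[OF that] matrix_inv_eq_adjugate[OF det[OF that(1)]] by (simp add: N_def)
  have "null_matrix (N w)" if w: "w \<in> left_half_plane" for w
    unfolding null_matrix_iff
  proof
    note zero = holomorphic_eq_zero_off_poles[OF g open_left_half_plane _ _ w]
    note entries = matrix_holomorphic_onD[OF N]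
    show "N w $1$1 + N w $2$2 = 0"
      by (rule zero[of "\<lambda>w. N w $1$1 + N w $2$2"])
         (auto intro!: holomorphic_intros entries simp: N_eq)
    show "N w $1$1 * N w $2$2 - N w $1$2 * N w $2$1 = 0"
      by (rule zero[of "\<lambda>w. N w $1$1 * N w $2$2 - N w $1$2 * N w $2$1"])
         (auto intro!: holomorphic_intros entries simp: N_eq power2_eq_square)
  qed
  moreover have "F w ** N w = matrix_deriv F w" if "w \<in> left_half_plane" for w
    by (simp only: N_def adjugate_inverse[OF det[OF that]])
  ultimately have "null_frame f F N"
    using N F'(1) det X by (simp add: null_frame_def)
  then show thesis
    by (rule that)
qed

section \<open>The Gauss map near the end\<close>

lemma conformal_factor_pos:
  assumes "null_matrix N" "conformal_factor N > 0"
  shows "N$2$1 \<noteq> 0" "cmod (gauss_quotient N) < 1"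
proof -
  show nonzero: "N$2$1 \<noteq> 0"
    using assms(2) by (auto simp: conformal_factor_def)
  have "cmod (N$2$1) * (1 - (cmod (gauss_quotient N))\<^sup>2) > 0"
    using norm_gauss_quotient(2)[OF assms(1) nonzero] assms(2) by simp
  then show "cmod (gauss_quotient N) < 1"
    by (simp add: zero_less_mult_iff abs_square_less_1)
qed

lemma gauss_quotient_conjugate_su11:
  assumes N: "null_matrix N" "conformal_factor N > 0" and det: "(cmod p)\<^sup>2 - (cmod q)\<^sup>2 = 1"
  shows "gauss_quotient (adjugate (su11 p q) ** N ** su11 p q)
    = disk_automorphism (cnj p) (- q) (gauss_quotient N)"
proof -
  define g \<omega> where "g = gauss_quotient N" and "\<omega> = N$2$1"
  note pos = conformal_factor_pos[OF N]
  have "\<omega> \<noteq> 0"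
    using pos(1) by (simp add: \<omega>_def)
  have "- cnj q * g + p \<noteq> 0"
    using disk_automorphism_denominator_neq_zero[of "cnj p" "- q" g] det pos(2) by (simp add: g_def)
  then have "p - cnj q * g \<noteq> 0"
    by (simp add: algebra_simps)
  have N_eq: "N = vector [vector [g * \<omega>, - g\<^sup>2 * \<omega>], vector [\<omega>, - g * \<omega>]]"
    unfolding g_def \<omega>_def by (rule null_matrix_eq_gauss_quotient[OF N(1) pos(1)])
  define M where "M = adjugate (su11 p q) ** N ** su11 p q"
  have "M$1$1 = (\<omega> * (p - cnj q * g)) * (cnj p * g - q)"
    "M$2$1 = (\<omega> * (p - cnj q * g)) * (p - cnj q * g)"
    unfolding M_def N_eq
    by (simp_all add: su11_def adjugate_def matrix_matrix_mult_def sum_2 power2_eq_square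
        algebra_simps)
  then have "gauss_quotient M = (cnj p * g - q) / (p - cnj q * g)"
    using \<open>\<omega> \<noteq> 0\<close> \<open>p - cnj q * g \<noteq> 0\<close> by (simp add: gauss_quotient_def)
  then show ?thesis
    by (simp add: disk_automorphism_def M_def g_def)
qed

lemma gauss_quotient_holomorphic:
  assumes "N matrix_holomorphic_on S" "\<And>w. w \<in> S \<Longrightarrow> null_matrix (N w)"
    "\<And>w. w \<in> S \<Longrightarrow> conformal_factor (N w) > 0"
  shows "(\<lambda>w. gauss_quotient (N w)) holomorphic_on S"
  unfolding gauss_quotient_def
  using conformal_factor_pos(1) assms(2,3)
  by (intro holomorphic_intros matrix_holomorphic_onD[OF assms(1)]) blast

lemma monodromy_trace_bound_if_conformal_factor_pos:
  assumes hol: "N matrix_holomorphic_on {w. Re w < r}"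
    and null: "\<And>w. Re w < r \<Longrightarrow> null_matrix (N w)"
    and pos: "\<And>w. Re w < r \<Longrightarrow> conformal_factor (N w) > 0"
    and det: "(cmod p)\<^sup>2 - (cmod q)\<^sup>2 = 1" and \<tau>: "Re \<tau> \<le> 0"
    and equivariant: "\<And>w. Re w < r \<Longrightarrow> N (w + \<tau>) = adjugate (su11 p q) ** N w ** su11 p q"
  shows "\<bar>Re p\<bar> \<le> 1"
proof -
  have "\<bar>Re (cnj p)\<bar> \<le> 1"
  proof (rule disk_automorphism_semiconjugate_translation[OF _ _ _ \<tau>])
    show "(\<lambda>w. gauss_quotient (N w)) holomorphic_on {w. Re w < r}"
      using null pos by (intro gauss_quotient_holomorphic hol) auto
    show "(cmod (cnj p))\<^sup>2 - (cmod (- q))\<^sup>2 = 1"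
      using det by simp
    fix w assume w: "Re w < r"
    show "cmod (gauss_quotient (N w)) < 1"
      by (rule conformal_factor_pos(2)[OF null[OF w] pos[OF w]])
    show "gauss_quotient (N (w + \<tau>)) = disk_automorphism (cnj p) (- q) (gauss_quotient (N w))"
      unfolding equivariant[OF w]
      by (rule gauss_quotient_conjugate_su11[OF null[OF w] pos[OF w] det])
  qed
  then show ?thesis by simp
qed

definition swap :: "complex^2^2" where
  "swap = vector [vector [0, 1], vector [-1, 0]]"

lemma adjugate_mat_1: "adjugate (mat 1) = mat 1"
  by (simp add: mat2_simps)

lemma conformal_factor_swap: "conformal_factor (adjugate swap ** N ** swap) = - conformal_factor N"
  by (simp add: conformal_factor_def swap_def adjugate_def matrix_matrix_mult_def sum_2)

lemma su11_mult_swap: "su11 p q ** swap = swap ** su11 (cnj p) (- cnj q)"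
  by (simp add: su11_def swap_def mat2_simps)

text \<open>
  Passing to the conjugate by \<^term>\<open>swap\<close> replaces the Gauss map \<open>g\<close> by \<open>1 / g\<close> up to sign.
\<close>

lemma conformal_factor_pos_or_swap:
  assumes "connected S" and hol: "N matrix_holomorphic_on S"
    and nonzero: "\<And>w. w \<in> S \<Longrightarrow> conformal_factor (N w) \<noteq> 0"
  obtains J where "J = mat 1 \<or> J = swap"
    "\<And>w. w \<in> S \<Longrightarrow> conformal_factor (adjugate J ** N w ** J) > 0"
proof -
  have "continuous_on S (\<lambda>w. conformal_factor (N w))"
    unfolding conformal_factor_def
    by (intro continuous_intros holomorphic_on_imp_continuous_on matrix_holomorphic_onD[OF hol])
  then have "connected ((\<lambda>w. conformal_factor (N w)) ` S)"
    using \<open>connected S\<close> by (rule connected_continuous_image)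
  moreover have "0 \<notin> (\<lambda>w. conformal_factor (N w)) ` S"
    using nonzero by auto
  ultimately have "(\<forall>w\<in>S. conformal_factor (N w) > 0) \<or> (\<forall>w\<in>S. conformal_factor (N w) < 0)"
    by (smt (verit) connectedD_interval image_eqI)
  then show thesis
    using that[of "mat 1"] that[of swap] by (auto simp: conformal_factor_swap adjugate_mat_1)
qed

lemma null_frame_translate:
  assumes frame: "null_frame f F N" and monodromy: "has_monodromy F \<rho>" and \<rho>: "det \<rho> = 1"
    and w: "w \<in> left_half_plane"
  shows "N (w + deck_period) = adjugate \<rho> ** N w ** \<rho>"
proof -
  note w' = add_deck_period_in_left_half_plane[OF w]
  have F': "F (w + deck_period) = F w ** \<rho>"
    using monodromy w by (simp add: has_monodromy_def)
  have "((\<lambda>u. F u ** \<rho>) has_matrix_derivative F w ** N w ** \<rho>) (at w)"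
    using has_matrix_derivative_mult[OF null_frameD(2)[OF frame w] has_matrix_derivative_const]
    by (simp add: matrix_mult_simps)
  then have "((\<lambda>u. F (u + deck_period)) has_matrix_derivative F w ** N w ** \<rho>) (at w)"
    unfolding has_matrix_derivative_def
    by (rule has_derivative_transform_within_open[OF _ open_left_half_plane w])
       (use monodromy in \<open>simp add: has_monodromy_def\<close>)
  moreover have "((\<lambda>u. F (u + deck_period)) has_matrix_derivative
      F (w + deck_period) ** N (w + deck_period)) (at w)"
    by (rule has_matrix_derivative_shift[OF null_frameD(2)[OF frame w']])
  ultimately have "F w ** (\<rho> ** N (w + deck_period)) = F w ** (N w ** \<rho>)"
    using has_matrix_derivative_unique by (metis F' matrix_mul_assoc)
  then have "\<rho> ** N (w + deck_period) = N w ** \<rho>"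
    by (metis adjugate_inverse(4) null_frameD(3)[OF frame w])
  then show ?thesis
    by (metis adjugate_inverse(4)[OF \<rho>] matrix_mul_assoc)
qed

lemma su11_mult_identity_or_swap:
  assumes "J = mat 1 \<or> J = swap"
  obtains p' q' where "su11 p q ** J = J ** su11 p' q'" "Re p' = Re p"
    "(cmod p')\<^sup>2 - (cmod q')\<^sup>2 = (cmod p)\<^sup>2 - (cmod q)\<^sup>2"
  using assms
proof
  assume "J = mat 1"
  then show thesis
    using that[of p q] by simp
next
  assume "J = swap"
  then show thesis
    using that[of "cnj p" "- cnj q"] by (simp add: su11_mult_swap)
qed

lemma null_frame_monodromy_trace_bound:
  assumes frame: "null_frame f F N" and r: "r \<le> 0"
    and nonzero: "\<And>w. Re w < r \<Longrightarrow> conformal_factor (N w) \<noteq> 0"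
    and det: "(cmod p)\<^sup>2 - (cmod q)\<^sup>2 = 1" and monodromy: "has_monodromy F (su11 p q)"
  shows "\<bar>Re p\<bar> \<le> 1"
proof -
  have sub: "{w. Re w < r} \<subseteq> left_half_plane"
    using r by (auto simp: left_half_plane_def)
  have hol: "N matrix_holomorphic_on {w. Re w < r}"
    using null_frameD(1)[OF frame] sub holomorphic_on_subset
    unfolding matrix_holomorphic_on_def by blast
  obtain J where J: "J = mat 1 \<or> J = swap"
    and pos: "\<And>w. w \<in> {w. Re w < r} \<Longrightarrow> conformal_factor (adjugate J ** N w ** J) > 0"
    using conformal_factor_pos_or_swap[OF convex_connected[OF convex_halfspace_Re_lt] hol] nonzero
    by blast
  obtain p' q' where conj: "su11 p q ** J = J ** su11 p' q'" and Re_p': "Re p' = Re p"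
    and det': "(cmod p')\<^sup>2 - (cmod q')\<^sup>2 = 1"
    using su11_mult_identity_or_swap[OF J] det by metis
  have "\<bar>Re p'\<bar> \<le> 1"
  proof (rule monodromy_trace_bound_if_conformal_factor_pos)
    show "(\<lambda>w. adjugate J ** N w ** J) matrix_holomorphic_on {w. Re w < r}"
      by (intro matrix_holomorphic_on_mult matrix_holomorphic_on_const hol)
    show "(cmod p')\<^sup>2 - (cmod q')\<^sup>2 = 1" "Re deck_period \<le> 0"
      using det' by simp_all
    fix w assume w: "Re w < r"
    then have "w \<in> left_half_plane"
      using sub by blast
    then show "null_matrix (adjugate J ** N w ** J)"
      by (intro null_matrix_conjugate null_frameD(5)[OF frame])
    show "conformal_factor (adjugate J ** N w ** J) > 0"
      using pos w by simp
    have "adjugate J ** N (w + deck_period) ** J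
        = adjugate (su11 p q ** J) ** N w ** (su11 p q ** J)"
      using null_frame_translate[OF frame monodromy det_SU11[OF su11_mem_SU11[OF det]]
          \<open>w \<in> left_half_plane\<close>]
      by (simp add: adjugate_simps matrix_mult_simps)
    then show "adjugate J ** N (w + deck_period) ** J
        = adjugate (su11 p' q') ** (adjugate J ** N w ** J) ** su11 p' q'"
      unfolding conj by (simp add: adjugate_simps matrix_mult_simps)
  qed
  then show ?thesis
    using Re_p' by simp
qed

section \<open>Curvature of conformal metrics\<close>

lemma pd_minus: "f differentiable (at z) \<Longrightarrow> pd i (\<lambda>w. - f w) z = - pd i f z"
  using pd_eqI[OF has_derivative_minus] unfolding frechet_derivative_works by (simp add: pd_def)

context
  fixes h :: "complex \<Rightarrow> real^2^2" and u S
  assumes S: "open S" and h: "\<And>w. w \<in> S \<Longrightarrow> h w = mat (exp (2 * u w))"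
    and u: "\<And>w. w \<in> S \<Longrightarrow> u differentiable (at w)"
begin

lemma pd_conformal_metric:
  assumes w: "w \<in> S"
  shows "pd l (\<lambda>v. h v $ i $ j) w = (if i = j then 2 * exp (2 * u w) * pd l u w else 0)"
proof -
  have "pd l (\<lambda>v. h v $ i $ j) w = pd l (\<lambda>v. if i = j then exp (2 * u v) else 0) w"
    by (rule pd_eq_on_open[OF S w]) (simp add: h mat_def)
  moreover have "((\<lambda>v. exp (2 * u v)) has_derivative
      (\<lambda>t. 2 * frechet_derivative u (at w) t * exp (2 * u w))) (at w)"
    using u[OF w] unfolding frechet_derivative_works
    by (intro DERIV_compose_FDERIV[OF DERIV_exp] has_derivative_mult_right)
  from pd_eqI[OF this] have "pd l (\<lambda>v. exp (2 * u v)) w = 2 * exp (2 * u w) * pd l u w"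
    by (simp add: pd_def)
  ultimately show ?thesis
    by (simp add: pd_const)
qed

lemma christoffel_conformal_metric:
  assumes w: "w \<in> S"
  shows "christoffel h k i j w = (if j = k then pd i u w else 0) + (if i = k then pd j u w else 0)
    - (if i = j then pd k u w else 0)"
proof -
  have "matrix_inv (h w) = mat (exp (- 2 * u w))"
    using matrix_inv_mat[of "exp (2 * u w)"] h[OF w] by (simp add: exp_minus inverse_eq_divide)
  then have "christoffel h k i j w = (\<Sum>l\<in>UNIV. (if k = l then 1 else 0) *
      ((if j = l then pd i u w else 0) + (if i = l then pd j u w else 0)
        - (if i = j then pd l u w else 0)))"
    unfolding christoffel_def pd_conformal_metric[OF w] mat_def
    by (simp add: sum_2 exp_minus field_simps)
  moreover have "(\<Sum>l\<in>UNIV. (if k = l then 1 else 0) * v l) = v k" for v :: "2 \<Rightarrow> real"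
    using exhaust_2[of k] by (auto simp: sum_2)
  ultimately show ?thesis
    by simp
qed

lemma gauss_curvature_conformal_metric:
  assumes z: "z \<in> S" and pd_u: "\<And>i. pd i u differentiable (at z)"
  shows "gauss_curvature h z * sqrt (det (h z)) = - laplacian u z"
proof -
  have "pd 1 (christoffel h 1 2 2) z = pd 1 (\<lambda>w. - pd 1 u w) z"
    by (rule pd_eq_on_open[OF S z]) (simp add: christoffel_conformal_metric)
  moreover have "pd 2 (christoffel h 1 1 2) z = pd 2 (pd 2 u) z"
    by (rule pd_eq_on_open[OF S z]) (simp add: christoffel_conformal_metric)
  ultimately have riemann: "riemann h 1 2 1 2 z = - laplacian u z"
    unfolding riemann_def laplacian_def
    by (simp add: sum_2 christoffel_conformal_metric[OF z] pd_minus[OF pd_u])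
  have det: "det (h z) = exp (2 * u z) * exp (2 * u z)"
    by (simp add: h[OF z] det_2 mat_def)
  have "gauss_curvature h z = riemann h 1 2 1 2 z / exp (2 * u z)"
    unfolding gauss_curvature_def det by (simp add: sum_2 h[OF z] mat_def)
  then show ?thesis
    by (simp add: riemann det)
qed

end

lemma laplacian_eq_if_derivative:
  assumes S: "open S" "z \<in> S"
    and u: "\<And>w. w \<in> S \<Longrightarrow> (u has_derivative (\<lambda>t. Re (t * \<Phi> w))) (at w)"
    and \<Phi>: "(\<Phi> has_derivative D) (at z)"
  shows "pd i u differentiable (at z)" "laplacian u z = Re (D 1 + \<i> * D \<i>)"
proof -
  have pd_u: "pd i u w = Re (coord_vec i * \<Phi> w)" if "w \<in> S" for i w
    using pd_eqI[OF u[OF that]] .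
  have "((\<lambda>w. Re (coord_vec i * \<Phi> w)) has_derivative (\<lambda>t. Re (coord_vec i * D t))) (at z)" for i
    using \<Phi> by (auto intro!: derivative_eq_intros)
  then have der: "(pd i u has_derivative (\<lambda>t. Re (coord_vec i * D t))) (at z)" for i
    by (rule has_derivative_transform_within_open[OF _ S]) (simp add: pd_u)
  then show "pd i u differentiable (at z)"
    by (rule differentiableI)
  show "laplacian u z = Re (D 1 + \<i> * D \<i>)"
    unfolding laplacian_def using pd_eqI[OF der[of 1], of 1] pd_eqI[OF der[of 2], of 2]
    by (simp add: coord_vec_def)
qed

lemma has_derivative_norm_power2:
  assumes "(k has_derivative D) (at w)"
  shows "((\<lambda>w. (cmod (k w))\<^sup>2) has_derivative (\<lambda>t. 2 * Re (D t * cnj (k w)))) (at w)"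
proof -
  have "((\<lambda>w. k w \<bullet> k w) has_derivative (\<lambda>t. k w \<bullet> D t + D t \<bullet> k w)) (at w)"
    by (intro has_derivative_inner assms)
  then show ?thesis
    by (simp add: power2_norm_eq_inner inner_complex_def algebra_simps)
qed

lemma has_derivative_ln_norm:
  assumes k: "(k has_field_derivative k') (at w)" and nonzero: "k w \<noteq> 0"
  shows "((\<lambda>w. ln (cmod (k w))) has_derivative (\<lambda>t. Re (t * (k' / k w)))) (at w)"
proof -
  have "((\<lambda>w. ln ((cmod (k w))\<^sup>2) / 2) has_derivative
      (\<lambda>t. 2 * Re (k' * t * cnj (k w)) * (1 / (cmod (k w))\<^sup>2) / 2)) (at w)"
    using nonzero
    by (intro bounded_linear.has_derivative[OF bounded_linear_divide]
        DERIV_compose_FDERIV[OF DERIV_ln_divide]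
        has_derivative_norm_power2[OF k[unfolded has_field_derivative_def]]) simp
  moreover have "t * (k' / k w) = (1 / (cmod (k w))\<^sup>2) *\<^sub>R (k' * t * cnj (k w))" for t
    using nonzero by (simp add: scaleR_conv_of_real complex_norm_square field_simps
        flip: of_real_power)
  ultimately show ?thesis
    by (simp only: scaleR_complex.sel) (simp add: ln_realpow diff_divide_distrib add_divide_distrib)
qed

lemma has_derivative_ln_one_minus_norm_power2:
  assumes \<gamma>: "(\<gamma> has_field_derivative \<gamma>') (at w)" and disk: "cmod (\<gamma> w) < 1"
  shows "((\<lambda>w. ln (1 - (cmod (\<gamma> w))\<^sup>2)) has_derivative
    (\<lambda>t. Re (t * - (2 * \<gamma>' * cnj (\<gamma> w) / (1 - \<gamma> w * cnj (\<gamma> w)))))) (at w)"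
proof -
  have "(cmod (\<gamma> w))\<^sup>2 < 1"
    using disk by (simp add: abs_square_less_1)
  then have "((\<lambda>w. ln (1 - (cmod (\<gamma> w))\<^sup>2)) has_derivative
      (\<lambda>t. (0 - 2 * Re (\<gamma>' * t * cnj (\<gamma> w))) * (1 / (1 - (cmod (\<gamma> w))\<^sup>2)))) (at w)"
    by (intro DERIV_compose_FDERIV[OF DERIV_ln_divide] has_derivative_diff has_derivative_const
        has_derivative_norm_power2[OF \<gamma>[unfolded has_field_derivative_def]]) simp
  moreover have "complex_of_real (1 - (cmod (\<gamma> w))\<^sup>2) = 1 - \<gamma> w * cnj (\<gamma> w)"
    unfolding of_real_diff complex_norm_square by simp
  then have "t * - (2 * \<gamma>' * cnj (\<gamma> w) / (1 - \<gamma> w * cnj (\<gamma> w)))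
      = (- 2 / (1 - (cmod (\<gamma> w))\<^sup>2)) *\<^sub>R (\<gamma>' * t * cnj (\<gamma> w))" for t
    by (simp add: scaleR_conv_of_real)
  ultimately show ?thesis
    by (simp only: scaleR_complex.sel) (simp add: algebra_simps)
qed

lemma has_derivative_disk_gradient:
  assumes \<gamma>: "(\<gamma> has_field_derivative \<gamma>' z) (at z)" and \<gamma>': "(\<gamma>' has_field_derivative \<gamma>'') (at z)"
    and disk: "cmod (\<gamma> z) < 1"
  obtains D where
    "((\<lambda>w. 2 * \<gamma>' w * cnj (\<gamma> w) / (1 - \<gamma> w * cnj (\<gamma> w))) has_derivative D) (at z)"
    "D 1 + \<i> * D \<i> = of_real ((2 * cmod (\<gamma>' z) / (1 - (cmod (\<gamma> z))\<^sup>2))\<^sup>2)"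
proof -
  define m where "m = 1 - \<gamma> z * cnj (\<gamma> z)"
  have m: "m = of_real (1 - (cmod (\<gamma> z))\<^sup>2)"
    unfolding m_def of_real_diff complex_norm_square by simp
  have "m \<noteq> 0"
    using disk one_minus_cnj_mult_neq_zero[OF disk disk] by (simp add: m_def mult.commute)
  define D where "D = (\<lambda>t. ((2 * \<gamma>' z * cnj (\<gamma>' z * t) + 2 * (\<gamma>'' * t) * cnj (\<gamma> z)) * m
      - 2 * \<gamma>' z * cnj (\<gamma> z) * (0 - (\<gamma> z * cnj (\<gamma>' z * t) + \<gamma>' z * t * cnj (\<gamma> z)))) / (m * m))"
  have "((\<lambda>w. 2 * \<gamma>' w * cnj (\<gamma> w) / (1 - \<gamma> w * cnj (\<gamma> w))) has_derivative D) (at z)"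
    unfolding D_def m_def
    using \<gamma> \<gamma>' \<open>m \<noteq> 0\<close> unfolding has_field_derivative_def m_def
    by (intro has_derivative_diff has_derivative_divide' has_derivative_mult
        has_derivative_mult_right has_derivative_cnj has_derivative_const)
  moreover have "D 1 + \<i> * D \<i> = 4 * (\<gamma>' z * cnj (\<gamma>' z)) / (m * m)"
    unfolding D_def using \<open>m \<noteq> 0\<close> by (simp add: divide_simps) (simp add: m_def algebra_simps)
  then have "D 1 + \<i> * D \<i> = of_real ((2 * cmod (\<gamma>' z) / (1 - (cmod (\<gamma> z))\<^sup>2))\<^sup>2)"
    unfolding m complex_norm_square[symmetric]
    by (simp add: power_divide power_mult_distrib power2_eq_square)
  ultimately show thesis
    by (rule that)
qed

text \<open>
  Up to a flat factor the metric is the inverse of the pullback under \<open>\<gamma>\<close> of the hyperbolic metric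
  of curvature \<open>-1\<close>, so its curvature form is the pullback of the hyperbolic area form.
\<close>

lemma gauss_curvature_disk_pullback:
  fixes k \<gamma> :: "complex \<Rightarrow> complex"
  assumes S: "open S" "z \<in> S" and k: "k holomorphic_on S" "\<And>w. w \<in> S \<Longrightarrow> k w \<noteq> 0"
    and \<gamma>: "\<gamma> holomorphic_on S" "\<And>w. w \<in> S \<Longrightarrow> cmod (\<gamma> w) < 1"
    and h: "\<And>w. w \<in> S \<Longrightarrow> h w = mat ((cmod (k w) * (1 - (cmod (\<gamma> w))\<^sup>2))\<^sup>2)"
  shows "gauss_curvature h z * sqrt (det (h z)) = (2 * cmod (deriv \<gamma> z) / (1 - (cmod (\<gamma> z))\<^sup>2))\<^sup>2"
proof -
  define u where "u = (\<lambda>w. ln (cmod (k w)) + ln (1 - (cmod (\<gamma> w))\<^sup>2))"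
  define \<Psi> where "\<Psi> = (\<lambda>w. 2 * deriv \<gamma> w * cnj (\<gamma> w) / (1 - \<gamma> w * cnj (\<gamma> w)))"
  define \<Phi> where "\<Phi> = (\<lambda>w. deriv k w / k w - \<Psi> w)"
  have norm_\<gamma>: "(cmod (\<gamma> w))\<^sup>2 < 1" if "w \<in> S" for w
    using \<gamma>(2)[OF that] by (simp add: abs_square_less_1)
  have exp_u: "h w = mat (exp (2 * u w))" if "w \<in> S" for w
  proof -
    have "exp (u w) = cmod (k w) * (1 - (cmod (\<gamma> w))\<^sup>2)"
      using k(2)[OF that] norm_\<gamma>[OF that] by (simp add: u_def exp_add)
    then show ?thesis
      using h[OF that] by (simp add: exp_double)
  qed
  have du: "(u has_derivative (\<lambda>t. Re (t * \<Phi> w))) (at w)" if "w \<in> S" for w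
    using has_derivative_add[OF
        has_derivative_ln_norm[OF holomorphic_derivI[OF k(1) S(1) that] k(2)[OF that]]
        has_derivative_ln_one_minus_norm_power2[OF holomorphic_derivI[OF \<gamma>(1) S(1) that]
          \<gamma>(2)[OF that]]]
    by (simp add: u_def \<Phi>_def \<Psi>_def right_diff_distrib)
  obtain c where log_deriv_k: "((\<lambda>w. deriv k w / k w) has_field_derivative c) (at z)"
    using holomorphic_derivI[OF holomorphic_on_divide[OF holomorphic_deriv[OF k(1) S(1)] k(1) k(2)]
        S]
    by blast
  obtain D where D: "(\<Psi> has_derivative D) (at z)"
      "D 1 + \<i> * D \<i> = of_real ((2 * cmod (deriv \<gamma> z) / (1 - (cmod (\<gamma> z))\<^sup>2))\<^sup>2)"
    using has_derivative_disk_gradient[OF holomorphic_derivI[OF \<gamma>(1) S]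
        holomorphic_derivI[OF holomorphic_deriv[OF \<gamma>(1) S(1)] S] \<gamma>(2)[OF S(2)]]
    unfolding \<Psi>_def by blast
  have d\<Phi>: "(\<Phi> has_derivative (\<lambda>t. c * t - D t)) (at z)"
    unfolding \<Phi>_def
    by (intro has_derivative_diff D(1) log_deriv_k[unfolded has_field_derivative_def])
  have "laplacian u z = Re (c * 1 - D 1 + \<i> * (c * \<i> - D \<i>))"
    by (rule laplacian_eq_if_derivative(2)[OF S du d\<Phi>])
  also have "\<dots> = - Re (D 1 + \<i> * D \<i>)"
    by simp
  finally have "laplacian u z = - (2 * cmod (deriv \<gamma> z) / (1 - (cmod (\<gamma> z))\<^sup>2))\<^sup>2"
    unfolding D(2) Re_complex_of_real .
  moreover have "gauss_curvature h z * sqrt (det (h z)) = - laplacian u z"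
    by (rule gauss_curvature_conformal_metric[OF S(1) exp_u differentiableI[OF du] S(2)
          laplacian_eq_if_derivative(1)[OF S du d\<Phi>]])
  ultimately show ?thesis by simp
qed

section \<open>Integrability at a cusp\<close>

lemma set_integrable_countable_cover:
  fixes T :: "'a \<Rightarrow> real"
  assumes meas: "set_borel_measurable M A T" and cover: "A \<subseteq> (\<Union>m. B m)"
    and B: "\<And>m. B m \<in> sets M" "\<And>m. emeasure M (B m) \<le> ennreal (b m)"
    and bound: "\<And>m x. x \<in> A \<Longrightarrow> x \<in> B m \<Longrightarrow> \<bar>T x\<bar> \<le> c m"
    and nonneg: "\<And>m. 0 \<le> b m" "\<And>m. 0 \<le> c m" and summable: "summable (\<lambda>m. c m * b m)"
  shows "set_integrable M A T"
  unfolding set_integrable_def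
proof (rule integrableI_bounded)
  show "(\<lambda>x. indicator A x *\<^sub>R T x) \<in> borel_measurable M"
    using meas by (simp add: set_borel_measurable_def)
  have term_le: "g m \<le> (\<Sum>m. g m)" for g :: "nat \<Rightarrow> ennreal" and m
    using sum_le_suminf[OF summableI, of "{m}" g] by simp
  have "ennreal (norm (indicator A x *\<^sub>R T x)) \<le> (\<Sum>m. ennreal (c m) * indicator (B m) x)" for x
  proof (cases "x \<in> A")
    case True
    then obtain m where "x \<in> B m"
      using cover by blast
    then have "ennreal (norm (indicator A x *\<^sub>R T x)) \<le> ennreal (c m) * indicator (B m) x"
      using True bound by (simp add: ennreal_leI)
    also note term_le
    finally show ?thesis .
  qed simp
  then have "(\<integral>\<^sup>+ x. ennreal (norm (indicator A x *\<^sub>R T x)) \<partial>M)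
      \<le> (\<integral>\<^sup>+ x. (\<Sum>m. ennreal (c m) * indicator (B m) x) \<partial>M)"
    by (intro nn_integral_mono)
  also have "\<dots> = (\<Sum>m. ennreal (c m) * emeasure M (B m))"
    using B(1) by (simp add: nn_integral_suminf nn_integral_cmult_indicator)
  also have "\<dots> \<le> (\<Sum>m. ennreal (c m * b m))"
    using B(2) nonneg by (intro suminf_le summableI) (simp add: ennreal_mult' mult_left_mono)
  also have "\<dots> < \<infinity>"
    using summable nonneg by (simp add: suminf_ennreal2)
  finally show "(\<integral>\<^sup>+ x. ennreal (norm (indicator A x *\<^sub>R T x)) \<partial>M) < \<infinity>" .
qed

lemma open_punctured_disk: "open (punctured_disk r)"
proof -
  have "punctured_disk r = ball 0 r - {0}"
    by (auto simp: punctured_disk_def)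
  then show ?thesis by auto
qed

lemma inverse_cusp_density_le:
  fixes \<delta> s x :: real
  assumes "\<delta> > 0" "\<delta> * exp (- (s + 1)) \<le> x" "s \<le> ln \<delta> - ln x" "s > 0"
  shows "(1 / (x * (ln \<delta> - ln x)))\<^sup>2 \<le> (exp (s + 1) / (\<delta> * s))\<^sup>2"
proof -
  have pos: "\<delta> * exp (- (s + 1)) * s > 0"
    using assms by simp
  have "\<delta> * exp (- (s + 1)) * s \<le> x * (ln \<delta> - ln x)"
    using assms by (intro mult_mono) (auto intro: order_trans[OF _ assms(2)])
  then have "1 / (x * (ln \<delta> - ln x)) \<le> 1 / (\<delta> * exp (- (s + 1)) * s)"
    using pos by (intro frac_le) auto
  also have "\<dots> = exp (s + 1) / (\<delta> * s)"
    unfolding exp_minus by (simp add: divide_simps)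
  finally show ?thesis
    using pos \<open>\<delta> * exp (- (s + 1)) * s \<le> x * (ln \<delta> - ln x)\<close> by (intro power_mono) auto
qed

definition cusp_annulus :: "real \<Rightarrow> nat \<Rightarrow> complex set" where
  "cusp_annulus \<delta> m = cball 0 (\<delta> * exp (- real (Suc m))) - ball 0 (\<delta> * exp (- real (Suc (Suc m))))"

lemma cusp_annulus_imp_ln_ge:
  assumes "\<delta> > 0" "z \<in> cusp_annulus \<delta> m" "z \<noteq> 0"
  shows "real (Suc m) \<le> ln \<delta> - ln (cmod z)"
proof -
  have "ln (cmod z) \<le> ln (\<delta> * exp (- real (Suc m)))"
    using assms by (intro ln_mono) (auto simp: cusp_annulus_def)
  then show ?thesis
    using assms(1) by (simp add: ln_mult)
qed

lemma punctured_disk_subset_cusp_annuli: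
  assumes \<delta>: "\<delta> > 0" and r: "r \<le> \<delta> * exp (-1)"
  shows "punctured_disk r \<subseteq> (\<Union>m. cusp_annulus \<delta> m)"
proof
  fix z assume "z \<in> punctured_disk r"
  then have z: "0 < cmod z" "cmod z < r"
    by (auto simp: punctured_disk_def)
  define x where "x = ln \<delta> - ln (cmod z)"
  have "ln (cmod z) < ln (\<delta> * exp (-1))"
    using z r \<delta> by simp
  then have "x > 1"
    using \<delta> by (simp add: x_def ln_mult)
  then have "\<lfloor>x\<rfloor> \<ge> 1"
    by linarith
  then have "real (Suc (nat \<lfloor>x\<rfloor> - 1)) = of_int \<lfloor>x\<rfloor>"
    by (simp add: of_nat_diff)
  moreover have "cmod z = \<delta> * exp (- x)"
    using z \<delta> by (simp add: x_def exp_diff)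
  ultimately have "z \<in> cusp_annulus \<delta> (nat \<lfloor>x\<rfloor> - 1)"
    using \<delta> unfolding cusp_annulus_def of_nat_Suc[of "Suc _"] by simp linarith
  then show "z \<in> (\<Union>m. cusp_annulus \<delta> m)"
    by blast
qed

lemma emeasure_cusp_annulus_le:
  assumes "\<delta> > 0"
  shows "emeasure lborel (cusp_annulus \<delta> m) \<le> ennreal (pi * (\<delta> * exp (- real (Suc m)))\<^sup>2)"
proof -
  have "emeasure lborel (cusp_annulus \<delta> m)
      \<le> emeasure lborel (cball (0::complex) (\<delta> * exp (- real (Suc m))))"
    by (intro emeasure_mono) (auto simp: cusp_annulus_def)
  also have "\<dots> = ennreal (pi * (\<delta> * exp (- real (Suc m)))\<^sup>2)"
    using assms emeasure_cball[of "\<delta> * exp (- real (Suc m))" "0::complex"]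
    by (simp add: eval_unit_ball_vol)
  finally show ?thesis .
qed

lemma cusp_annulus_weight:
  fixes \<delta> s :: real
  assumes "\<delta> > 0"
  shows "(exp (s + 1) / (\<delta> * s))\<^sup>2 * (pi * (\<delta> * exp (- s))\<^sup>2) = pi * exp 2 * (1 / s\<^sup>2)"
proof -
  have "exp (s + 1) / (\<delta> * s) * (\<delta> * exp (- s)) = exp (s + 1) * exp (- s) / s"
    using assms by simp
  also have "exp (s + 1) * exp (- s) = exp 1"
    by (simp flip: exp_add)
  finally have "(exp (s + 1) / (\<delta> * s))\<^sup>2 * (pi * (\<delta> * exp (- s))\<^sup>2) = pi * (exp 1 / s)\<^sup>2"
    by (metis mult.left_commute power_mult_distrib)
  then show ?thesis
    by (simp add: power_divide flip: exp_double)
qed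

text \<open>
  The bound is the area density of the hyperbolic metric of the punctured disk of radius \<open>\<delta>\<close>.
\<close>

lemma set_integrable_cusp:
  fixes T :: "complex \<Rightarrow> real"
  assumes \<delta>: "\<delta> > 0" and r: "r \<le> \<delta> * exp (-1)"
    and cont: "continuous_on (punctured_disk r) T"
    and bound: "\<And>z. z \<in> punctured_disk r \<Longrightarrow> \<bar>T z\<bar> \<le> (1 / (cmod z * (ln \<delta> - ln (cmod z))))\<^sup>2"
  shows "set_integrable lborel (punctured_disk r) T"
proof (rule set_integrable_countable_cover)
  define c where "c = (\<lambda>m. (exp (real (Suc m) + 1) / (\<delta> * real (Suc m)))\<^sup>2)"
  define b where "b = (\<lambda>m. pi * (\<delta> * exp (- real (Suc m)))\<^sup>2)"
  show "set_borel_measurable lborel (punctured_disk r) T"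
    using borel_measurable_continuous_on_indicator[OF borel_open[OF open_punctured_disk] cont]
    by (simp add: set_borel_measurable_def)
  show "punctured_disk r \<subseteq> (\<Union>m. cusp_annulus \<delta> m)"
    by (rule punctured_disk_subset_cusp_annuli[OF \<delta> r])
  show "cusp_annulus \<delta> m \<in> sets lborel" for m
    by (simp add: cusp_annulus_def)
  show "emeasure lborel (cusp_annulus \<delta> m) \<le> ennreal (b m)" for m
    unfolding b_def by (rule emeasure_cusp_annulus_le[OF \<delta>])
  show "\<bar>T z\<bar> \<le> c m" if z: "z \<in> punctured_disk r" "z \<in> cusp_annulus \<delta> m" for m z
  proof -
    have "\<delta> * exp (- (real (Suc m) + 1)) \<le> cmod z"
      using z(2) by (simp add: cusp_annulus_def add.commute)
    moreover have "real (Suc m) \<le> ln \<delta> - ln (cmod z)"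
      using z by (intro cusp_annulus_imp_ln_ge[OF \<delta>]) (auto simp: punctured_disk_def)
    ultimately show ?thesis
      using bound[OF z(1)] inverse_cusp_density_le[OF \<delta>, of "real (Suc m)" "cmod z"]
      by (simp add: c_def)
  qed
  show "0 \<le> b m" "0 \<le> c m" for m
    by (simp_all add: b_def c_def)
  have "c m * b m = pi * exp 2 * (1 / (real (Suc m))\<^sup>2)" for m
    unfolding c_def b_def by (rule cusp_annulus_weight[OF \<delta>])
  moreover have "summable (\<lambda>m. 1 / (real (Suc m))\<^sup>2)"
    using inverse_squares_sums by (simp add: sums_iff)
  ultimately show "summable (\<lambda>m. c m * b m)"
    by (simp only: summable_mult)
qed

section \<open>Complete ends\<close>

lemma local_logarithm:
  fixes w0 :: complex
  assumes D: "open D" "w0 \<in> D"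
  obtains S l where "open S" "exp w0 \<in> S" "l (exp w0) = w0"
    "\<And>z. z \<in> S \<Longrightarrow> exp (l z) = z" "\<And>z. z \<in> S \<Longrightarrow> l z \<in> D"
    "\<And>z. z \<in> S \<Longrightarrow> (l has_field_derivative 1 / z) (at z)"
proof -
  define V where "V = {z. Re (z / exp w0) > 0}"
  define l where "l = (\<lambda>z. Ln (z / exp w0) + w0)"
  have "open V"
    unfolding V_def by (intro open_Collect_less continuous_intros) simp
  have deriv: "(l has_field_derivative 1 / z) (at z)" if "z \<in> V" for z
  proof -
    have "z / exp w0 \<notin> \<real>\<^sub>\<le>\<^sub>0" "z \<noteq> 0"
      using that by (auto simp: V_def complex_nonpos_Reals_iff)
    then show ?thesis
      unfolding l_def by (auto intro!: derivative_eq_intros simp: field_simps)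
  qed
  then have "continuous_on V l"
    by (intro continuous_at_imp_continuous_on) (auto intro: DERIV_isCont)
  show thesis
  proof (rule that[of "V \<inter> l -` D" l])
    show "open (V \<inter> l -` D)"
      by (rule continuous_open_preimage[OF \<open>continuous_on V l\<close> \<open>open V\<close> D(1)])
    show "exp w0 \<in> V \<inter> l -` D" "l (exp w0) = w0"
      using D(2) by (simp_all add: V_def l_def)
    fix z assume z: "z \<in> V \<inter> l -` D"
    then show "l z \<in> D" "(l has_field_derivative 1 / z) (at z)"
      using deriv by simp_all
    have "z \<noteq> 0"
      using z by (auto simp: V_def)
    then show "exp (l z) = z"
      by (simp add: l_def exp_add)
  qed
qed

lemma gauss_curvature_exp:
  assumes D: "open D" and k: "k holomorphic_on D" "\<And>w. w \<in> D \<Longrightarrow> k w \<noteq> 0"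
    and G: "G holomorphic_on D" "\<And>w. w \<in> D \<Longrightarrow> cmod (G w) < 1"
    and h: "\<And>w. w \<in> D \<Longrightarrow> h (exp w) = mat ((cmod (k w) * (1 - (cmod (G w))\<^sup>2) / cmod (exp w))\<^sup>2)"
    and w: "w \<in> D"
  shows "gauss_curvature h (exp w) * sqrt (det (h (exp w)))
    = (2 * cmod (deriv G w) / (1 - (cmod (G w))\<^sup>2) / cmod (exp w))\<^sup>2"
proof -
  obtain S l where S: "open S" "exp w \<in> S" and l_w: "l (exp w) = w"
    and l: "\<And>z. z \<in> S \<Longrightarrow> exp (l z) = z" "\<And>z. z \<in> S \<Longrightarrow> l z \<in> D"
      "\<And>z. z \<in> S \<Longrightarrow> (l has_field_derivative 1 / z) (at z)"
    using local_logarithm[OF D w] by blast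
  define \<gamma> where "\<gamma> = (\<lambda>z. G (l z))"
  have nonzero: "z \<noteq> 0" if "z \<in> S" for z
    using l(1)[OF that] exp_not_eq_zero by metis
  have l_hol: "l holomorphic_on S"
    using l(3) S(1) by (auto simp: holomorphic_on_open)
  have "\<gamma> holomorphic_on S" "(\<lambda>z. k (l z)) holomorphic_on S"
    using holomorphic_on_compose_gen[OF l_hol G(1)] holomorphic_on_compose_gen[OF l_hol k(1)] l(2)
    by (auto simp: \<gamma>_def o_def image_subset_iff)
  moreover from this(2) have "(\<lambda>z. k (l z) / z) holomorphic_on S"
    using nonzero by (intro holomorphic_intros) auto
  moreover have "h z = mat ((cmod (k (l z) / z) * (1 - (cmod (\<gamma> z))\<^sup>2))\<^sup>2)" if "z \<in> S" for z
    using h[OF l(2)[OF that]] l(1)[OF that] by (simp add: \<gamma>_def norm_divide)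
  ultimately have curvature: "gauss_curvature h (exp w) * sqrt (det (h (exp w)))
      = (2 * cmod (deriv \<gamma> (exp w)) / (1 - (cmod (\<gamma> (exp w)))\<^sup>2))\<^sup>2"
    using S k(2) G(2) l(2) nonzero
    by (intro gauss_curvature_disk_pullback[where k = "\<lambda>z. k (l z) / z"]) (auto simp: \<gamma>_def)
  have "(G has_field_derivative deriv G w) (at (l (exp w)))"
    unfolding l_w by (rule holomorphic_derivI[OF G(1) D w])
  from DERIV_chain2[OF this l(3)[OF S(2)]] have "deriv \<gamma> (exp w) = deriv G w / exp w"
    unfolding \<gamma>_def by (simp add: DERIV_imp_deriv)
  then show ?thesis
    unfolding curvature by (simp add: \<gamma>_def l_w norm_divide mult.commute)
qed

lemma isCont_if_continuous_on_exp:
  fixes w :: complex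
  assumes D: "open D" "w \<in> D" and cont: "continuous_on D (\<lambda>w. T (exp w))"
  shows "isCont T (exp w)"
proof -
  obtain S l where S: "open S" "exp w \<in> S"
    and l: "\<And>z. z \<in> S \<Longrightarrow> exp (l z) = z" "\<And>z. z \<in> S \<Longrightarrow> l z \<in> D"
      "\<And>z. z \<in> S \<Longrightarrow> (l has_field_derivative 1 / z) (at z)"
    by (rule local_logarithm[OF D]) (rule that; assumption)
  have "continuous_on S l"
    using l(3) by (intro continuous_at_imp_continuous_on) (auto intro: DERIV_isCont)
  then have "continuous_on S (\<lambda>z. T (exp (l z)))"
    using l(2) by (intro continuous_on_compose2[OF cont]) auto
  then have "continuous_on S T"
    using l(1) by (simp cong: continuous_on_cong)
  then show ?thesis
    using S continuous_on_eq_continuous_at by blast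
qed

definition curvature_density :: "(complex \<Rightarrow> real^4) \<Rightarrow> complex \<Rightarrow> real" where
  "curvature_density f z = gauss_curvature (ds2 f) z * sqrt (det (ds2 f z))"

lemma null_frame_curvature_density:
  assumes frame: "null_frame f F N" and f: "\<And>z. z \<in> punctured_disk 1 \<Longrightarrow> f differentiable (at z)"
    and r: "r \<le> 0" and nonzero: "\<And>w. Re w < r \<Longrightarrow> conformal_factor (N w) \<noteq> 0"
  obtains G where "G holomorphic_on {w. Re w < r}" "\<And>w. Re w < r \<Longrightarrow> cmod (G w) < 1"
    "\<And>w. Re w < r \<Longrightarrow> curvature_density f (exp w)
      = (2 * cmod (deriv G w) / (1 - (cmod (G w))\<^sup>2) / cmod (exp w))\<^sup>2"
proof -
  define D where "D = {w. Re w < r}"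
  have D: "open D" "connected D" "D \<subseteq> left_half_plane"
    using r by (auto simp: D_def left_half_plane_def open_halfspace_Re_lt
        intro!: convex_connected convex_halfspace_Re_lt)
  have N_hol: "N matrix_holomorphic_on D"
    using null_frameD(1)[OF frame] D(3) holomorphic_on_subset
    unfolding matrix_holomorphic_on_def by blast
  obtain J where J: "J = mat 1 \<or> J = swap"
    and pos: "\<And>w. w \<in> D \<Longrightarrow> conformal_factor (adjugate J ** N w ** J) > 0"
    using conformal_factor_pos_or_swap[OF D(2) N_hol] nonzero by (auto simp: D_def)
  define M where "M = (\<lambda>w. adjugate J ** N w ** J)"
  define G where "G = (\<lambda>w. gauss_quotient (M w))"
  have M_hol: "M matrix_holomorphic_on D"
    unfolding M_def by (intro matrix_holomorphic_on_mult matrix_holomorphic_on_const N_hol)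
  have M: "null_matrix (M w)" "conformal_factor (M w) > 0" if "w \<in> D" for w
    using that D(3) pos null_matrix_conjugate null_frameD(5)[OF frame] by (auto simp: M_def)
  have k: "(\<lambda>w. M w $2$1) holomorphic_on D" "\<And>w. w \<in> D \<Longrightarrow> M w $2$1 \<noteq> 0"
    using matrix_holomorphic_onD[OF M_hol] conformal_factor_pos(1)[OF M] by auto
  have G: "G holomorphic_on D" "\<And>w. w \<in> D \<Longrightarrow> cmod (G w) < 1"
    using gauss_quotient_holomorphic[OF M_hol M] conformal_factor_pos(2)[OF M] by (auto simp: G_def)
  have metric: "ds2 f (exp w) = mat ((cmod (M w $2$1) * (1 - (cmod (G w))\<^sup>2) / cmod (exp w))\<^sup>2)"
    if w: "w \<in> D" for w
  proof -
    have "(conformal_factor (N w))\<^sup>2 = (conformal_factor (M w))\<^sup>2"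
      using J by (auto simp: M_def conformal_factor_swap adjugate_mat_1)
    then show ?thesis
      using null_frame_metric[OF frame _ f[OF exp_in_punctured_disk]] w D(3)
        norm_gauss_quotient(2)[OF M(1)[OF w] k(2)[OF w]]
      by (simp add: G_def power_divide subset_iff)
  qed
  show thesis
    using that[of G] G gauss_curvature_exp[OF D(1) k G metric]
    by (simp add: curvature_density_def D_def)
qed

lemma Ln_punctured_disk:
  assumes "z \<in> punctured_disk \<delta>"
  shows "exp (Ln z) = z" "Re (Ln z) = ln (cmod z)" "Re (Ln z) < ln \<delta>"
proof -
  have z: "0 < cmod z" "cmod z < \<delta>"
    using assms by (simp_all add: punctured_disk_def)
  then have "0 < \<delta>"
    by linarith
  with z show "exp (Ln z) = z" "Re (Ln z) = ln (cmod z)" "Re (Ln z) < ln \<delta>"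
    by simp_all
qed

lemma Schwarz_Pick_density_le:
  assumes "G holomorphic_on {w. Re w < c}" "\<And>w. Re w < c \<Longrightarrow> cmod (G w) < 1" and w: "Re w < c"
    and "x \<ge> 0"
  shows "(2 * cmod (deriv G w) / (1 - (cmod (G w))\<^sup>2) / x)\<^sup>2 \<le> (1 / (x * (c - Re w)))\<^sup>2"
proof -
  have "2 * cmod (deriv G w) / (1 - (cmod (G w))\<^sup>2) \<le> 1 / (c - Re w)"
    using Schwarz_Pick_half_plane_deriv[OF assms(1-3)] w by (simp add: field_simps)
  then have "2 * cmod (deriv G w) / (1 - (cmod (G w))\<^sup>2) / x \<le> 1 / (c - Re w) / x"
    using \<open>x \<ge> 0\<close> by (intro divide_right_mono)
  moreover have "1 - (cmod (G w))\<^sup>2 > 0"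
    using assms(2)[OF w] by (simp add: abs_square_less_1)
  ultimately have "(2 * cmod (deriv G w) / (1 - (cmod (G w))\<^sup>2) / x)\<^sup>2 \<le> (1 / (c - Re w) / x)\<^sup>2"
    using \<open>x \<ge> 0\<close> by (intro power_mono) simp_all
  then show ?thesis
    by (simp add: mult.commute)
qed

lemma finite_total_curvature_if_null_frame:
  assumes frame: "null_frame f F N" and f: "\<And>z. z \<in> punctured_disk 1 \<Longrightarrow> f differentiable (at z)"
    and \<delta>: "0 < \<delta>" "\<delta> \<le> 1"
    and nonzero: "\<And>w. Re w < ln \<delta> \<Longrightarrow> conformal_factor (N w) \<noteq> 0"
    and r: "r \<le> \<delta> * exp (-1)"
  shows "finite_total_curvature f (punctured_disk r)"
proof -
  have "ln \<delta> \<le> 0"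
    using \<delta> by simp
  then obtain G where G: "G holomorphic_on {w. Re w < ln \<delta>}" "\<And>w. Re w < ln \<delta> \<Longrightarrow> cmod (G w) < 1"
    and density: "\<And>w. Re w < ln \<delta> \<Longrightarrow> curvature_density f (exp w)
      = (2 * cmod (deriv G w) / (1 - (cmod (G w))\<^sup>2) / cmod (exp w))\<^sup>2"
    using null_frame_curvature_density[OF frame f _ nonzero] by blast
  have "1 - (cmod (G w))\<^sup>2 > 0" if "Re w < ln \<delta>" for w
    using G(2)[OF that] by (simp add: abs_square_less_1)
  then have "continuous_on {w. Re w < ln \<delta>}
      (\<lambda>w. (2 * cmod (deriv G w) / (1 - (cmod (G w))\<^sup>2) / cmod (exp w))\<^sup>2)"
    using holomorphic_on_imp_continuous_on[OF G(1)]
      holomorphic_on_imp_continuous_on[OF holomorphic_deriv[OF G(1) open_halfspace_Re_lt]]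
    by (intro continuous_intros) force+
  then have cont: "continuous_on {w. Re w < ln \<delta>} (\<lambda>w. curvature_density f (exp w))"
    by (rule continuous_on_eq) (simp add: density)
  have "\<delta> * exp (-1) \<le> \<delta> * 1"
    using \<delta>(1) by (intro mult_left_mono) auto
  then have "punctured_disk r \<subseteq> punctured_disk \<delta>"
    using r by (auto simp: punctured_disk_def)
  then have log: "exp (Ln z) = z" "Re (Ln z) = ln (cmod z)" "Re (Ln z) < ln \<delta>"
    if "z \<in> punctured_disk r" for z
    using Ln_punctured_disk that by blast+
  have "continuous_on (punctured_disk r) (curvature_density f)"
    using isCont_if_continuous_on_exp[OF open_halfspace_Re_lt _ cont] log
    by (metis continuous_at_imp_continuous_on mem_Collect_eq)
  moreover have "\<bar>curvature_density f z\<bar> \<le> (1 / (cmod z * (ln \<delta> - ln (cmod z))))\<^sup>2"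
    if "z \<in> punctured_disk r" for z
    using Schwarz_Pick_density_le[OF G log(3)[OF that], of "cmod z"] density[OF log(3)[OF that]]
    by (simp add: log(1,2)[OF that])
  ultimately have "set_integrable lborel (punctured_disk r) (curvature_density f)"
    by (rule set_integrable_cusp[OF \<delta>(1) r])
  then show ?thesis
    unfolding finite_total_curvature_def curvature_density_def .
qed

lemma complete_end_regular_radius:
  assumes "complete_end f"
  obtains \<delta> where "0 < \<delta>" "\<delta> \<le> 1"
    "\<And>F N w. null_frame f F N \<Longrightarrow> Re w < ln \<delta> \<Longrightarrow> conformal_factor (N w) \<noteq> 0"
proof -
  have face: "cmc1_face (punctured_disk 1) f"
    and regular: "\<not> 0 islimpt singular_set (punctured_disk 1) f"
    using assms by (auto simp: complete_end_def)
  obtain e where "e > 0" and singular_far: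
    "\<And>z. z \<in> singular_set (punctured_disk 1) f \<Longrightarrow> z \<noteq> 0 \<Longrightarrow> e \<le> cmod z"
    using regular unfolding islimpt_approachable by (auto simp: not_less)
  define \<delta> where "\<delta> = min e 1"
  have \<delta>: "0 < \<delta>" "\<delta> \<le> 1"
    using \<open>e > 0\<close> by (auto simp: \<delta>_def)
  have "conformal_factor (N w) \<noteq> 0" if frame: "null_frame f F N" and w: "Re w < ln \<delta>" for F N w
  proof
    assume degenerate: "conformal_factor (N w) = 0"
    have "ln \<delta> \<le> 0"
      using \<delta> by simp
    with w have "w \<in> left_half_plane"
      by (simp add: left_half_plane_def)
    note z = exp_in_punctured_disk[OF this]
      and metric = null_frame_metric[OF frame this cmc1_face_imp_differentiable[OF face z]]
    have "exp w \<in> singular_set (punctured_disk 1) f"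
      using z metric degenerate by (simp add: singular_set_def det_2 mat_def)
    moreover have "cmod (exp w) < \<delta>"
      using w \<delta>(1) by (simp add: ln_less_cancel_iff[symmetric] del: ln_less_cancel_iff)
    ultimately show False
      using singular_far[of "exp w"] by (simp add: \<delta>_def)
  qed
  with \<delta> show thesis
    using that by blast
qed

lemma complete_end_monodromy_trace_bound:
  assumes "complete_end f" "null_frame f F N" "has_monodromy F (su11 p q)"
    "(cmod p)\<^sup>2 - (cmod q)\<^sup>2 = 1"
  shows "\<bar>Re p\<bar> \<le> 1"
proof -
  obtain \<delta> where "0 < \<delta>" "\<delta> \<le> 1" "\<And>w. Re w < ln \<delta> \<Longrightarrow> conformal_factor (N w) \<noteq> 0"
    using complete_end_regular_radius[OF assms(1)] assms(2) by metis
  then show ?thesis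
    by (intro null_frame_monodromy_trace_bound[OF assms(2) _ _ assms(4,3), of "ln \<delta>"]) auto
qed

lemma complete_end_not_hyperbolic:
  assumes "complete_end f"
  shows "\<not> hyperbolic_end f"
proof
  assume "hyperbolic_end f"
  then obtain \<rho> F where \<rho>: "\<rho> \<in> SU11" "hyperbolic \<rho>" and F: "null_lift f F" "has_monodromy F \<rho>"
    unfolding hyperbolic_end_def end_monodromy_def has_monodromy_def by blast
  obtain p q where pq: "\<rho> = su11 p q" "(cmod p)\<^sup>2 - (cmod q)\<^sup>2 = 1"
    using SU11_E[OF \<rho>(1)] .
  obtain N where "null_frame f F N"
    using null_frame_of_null_lift[OF F(1)] .
  then have "\<bar>Re p\<bar> \<le> 1"
    using complete_end_monodromy_trace_bound[OF assms] F(2) pq by blast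
  moreover have "\<bar>Re p\<bar> > 1"
    using hyperbolic_su11_imp_Re_gt_1 \<rho>(2) pq(1) by blast
  ultimately show False by simp
qed

lemma complete_end_elliptic_or_parabolic:
  assumes "complete_end f"
  shows "elliptic_end f \<or> parabolic_end f"
proof -
  have face: "cmc1_face (punctured_disk 1) f"
    using assms by (simp add: complete_end_def)
  obtain F N \<rho> where frame: "null_frame f F N"
    and N: "\<And>w. w \<in> left_half_plane \<Longrightarrow> N w \<noteq> 0" "\<exists>w\<in>left_half_plane. N w $2$1 \<noteq> 0"
    and \<rho>: "\<rho> \<in> SU11" "has_monodromy F \<rho>"
    using null_frame_exists_nondegenerate[OF face] by blast
  obtain \<delta> where \<delta>: "0 < \<delta>" "\<delta> \<le> 1" "\<And>w. Re w < ln \<delta> \<Longrightarrow> conformal_factor (N w) \<noteq> 0"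
    using complete_end_regular_radius[OF assms] frame by metis
  have "ln \<delta> \<le> 0"
    using \<delta>(1,2) by simp
  then have "of_real (ln \<delta> - 1) \<in> left_half_plane" "conformal_factor (N (of_real (ln \<delta> - 1))) \<noteq> 0"
    using \<delta>(3) by (simp_all add: left_half_plane_def)
  then have "null_lift f F"
    using null_lift_of_null_frame[OF frame N] by blast
  then have monodromy: "end_monodromy f \<rho>"
    using \<rho> unfolding end_monodromy_def has_monodromy_def by blast
  obtain p q where pq: "\<rho> = su11 p q" "(cmod p)\<^sup>2 - (cmod q)\<^sup>2 = 1"
    using SU11_E[OF \<rho>(1)] .
  then have "\<bar>Re p\<bar> \<le> 1"
    using complete_end_monodromy_trace_bound[OF assms frame] \<rho>(2) by blast
  then have "elliptic \<rho> \<or> parabolic \<rho>"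
    using su11_elliptic_or_parabolic pq by blast
  with monodromy show ?thesis
    unfolding elliptic_end_def parabolic_end_def by blast
qed

lemma complete_end_finite_total_curvature:
  assumes "complete_end f"
  shows "\<forall>\<^sub>F r in at_right 0. finite_total_curvature f (punctured_disk r)"
proof -
  have face: "cmc1_face (punctured_disk 1) f"
    using assms by (simp add: complete_end_def)
  obtain F N \<rho> where frame: "null_frame f F N"
    using null_frame_exists[OF face] by blast
  obtain \<delta> where \<delta>: "0 < \<delta>" "\<delta> \<le> 1" "\<And>w. Re w < ln \<delta> \<Longrightarrow> conformal_factor (N w) \<noteq> 0"
    using complete_end_regular_radius[OF assms] frame by metis
  have "\<forall>\<^sub>F r in at_right 0. r \<in> {0<..<\<delta> * exp (-1)}"
    using \<delta>(1) by (intro eventually_at_right_real) simp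
  then show ?thesis
  proof eventually_elim
    case (elim r)
    then show ?case
      by (intro finite_total_curvature_if_null_frame[OF frame
            cmc1_face_imp_differentiable[OF face] \<delta>]) auto
  qed
qed

theorem theorem1:
  fixes f :: "complex \<Rightarrow> real^4"
  assumes "complete_end f"
  shows "\<not> hyperbolic_end f \<and> (elliptic_end f \<or> parabolic_end f) \<and>
         (\<forall>\<^sub>F r in at_right 0. finite_total_curvature f (punctured_disk r))"
proof (intro conjI)
  show "\<not> hyperbolic_end f"
    by (rule complete_end_not_hyperbolic[OF assms])
  show "elliptic_end f \<or> parabolic_end f"
    by (rule complete_end_elliptic_or_parabolic[OF assms])
  show "\<forall>\<^sub>F r in at_right 0. finite_total_curvature f (punctured_disk r)"
    by (rule complete_end_finite_total_curvature[OF assms])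
qed

end
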